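(* Let $P\colon K\to L$ be an opfibration of 2-categories and $F\colon J\to L$ any 2-functor, and assume all 2-cells of $L$ are invertible. Then the inclusion $i\colon \mathrm{pb}(P,F)\to(P\downarrow F)$ of the strict pullback into the lax comma object, $(k,j)\mapsto[k,1_{Pk},j]$ on objects, $(s,t)\mapsto[s,1,t]$ on 1-cells and $(\phi,\gamma)\mapsto[\phi,\gamma]$ on 2-cells, induces a homotopy equivalence of classifying spaces.
   Context: All 2-categories/2-functors are strict. Classifying space $BX=|NX|$, where $NX$ has $p$-simplices the normal oplax functors $[p]\to X$. Strict pullback $\mathrm{pb}(P,F)$: its $k$-cells are pairs $(w_1,w_2)$ of $k$-cells of $K$ and $J$ with $P(w_1)=F(w_2)$. Lax comma object $(P\downarrow F)$: objects $[x,f,z]$ with $x\in K$, $z\in J$, $f\colon Px\to Fz$; 1-cells $[s,\alpha,t]\colon[x,f,z]\to[x',f',z']$ with $s\colon x\to x'$, $t\colon z\to z'$, $\alpha\colon Ft\circ f\Rightarrow f'\circ Ps$; 2-cells $[\phi,\gamma]$ with $\phi\colon s\Rightarrow s'$, $\gamma\colon t\Rightarrow t'$, $(f'*P\phi)\circ\alpha=\alpha'\circ(F\gamma*f)$. Opfibration: for a 2-functor $P\colon K\to L$: (a) a 2-cell $\gamma\colon g\Rightarrow h$ between 1-cells $x\to y$ of $K$ is cartesian if for every $k\colon x\to y$, $\psi\colon k\Rightarrow h$ and $\phi\colon Pk\Rightarrow Pg$ with $P\psi=P\gamma\circ\phi$ there is a unique $\phi^c\colon k\Rightarrow g$ with $P\phi^c=\phi$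 and $\gamma\circ\phi^c=\psi$; (b) $P$ is a local fibration if every 2-cell $\alpha\colon f\Rightarrow Pg$ in $L$ has a cartesian lift $\hat\alpha\colon\hat g\Rightarrow g$ with $P\hat\alpha=\alpha$; (c) a 1-cell $h\colon a\to d$ of $K$ is opcartesian if (i) for every 1-cell $u\colon a\to b$, 1-cell $t\colon Pd\to Pb$ and invertible $\alpha\colon t\circ Ph\Rightarrow Pu$, there exist $\tilde t\colon d\to b$ and invertible $\alpha_1\colon t\Rightarrow P\tilde t$, $\alpha_2\colon\tilde t\circ h\Rightarrow u$ with $\alpha=P\alpha_2\circ(\alpha_1*Ph)$ (a "lift" of $(u,t,\alpha)$), and (ii) given $\beta\colon t\Rightarrow t'$, $\rho\colon u\Rightarrow u'$, invertible $\alpha\colon t\circ Ph\Rightarrow Pu$, $\alpha'\colon t'\circ Ph\Rightarrow Pu'$ with $P\rho\circ\alpha=\alpha'\circ(\beta*Ph)$, and lifts $(\tilde t,\alpha_1,\alpha_2)$, $(\tilde t',\alpha'_1,\alpha'_2)$ of $(u,t,\alpha)$, $(u',t',\alpha')$, there is a unique $\tilde\beta\colon\tilde t\Rightarrow\tilde t'$ with $P\tilde\beta\circ\alpha_1=\alpha_1'\circ\beta$ and $\rho\circ\alpha_2=\alpha_2'\circ(\tilde\beta*h)$. $P$ is an opfibration if every 1-cell $f\colon Px\to z$ of $L$ has an opcartesian lift $\hat f\colon x\to\hat x$ with $P\hat f=f$, $P$ is a local fibration, and horizontal composites of cartesian 2-cells are cartesian. *)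

theory Defs
  imports "HOL-Homology.Simplices"
begin

text \<open>A strict 2-category: objects, 1-cells, 2-cells.  cmp g f is g after f;
  vcmp b a is b after a (vertical); hcmp b a is the horizontal composite b * a,
  where a : f => f' with f : x -> y and b : g => g' with g : y -> z.\<close>

record ('o,'a,'c) cat2 =
  Obj  :: "'o set"
  Hom  :: "'a set"
  Cell :: "'c set"
  src  :: "'a \<Rightarrow> 'o"
  tgt  :: "'a \<Rightarrow> 'o"
  idm  :: "'o \<Rightarrow> 'a"
  cmp  :: "'a \<Rightarrow> 'a \<Rightarrow> 'a"
  dom2 :: "'c \<Rightarrow> 'a"
  cod2 :: "'c \<Rightarrow> 'a"
  id2  :: "'a \<Rightarrow> 'c"
  vcmp :: "'c \<Rightarrow> 'c \<Rightarrow> 'c"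
  hcmp :: "'c \<Rightarrow> 'c \<Rightarrow> 'c"

definition strict_2cat :: "('o,'a,'c,'m) cat2_scheme \<Rightarrow> bool" where
  "strict_2cat C \<longleftrightarrow>
    (\<forall>f\<in>Hom C. src C f \<in> Obj C \<and> tgt C f \<in> Obj C) \<and>
    (\<forall>x\<in>Obj C. idm C x \<in> Hom C \<and> src C (idm C x) = x \<and> tgt C (idm C x) = x) \<and>
    (\<forall>f\<in>Hom C. \<forall>g\<in>Hom C. tgt C f = src C g \<longrightarrow>
        cmp C g f \<in> Hom C \<and> src C (cmp C g f) = src C f \<and> tgt C (cmp C g f) = tgt C g) \<and>
    (\<forall>f\<in>Hom C. \<forall>g\<in>Hom C. \<forall>h\<in>Hom C. tgt C f = src C g \<and> tgt C g = src C h \<longrightarrow>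
        cmp C h (cmp C g f) = cmp C (cmp C h g) f) \<and>
    (\<forall>f\<in>Hom C. cmp C (idm C (tgt C f)) f = f \<and> cmp C f (idm C (src C f)) = f) \<and>
    (\<forall>a\<in>Cell C. dom2 C a \<in> Hom C \<and> cod2 C a \<in> Hom C \<and>
        src C (dom2 C a) = src C (cod2 C a) \<and> tgt C (dom2 C a) = tgt C (cod2 C a)) \<and>
    (\<forall>f\<in>Hom C. id2 C f \<in> Cell C \<and> dom2 C (id2 C f) = f \<and> cod2 C (id2 C f) = f) \<and>
    (\<forall>a\<in>Cell C. \<forall>b\<in>Cell C. cod2 C a = dom2 C b \<longrightarrow>
        vcmp C b a \<in> Cell C \<and> dom2 C (vcmp C b a) = dom2 C a \<and> cod2 C (vcmp C b a) = cod2 C b) \<and>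
    (\<forall>a\<in>Cell C. \<forall>b\<in>Cell C. \<forall>c\<in>Cell C. cod2 C a = dom2 C b \<and> cod2 C b = dom2 C c \<longrightarrow>
        vcmp C c (vcmp C b a) = vcmp C (vcmp C c b) a) \<and>
    (\<forall>a\<in>Cell C. vcmp C (id2 C (cod2 C a)) a = a \<and> vcmp C a (id2 C (dom2 C a)) = a) \<and>
    (\<forall>a\<in>Cell C. \<forall>b\<in>Cell C. tgt C (dom2 C a) = src C (dom2 C b) \<longrightarrow>
        hcmp C b a \<in> Cell C \<and> dom2 C (hcmp C b a) = cmp C (dom2 C b) (dom2 C a) \<and>
        cod2 C (hcmp C b a) = cmp C (cod2 C b) (cod2 C a)) \<and>
    (\<forall>a\<in>Cell C. \<forall>b\<in>Cell C. \<forall>c\<in>Cell C.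
        tgt C (dom2 C a) = src C (dom2 C b) \<and> tgt C (dom2 C b) = src C (dom2 C c) \<longrightarrow>
        hcmp C c (hcmp C b a) = hcmp C (hcmp C c b) a) \<and>
    (\<forall>a\<in>Cell C. hcmp C (id2 C (idm C (tgt C (dom2 C a)))) a = a \<and>
        hcmp C a (id2 C (idm C (src C (dom2 C a)))) = a) \<and>
    (\<forall>f\<in>Hom C. \<forall>g\<in>Hom C. tgt C f = src C g \<longrightarrow>
        hcmp C (id2 C g) (id2 C f) = id2 C (cmp C g f)) \<and>
    (\<forall>a\<in>Cell C. \<forall>a'\<in>Cell C. \<forall>b\<in>Cell C. \<forall>b'\<in>Cell C.
        cod2 C a = dom2 C a' \<and> cod2 C b = dom2 C b' \<and> tgt C (dom2 C a) = src C (dom2 C b) \<longrightarrow>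
        hcmp C (vcmp C b' b) (vcmp C a' a) = vcmp C (hcmp C b' a') (hcmp C b a))"

record ('o,'a,'c,'o2,'a2,'c2) fun2 =
  fob   :: "'o \<Rightarrow> 'o2"
  fhom  :: "'a \<Rightarrow> 'a2"
  fcell :: "'c \<Rightarrow> 'c2"

definition strict_2functor ::
  "('o,'a,'c,'m) cat2_scheme \<Rightarrow> ('o2,'a2,'c2,'n) cat2_scheme \<Rightarrow> ('o,'a,'c,'o2,'a2,'c2) fun2 \<Rightarrow> bool" where
  "strict_2functor C D G \<longleftrightarrow>
    (\<forall>x\<in>Obj C. fob G x \<in> Obj D) \<and>
    (\<forall>f\<in>Hom C. fhom G f \<in> Hom D \<and> src D (fhom G f) = fob G (src C f) \<and>
        tgt D (fhom G f) = fob G (tgt C f)) \<and>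
    (\<forall>a\<in>Cell C. fcell G a \<in> Cell D \<and> dom2 D (fcell G a) = fhom G (dom2 C a) \<and>
        cod2 D (fcell G a) = fhom G (cod2 C a)) \<and>
    (\<forall>x\<in>Obj C. fhom G (idm C x) = idm D (fob G x)) \<and>
    (\<forall>f\<in>Hom C. \<forall>g\<in>Hom C. tgt C f = src C g \<longrightarrow> fhom G (cmp C g f) = cmp D (fhom G g) (fhom G f)) \<and>
    (\<forall>f\<in>Hom C. fcell G (id2 C f) = id2 D (fhom G f)) \<and>
    (\<forall>a\<in>Cell C. \<forall>b\<in>Cell C. cod2 C a = dom2 C b \<longrightarrow>
        fcell G (vcmp C b a) = vcmp D (fcell G b) (fcell G a)) \<and>
    (\<forall>a\<in>Cell C. \<forall>b\<in>Cell C. tgt C (dom2 C a) = src C (dom2 C b) \<longrightarrow>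
        fcell G (hcmp C b a) = hcmp D (fcell G b) (fcell G a))"

definition iso2 :: "('o,'a,'c,'m) cat2_scheme \<Rightarrow> 'c \<Rightarrow> bool" where
  "iso2 C a \<longleftrightarrow> a \<in> Cell C \<and> (\<exists>b\<in>Cell C. dom2 C b = cod2 C a \<and> cod2 C b = dom2 C a \<and>
      vcmp C b a = id2 C (dom2 C a) \<and> vcmp C a b = id2 C (cod2 C a))"

definition cartesian2 ::
  "('o,'a,'c,'m) cat2_scheme \<Rightarrow> ('o2,'a2,'c2,'n) cat2_scheme \<Rightarrow> ('o,'a,'c,'o2,'a2,'c2) fun2 \<Rightarrow> 'c \<Rightarrow> bool" where
  "cartesian2 K L P gam \<longleftrightarrow> gam \<in> Cell K \<and>
    (\<forall>k psi phi. k \<in> Hom K \<and> src K k = src K (dom2 K gam) \<and> tgt K k = tgt K (dom2 K gam) \<and>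
       psi \<in> Cell K \<and> dom2 K psi = k \<and> cod2 K psi = cod2 K gam \<and>
       phi \<in> Cell L \<and> dom2 L phi = fhom P k \<and> cod2 L phi = fhom P (dom2 K gam) \<and>
       fcell P psi = vcmp L (fcell P gam) phi \<longrightarrow>
       (\<exists>!phic. phic \<in> Cell K \<and> dom2 K phic = k \<and> cod2 K phic = dom2 K gam \<and>
          fcell P phic = phi \<and> vcmp K gam phic = psi))"

definition local_fibration ::
  "('o,'a,'c,'m) cat2_scheme \<Rightarrow> ('o2,'a2,'c2,'n) cat2_scheme \<Rightarrow> ('o,'a,'c,'o2,'a2,'c2) fun2 \<Rightarrow> bool" where
  "local_fibration K L P \<longleftrightarrow>
    (\<forall>alpha\<in>Cell L. \<forall>g\<in>Hom K. cod2 L alpha = fhom P g \<longrightarrow>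
       (\<exists>ahat. ahat \<in> Cell K \<and> cod2 K ahat = g \<and> fcell P ahat = alpha \<and> cartesian2 K L P ahat))"

definition opc_lift ::
  "('o,'a,'c,'m) cat2_scheme \<Rightarrow> ('o2,'a2,'c2,'n) cat2_scheme \<Rightarrow> ('o,'a,'c,'o2,'a2,'c2) fun2 \<Rightarrow>
   'a \<Rightarrow> 'a \<Rightarrow> 'a2 \<Rightarrow> 'c2 \<Rightarrow> 'a \<Rightarrow> 'c2 \<Rightarrow> 'c \<Rightarrow> bool" where
  "opc_lift K L P h u t alpha tt a1 a2 \<longleftrightarrow>
    tt \<in> Hom K \<and> src K tt = tgt K h \<and> tgt K tt = tgt K u \<and>
    iso2 L a1 \<and> dom2 L a1 = t \<and> cod2 L a1 = fhom P tt \<and>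
    iso2 K a2 \<and> dom2 K a2 = cmp K tt h \<and> cod2 K a2 = u \<and>
    alpha = vcmp L (fcell P a2) (hcmp L a1 (id2 L (fhom P h)))"

definition opcartesian1 ::
  "('o,'a,'c,'m) cat2_scheme \<Rightarrow> ('o2,'a2,'c2,'n) cat2_scheme \<Rightarrow> ('o,'a,'c,'o2,'a2,'c2) fun2 \<Rightarrow> 'a \<Rightarrow> bool" where
  "opcartesian1 K L P h \<longleftrightarrow> h \<in> Hom K \<and>
    (\<forall>u t alpha. u \<in> Hom K \<and> src K u = src K h \<and>
       t \<in> Hom L \<and> src L t = fob P (tgt K h) \<and> tgt L t = fob P (tgt K u) \<and>
       iso2 L alpha \<and> dom2 L alpha = cmp L t (fhom P h) \<and> cod2 L alpha = fhom P u \<longrightarrow>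
       (\<exists>tt a1 a2. opc_lift K L P h u t alpha tt a1 a2)) \<and>
    (\<forall>u u' t t' beta rho alpha alpha' tt a1 a2 tt' a1' a2'.
       u \<in> Hom K \<and> src K u = src K h \<and> u' \<in> Hom K \<and> src K u' = src K h \<and> tgt K u' = tgt K u \<and>
       t \<in> Hom L \<and> src L t = fob P (tgt K h) \<and> tgt L t = fob P (tgt K u) \<and>
       t' \<in> Hom L \<and> src L t' = fob P (tgt K h) \<and> tgt L t' = fob P (tgt K u) \<and>
       beta \<in> Cell L \<and> dom2 L beta = t \<and> cod2 L beta = t' \<and>
       rho \<in> Cell K \<and> dom2 K rho = u \<and> cod2 K rho = u' \<and>
       iso2 L alpha \<and> dom2 L alpha = cmp L t (fhom P h) \<and> cod2 L alpha = fhom P u \<and>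
       iso2 L alpha' \<and> dom2 L alpha' = cmp L t' (fhom P h) \<and> cod2 L alpha' = fhom P u' \<and>
       vcmp L (fcell P rho) alpha = vcmp L alpha' (hcmp L beta (id2 L (fhom P h))) \<and>
       opc_lift K L P h u t alpha tt a1 a2 \<and> opc_lift K L P h u' t' alpha' tt' a1' a2' \<longrightarrow>
       (\<exists>!bt. bt \<in> Cell K \<and> dom2 K bt = tt \<and> cod2 K bt = tt' \<and>
          vcmp L (fcell P bt) a1 = vcmp L a1' beta \<and>
          vcmp K rho a2 = vcmp K a2' (hcmp K bt (id2 K h))))"

definition opfibration ::
  "('o,'a,'c,'m) cat2_scheme \<Rightarrow> ('o2,'a2,'c2,'n) cat2_scheme \<Rightarrow> ('o,'a,'c,'o2,'a2,'c2) fun2 \<Rightarrow> bool" where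
  "opfibration K L P \<longleftrightarrow> strict_2functor K L P \<and>
    (\<forall>x\<in>Obj K. \<forall>f\<in>Hom L. src L f = fob P x \<longrightarrow>
       (\<exists>hh. hh \<in> Hom K \<and> src K hh = x \<and> fhom P hh = f \<and> opcartesian1 K L P hh)) \<and>
    local_fibration K L P \<and>
    (\<forall>a b. cartesian2 K L P a \<and> cartesian2 K L P b \<and> tgt K (dom2 K a) = src K (dom2 K b) \<longrightarrow>
       cartesian2 K L P (hcmp K b a))"

definition pb ::
  "('o,'a,'c,'m) cat2_scheme \<Rightarrow> ('o3,'a3,'c3,'k) cat2_scheme \<Rightarrow>
   ('o,'a,'c,'o2,'a2,'c2) fun2 \<Rightarrow> ('o3,'a3,'c3,'o2,'a2,'c2) fun2 \<Rightarrow>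
   ('o \<times> 'o3, 'a \<times> 'a3, 'c \<times> 'c3) cat2" where
  "pb K J P F = \<lparr>
     Obj = {(k,j). k \<in> Obj K \<and> j \<in> Obj J \<and> fob P k = fob F j},
     Hom = {(s,t). s \<in> Hom K \<and> t \<in> Hom J \<and> fhom P s = fhom F t},
     Cell = {(p,g). p \<in> Cell K \<and> g \<in> Cell J \<and> fcell P p = fcell F g},
     src = (\<lambda>(s,t). (src K s, src J t)),
     tgt = (\<lambda>(s,t). (tgt K s, tgt J t)),
     idm = (\<lambda>(k,j). (idm K k, idm J j)),
     cmp = (\<lambda>(s',t') (s,t). (cmp K s' s, cmp J t' t)),
     dom2 = (\<lambda>(p,g). (dom2 K p, dom2 J g)),
     cod2 = (\<lambda>(p,g). (cod2 K p, cod2 J g)),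
     id2 = (\<lambda>(s,t). (id2 K s, id2 J t)),
     vcmp = (\<lambda>(p',g') (p,g). (vcmp K p' p, vcmp J g' g)),
     hcmp = (\<lambda>(p',g') (p,g). (hcmp K p' p, hcmp J g' g)) \<rparr>"

type_synonym ('o,'a2,'o3) cobj = "'o \<times> 'a2 \<times> 'o3"
type_synonym ('o,'a,'a2,'c2,'o3,'a3) chom =
  "('o,'a2,'o3) cobj \<times> 'a \<times> 'c2 \<times> 'a3 \<times> ('o,'a2,'o3) cobj"
type_synonym ('o,'a,'c,'a2,'c2,'o3,'a3,'c3) ccell =
  "('o,'a,'a2,'c2,'o3,'a3) chom \<times> 'c \<times> 'c3 \<times> ('o,'a,'a2,'c2,'o3,'a3) chom"

definition comma_cmp ::
  "('o2,'a2,'c2,'n) cat2_scheme \<Rightarrow> ('o,'a,'c,'o2,'a2,'c2) fun2 \<Rightarrow> ('o3,'a3,'c3,'o2,'a2,'c2) fun2 \<Rightarrow>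
   ('o,'a,'c,'m) cat2_scheme \<Rightarrow> ('o3,'a3,'c3,'k) cat2_scheme \<Rightarrow>
   ('o,'a,'a2,'c2,'o3,'a3) chom \<Rightarrow> ('o,'a,'a2,'c2,'o3,'a3) chom \<Rightarrow> ('o,'a,'a2,'c2,'o3,'a3) chom" where
  "comma_cmp L P F K J = (\<lambda>(Y,s',alpha',t',Z) (X,s,alpha,t,Y0).
     (X, cmp K s' s,
      vcmp L (hcmp L alpha' (id2 L (fhom P s))) (hcmp L (id2 L (fhom F t')) alpha),
      cmp J t' t, Z))"

definition comma ::
  "('o,'a,'c,'m) cat2_scheme \<Rightarrow> ('o2,'a2,'c2,'n) cat2_scheme \<Rightarrow> ('o3,'a3,'c3,'k) cat2_scheme \<Rightarrow>
   ('o,'a,'c,'o2,'a2,'c2) fun2 \<Rightarrow> ('o3,'a3,'c3,'o2,'a2,'c2) fun2 \<Rightarrow>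
   (('o,'a2,'o3) cobj, ('o,'a,'a2,'c2,'o3,'a3) chom, ('o,'a,'c,'a2,'c2,'o3,'a3,'c3) ccell) cat2" where
  "comma K L J P F = \<lparr>
     Obj = {(x,f,z). x \<in> Obj K \<and> z \<in> Obj J \<and> f \<in> Hom L \<and> src L f = fob P x \<and> tgt L f = fob F z},
     Hom = {((x,f,z),s,alpha,t,(x',f',z')) | x f z s alpha t x' f' z'.
              x \<in> Obj K \<and> z \<in> Obj J \<and> f \<in> Hom L \<and> src L f = fob P x \<and> tgt L f = fob F z \<and>
              x' \<in> Obj K \<and> z' \<in> Obj J \<and> f' \<in> Hom L \<and> src L f' = fob P x' \<and> tgt L f' = fob F z' \<and>
              s \<in> Hom K \<and> src K s = x \<and> tgt K s = x' \<and>
              t \<in> Hom J \<and> src J t = z \<and> tgt J t = z' \<and>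
              alpha \<in> Cell L \<and> dom2 L alpha = cmp L (fhom F t) f \<and> cod2 L alpha = cmp L f' (fhom P s)},
     Cell = {(((x,f,z),s,alpha,t,(x',f',z')), phi, gam, ((x,f,z),s',alpha',t',(x',f',z')))
             | x f z s alpha t x' f' z' s' alpha' t' phi gam.
              ((x,f,z),s,alpha,t,(x',f',z')) \<in>
                {((x,f,z),s,alpha,t,(x',f',z')) | x f z s alpha t x' f' z'.
                  x \<in> Obj K \<and> z \<in> Obj J \<and> f \<in> Hom L \<and> src L f = fob P x \<and> tgt L f = fob F z \<and>
                  x' \<in> Obj K \<and> z' \<in> Obj J \<and> f' \<in> Hom L \<and> src L f' = fob P x' \<and> tgt L f' = fob F z' \<and>
                  s \<in> Hom K \<and> src K s = x \<and> tgt K s = x' \<and>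
                  t \<in> Hom J \<and> src J t = z \<and> tgt J t = z' \<and>
                  alpha \<in> Cell L \<and> dom2 L alpha = cmp L (fhom F t) f \<and> cod2 L alpha = cmp L f' (fhom P s)} \<and>
              ((x,f,z),s',alpha',t',(x',f',z')) \<in>
                {((x,f,z),s,alpha,t,(x',f',z')) | x f z s alpha t x' f' z'.
                  x \<in> Obj K \<and> z \<in> Obj J \<and> f \<in> Hom L \<and> src L f = fob P x \<and> tgt L f = fob F z \<and>
                  x' \<in> Obj K \<and> z' \<in> Obj J \<and> f' \<in> Hom L \<and> src L f' = fob P x' \<and> tgt L f' = fob F z' \<and>
                  s \<in> Hom K \<and> src K s = x \<and> tgt K s = x' \<and>
                  t \<in> Hom J \<and> src J t = z \<and> tgt J t = z' \<and>
                  alpha \<in> Cell L \<and> dom2 L alpha = cmp L (fhom F t) f \<and> cod2 L alpha = cmp L f' (fhom P s)} \<and>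
              phi \<in> Cell K \<and> dom2 K phi = s \<and> cod2 K phi = s' \<and>
              gam \<in> Cell J \<and> dom2 J gam = t \<and> cod2 J gam = t' \<and>
              vcmp L (hcmp L (id2 L f') (fcell P phi)) alpha = vcmp L alpha' (hcmp L (fcell F gam) (id2 L f))},
     src = (\<lambda>(X,s,alpha,t,X'). X),
     tgt = (\<lambda>(X,s,alpha,t,X'). X'),
     idm = (\<lambda>(x,f,z). ((x,f,z), idm K x, id2 L f, idm J z, (x,f,z))),
     cmp = comma_cmp L P F K J,
     dom2 = (\<lambda>(A,phi,gam,A'). A),
     cod2 = (\<lambda>(A,phi,gam,A'). A'),
     id2 = (\<lambda>(X,s,alpha,t,X'). ((X,s,alpha,t,X'), id2 K s, id2 J t, (X,s,alpha,t,X'))),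
     vcmp = (\<lambda>(B,phi',gam',C) (A,phi,gam,B0). (A, vcmp K phi' phi, vcmp J gam' gam, C)),
     hcmp = (\<lambda>(B,psi,del,B') (A,phi,gam,A').
               (comma_cmp L P F K J B A, hcmp K psi phi, hcmp J del gam, comma_cmp L P F K J B' A')) \<rparr>"

definition incl_ob :: "('o2,'a2,'c2,'n) cat2_scheme \<Rightarrow> ('o,'a,'c,'o2,'a2,'c2) fun2 \<Rightarrow>
    'o \<times> 'o3 \<Rightarrow> ('o,'a2,'o3) cobj" where
  "incl_ob L P = (\<lambda>(k,j). (k, idm L (fob P k), j))"

definition incl_hom ::
  "('o,'a,'c,'m) cat2_scheme \<Rightarrow> ('o2,'a2,'c2,'n) cat2_scheme \<Rightarrow> ('o3,'a3,'c3,'k) cat2_scheme \<Rightarrow>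
   ('o,'a,'c,'o2,'a2,'c2) fun2 \<Rightarrow> 'a \<times> 'a3 \<Rightarrow> ('o,'a,'a2,'c2,'o3,'a3) chom" where
  "incl_hom K L J P = (\<lambda>(s,t). (incl_ob L P (src K s, src J t), s, id2 L (fhom P s), t,
                                incl_ob L P (tgt K s, tgt J t)))"

definition incl ::
  "('o,'a,'c,'m) cat2_scheme \<Rightarrow> ('o2,'a2,'c2,'n) cat2_scheme \<Rightarrow> ('o3,'a3,'c3,'k) cat2_scheme \<Rightarrow>
   ('o,'a,'c,'o2,'a2,'c2) fun2 \<Rightarrow>
   ('o \<times> 'o3, 'a \<times> 'a3, 'c \<times> 'c3, ('o,'a2,'o3) cobj, ('o,'a,'a2,'c2,'o3,'a3) chom,
    ('o,'a,'c,'a2,'c2,'o3,'a3,'c3) ccell) fun2" where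
  "incl K L J P = \<lparr> fob = incl_ob L P,
     fhom = incl_hom K L J P,
     fcell = (\<lambda>(phi,gam). (incl_hom K L J P (dom2 K phi, dom2 J gam), phi, gam,
                           incl_hom K L J P (cod2 K phi, cod2 J gam))) \<rparr>"

text \<open>A p-simplex of NX: a normal oplax functor [p] -> X, given by objects x i,
  1-cells f i j : x i -> x j (i <= j), with f i i identities, and 2-cells
  c i j k : f i k => f j k o f i j (i <= j <= k), normal (c i i j = c i j j = identity)
  and satisfying the oplax associativity coherence.  Data outside the range is undefined.\<close>

type_synonym ('o,'a,'c) simplex = "(nat \<Rightarrow> 'o) \<times> (nat \<Rightarrow> nat \<Rightarrow> 'a) \<times> (nat \<Rightarrow> nat \<Rightarrow> nat \<Rightarrow> 'c)"

definition nerve_simplex :: "('o,'a,'c,'m) cat2_scheme \<Rightarrow> nat \<Rightarrow> ('o,'a,'c) simplex \<Rightarrow> bool" where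
  "nerve_simplex C p \<sigma> \<longleftrightarrow> (case \<sigma> of (x,f,c) \<Rightarrow>
     (\<forall>i. p < i \<longrightarrow> x i = undefined) \<and>
     (\<forall>i j. \<not> (i \<le> j \<and> j \<le> p) \<longrightarrow> f i j = undefined) \<and>
     (\<forall>i j k. \<not> (i \<le> j \<and> j \<le> k \<and> k \<le> p) \<longrightarrow> c i j k = undefined) \<and>
     (\<forall>i\<le>p. x i \<in> Obj C) \<and>
     (\<forall>i j. i \<le> j \<and> j \<le> p \<longrightarrow> f i j \<in> Hom C \<and> src C (f i j) = x i \<and> tgt C (f i j) = x j) \<and>
     (\<forall>i\<le>p. f i i = idm C (x i)) \<and>
     (\<forall>i j k. i \<le> j \<and> j \<le> k \<and> k \<le> p \<longrightarrow>
        c i j k \<in> Cell C \<and> dom2 C (c i j k) = f i k \<and> cod2 C (c i j k) = cmp C (f j k) (f i j)) \<and>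
     (\<forall>i j. i \<le> j \<and> j \<le> p \<longrightarrow> c i i j = id2 C (f i j) \<and> c i j j = id2 C (f i j)) \<and>
     (\<forall>i j k l. i \<le> j \<and> j \<le> k \<and> k \<le> l \<and> l \<le> p \<longrightarrow>
        vcmp C (hcmp C (c j k l) (id2 C (f i j))) (c i j l) =
        vcmp C (hcmp C (id2 C (f k l)) (c i j k)) (c i k l)))"

definition simp_op :: "(nat \<Rightarrow> nat) \<Rightarrow> nat \<Rightarrow> ('o,'a,'c) simplex \<Rightarrow> ('o,'a,'c) simplex" where
  "simp_op \<theta> p \<sigma> = (case \<sigma> of (x,f,c) \<Rightarrow>
     (\<lambda>i. if i \<le> p then x (\<theta> i) else undefined,
      \<lambda>i j. if i \<le> j \<and> j \<le> p then f (\<theta> i) (\<theta> j) else undefined,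
      \<lambda>i j k. if i \<le> j \<and> j \<le> k \<and> k \<le> p then c (\<theta> i) (\<theta> j) (\<theta> k) else undefined))"

definition push_simplex :: "(nat \<Rightarrow> nat) \<Rightarrow> nat \<Rightarrow> (nat \<Rightarrow> real) \<Rightarrow> (nat \<Rightarrow> real)" where
  "push_simplex \<theta> p t = (\<lambda>j. \<Sum>i\<in>{i. i \<le> p \<and> \<theta> i = j}. t i)"

definition nerve_elems :: "('o,'a,'c,'m) cat2_scheme \<Rightarrow> (nat \<times> ('o,'a,'c) simplex \<times> (nat \<Rightarrow> real)) set" where
  "nerve_elems C = {(p,\<sigma>,t). nerve_simplex C p \<sigma> \<and> t \<in> standard_simplex p}"

definition nerve_rel :: "('o,'a,'c,'m) cat2_scheme \<Rightarrow>
   ((nat \<times> ('o,'a,'c) simplex \<times> (nat \<Rightarrow> real)) \<times> (nat \<times> ('o,'a,'c) simplex \<times> (nat \<Rightarrow> real))) set" where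
  "nerve_rel C = {((p, simp_op \<theta> p \<sigma>, t), (q, \<sigma>, push_simplex \<theta> p t)) | p q \<theta> \<sigma> t.
      (\<forall>i\<le>p. \<theta> i \<le> q) \<and> (\<forall>i j. i \<le> j \<and> j \<le> p \<longrightarrow> \<theta> i \<le> \<theta> j) \<and>
      nerve_simplex C q \<sigma> \<and> t \<in> standard_simplex p}"

definition nerve_equiv :: "('o,'a,'c,'m) cat2_scheme \<Rightarrow>
   ((nat \<times> ('o,'a,'c) simplex \<times> (nat \<Rightarrow> real)) \<times> (nat \<times> ('o,'a,'c) simplex \<times> (nat \<Rightarrow> real))) set" where
  "nerve_equiv C = (nerve_rel C \<union> (nerve_rel C)\<inverse>)\<^sup>*"

definition real_class :: "('o,'a,'c,'m) cat2_scheme \<Rightarrow> nat \<times> ('o,'a,'c) simplex \<times> (nat \<Rightarrow> real) \<Rightarrow>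
    (nat \<times> ('o,'a,'c) simplex \<times> (nat \<Rightarrow> real)) set" where
  "real_class C a = nerve_equiv C `` {a}"

definition classifying_space :: "('o,'a,'c,'m) cat2_scheme \<Rightarrow>
    (nat \<times> ('o,'a,'c) simplex \<times> (nat \<Rightarrow> real)) set topology" where
  "classifying_space C = topology (\<lambda>U. U \<subseteq> nerve_elems C // nerve_equiv C \<and>
     (\<forall>p \<sigma>. nerve_simplex C p \<sigma> \<longrightarrow>
        openin (subtopology (powertop_real UNIV) (standard_simplex p))
               {t \<in> standard_simplex p. real_class C (p,\<sigma>,t) \<in> U}))"

definition nerve_map :: "('o,'a,'c,'o2,'a2,'c2) fun2 \<Rightarrow> nat \<Rightarrow> ('o,'a,'c) simplex \<Rightarrow> ('o2,'a2,'c2) simplex" where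
  "nerve_map G p \<sigma> = (case \<sigma> of (x,f,c) \<Rightarrow>
     (\<lambda>i. if i \<le> p then fob G (x i) else undefined,
      \<lambda>i j. if i \<le> j \<and> j \<le> p then fhom G (f i j) else undefined,
      \<lambda>i j k. if i \<le> j \<and> j \<le> k \<and> k \<le> p then fcell G (c i j k) else undefined))"

definition B_map :: "('o2,'a2,'c2,'n) cat2_scheme \<Rightarrow> ('o,'a,'c,'o2,'a2,'c2) fun2 \<Rightarrow>
    (nat \<times> ('o,'a,'c) simplex \<times> (nat \<Rightarrow> real)) set \<Rightarrow> (nat \<times> ('o2,'a2,'c2) simplex \<times> (nat \<Rightarrow> real)) set" where
  "B_map D G c = (case (SOME a. a \<in> c) of (p,\<sigma>,t) \<Rightarrow> real_class D (p, nerve_map G p \<sigma>, t))"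

definition homotopy_equivalence_map :: "'a topology \<Rightarrow> 'b topology \<Rightarrow> ('a \<Rightarrow> 'b) \<Rightarrow> bool" where
  "homotopy_equivalence_map X Y f \<longleftrightarrow> continuous_map X Y f \<and>
     (\<exists>g. continuous_map Y X g \<and> homotopic_with (\<lambda>h. True) X X (g \<circ> f) id \<and>
          homotopic_with (\<lambda>h. True) Y Y (f \<circ> g) id)"

end

theory Submission
  imports Defs "HOL-Analysis.Abstract_Topological_Spaces"
begin

text \<open>
  Choose an opcartesian lift \<open>h: x \<rightarrow> y\<close> of every \<open>f: P x \<rightarrow> F z\<close>, taking \<open>h = 1\<close> when \<open>f = 1\<close>. Then
  \<open>[h, 1, 1]\<close> is a 1-cell from \<open>[x, f, z]\<close> to \<open>[y, 1, z]\<close>, an object of the pullback. Since the 2-cells of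
  the base are invertible, opcartesianness followed by correction along a cartesian lift yields, for every
  1-cell of the comma object, a 1-cell of the pullback between the chosen targets and an
  invertible 2-cell filling the square; this filler can be taken to be an identity on the image of the pullback.
  Whiskering with \<open>[h, 1, 1]\<close> is bijective on 2-cells between 1-cells of the pullback, so any simplex of the nerve
  can be moved, all at once or only on a final segment of its vertices, along these 1-cells. Moving all vertices gives a
  strict retraction of the nerve of the comma object onto that of the pullback, and moving final segments
  is a simplicial homotopy from the identity to this retraction.
\<close>

text \<open>The retraction need not be a 2-functor: the 1-cell chosen for a composite need not be
  the composite of the chosen ones. Oplax simplices absorb this, since the comparison is again a
  structure cell, and bijectivity of whiskering makes it unique; so choices are made once for every
  object and 1-cell, and compatibility with faces and degeneracies is automatic. Identities must go
  to identities because simplices are normal. Final segments are moved because the chosen 1-cells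
  point from an object to its moved copy: an edge from an unmoved to a moved vertex can be composed
  with one of them, while the opposite kind of edge would need an inverse. Invertibility in the base
  matters because opcartesian factorization is assumed for invertible 2-cells only. The
  factorization lies over the prescribed 1-cell only up to an invertible 2-cell, while the strict
  pullback asks for equality; hence the cartesian correction. The product of the interval with the
  quotient space is again a quotient, the interval being locally compact Hausdorff, so the homotopy
  may be built on prisms over single simplices.\<close>

section \<open>Classifying spaces as quotients\<close>

definition mono_upto :: "(nat \<Rightarrow> nat) \<Rightarrow> nat \<Rightarrow> nat \<Rightarrow> bool" where
  "mono_upto \<theta> p q \<longleftrightarrow> (\<forall>i\<le>p. \<theta> i \<le> q) \<and> (\<forall>i j. i \<le> j \<and> j \<le> p \<longrightarrow> \<theta> i \<le> \<theta> j)"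

lemma simp_op_cong: "(\<And>i. i \<le> p \<Longrightarrow> \<theta> i = \<eta> i) \<Longrightarrow> simp_op \<theta> p \<sigma> = simp_op \<eta> p \<sigma>"
  by (cases \<sigma>) (auto simp: simp_op_def fun_eq_iff)

lemma simp_op_comp: "mono_upto \<theta> p q \<Longrightarrow> simp_op \<theta> p (simp_op \<eta> q \<sigma>) = simp_op (\<eta> \<circ> \<theta>) p \<sigma>"
  by (cases \<sigma>) (auto simp: simp_op_def fun_eq_iff mono_upto_def dest: le_trans)

text \<open>This is an equality of triples of total functions: a simplex is \<open>undefined\<close>
  outside its range, and so is the result of \<open>simp_op\<close>.\<close>

lemma simp_op_id:
  assumes "nerve_simplex C p \<sigma>" "\<And>i. i \<le> p \<Longrightarrow> \<theta> i = i"
  shows "simp_op \<theta> p \<sigma> = \<sigma>"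
  using assms by (cases \<sigma>) (auto simp: simp_op_def nerve_simplex_def fun_eq_iff not_le)

lemma nerve_simplex_simp_op:
  assumes "nerve_simplex C q \<sigma>" "mono_upto \<theta> p q"
  shows "nerve_simplex C p (simp_op \<theta> p \<sigma>)"
proof (cases \<sigma>)
  case (fields x f c)
  have m: "\<theta> i \<le> \<theta> j" if "i \<le> j" "j \<le> p" for i j using assms(2) that by (auto simp: mono_upto_def)
  have u: "\<theta> i \<le> q" if "i \<le> p" for i using assms(2) that by (auto simp: mono_upto_def)
  show ?thesis
    using assms(1) unfolding fields nerve_simplex_def simp_op_def prod.case
    by (elim conjE, intro conjI allI impI) (simp_all add: m u, blast+)
qed

lemma push_simplex_standard:
  assumes "mono_upto \<theta> p q" "t \<in> standard_simplex p"
  shows "push_simplex \<theta> p t \<in> standard_simplex q"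
proof -
  have nn: "\<And>i. 0 \<le> t i" and s1: "(\<Sum>i\<le>p. t i) = 1" using assms(2) by (auto simp: standard_simplex_def)
  have le: "\<theta> i \<le> q" if "i \<le> p" for i using assms(1) that by (auto simp: mono_upto_def)
  have "(\<Sum>j\<le>q. push_simplex \<theta> p t j) = (\<Sum>j\<le>q. \<Sum>i\<in>{i \<in> {..p}. \<theta> i = j}. t i)"
    by (simp add: push_simplex_def)
  also have "\<dots> = (\<Sum>i\<le>p. t i)"
    by (rule sum.group) (auto simp: le)
  finally have "(\<Sum>j\<le>q. push_simplex \<theta> p t j) = 1" using s1 by simp
  moreover have "push_simplex \<theta> p t j = 0" if "j > q" for j
    unfolding push_simplex_def by (rule sum.neutral) (use le that in force)
  moreover have "push_simplex \<theta> p t j \<le> (\<Sum>i\<le>p. t i)" for j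
    unfolding push_simplex_def by (rule sum_mono2) (auto simp: nn)
  ultimately show ?thesis using s1
    by (auto simp: standard_simplex_def push_simplex_def intro: sum_nonneg nn)
qed

lemma nerve_relI:
  assumes "mono_upto \<theta> p q" "nerve_simplex C q \<sigma>" "t \<in> standard_simplex p"
  shows "((p, simp_op \<theta> p \<sigma>, t), (q, \<sigma>, push_simplex \<theta> p t)) \<in> nerve_rel C"
  using assms unfolding nerve_rel_def mono_upto_def by blast

lemma nerve_relE:
  assumes "(a, b) \<in> nerve_rel C"
  obtains p q \<theta> \<sigma> t where "a = (p, simp_op \<theta> p \<sigma>, t)" "b = (q, \<sigma>, push_simplex \<theta> p t)"
    "mono_upto \<theta> p q" "nerve_simplex C q \<sigma>" "t \<in> standard_simplex p"
  using assms unfolding nerve_rel_def mono_upto_def by blast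

text \<open>The closure is taken on the whole type, hence \<open>UNIV\<close>. A triple that is not
  a point of a simplex is related only to itself, so such triples do not disturb the classes of
  genuine points.\<close>

lemma equiv_nerve_equiv: "equiv UNIV (nerve_equiv C)"
  unfolding nerve_equiv_def
  by (intro equivI refl_rtrancl trans_rtrancl sym_rtrancl sym_Un_converse) auto

lemma real_class_eq_iff: "real_class C a = real_class C b \<longleftrightarrow> (a, b) \<in> nerve_equiv C"
  unfolding real_class_def by (rule eq_equiv_class_iff[OF equiv_nerve_equiv]) simp_all

lemma real_class_step:
  assumes "mono_upto \<theta> p q" "nerve_simplex C q \<sigma>" "t \<in> standard_simplex p"
  shows "real_class C (p, simp_op \<theta> p \<sigma>, t) = real_class C (q, \<sigma>, push_simplex \<theta> p t)"
  using nerve_relI[OF assms] unfolding real_class_eq_iff nerve_equiv_def by blast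

text \<open>\<open>B_map\<close> evaluates its formula at a representative picked by
  \<open>SOME\<close>. Isolating that pattern lets \<open>B_map\<close> and the homotopy be treated
  by the same two facts: independence of the representative and continuity.\<close>

definition descend :: "('a \<Rightarrow> 'b) \<Rightarrow> 'a set \<Rightarrow> 'b" where
  "descend f c = f (SOME a. a \<in> c)"

lemma nerve_equiv_respects:
  assumes "\<And>a b. (a, b) \<in> nerve_rel C \<Longrightarrow> f a = f b" and "(a, b) \<in> nerve_equiv C"
  shows "f a = f b"
  using assms(2) unfolding nerve_equiv_def
  by (induction rule: rtrancl_induct) (use assms(1) in force)+

lemma descend_real_class:
  assumes "\<And>a b. (a, b) \<in> nerve_rel C \<Longrightarrow> f a = f b"
  shows "descend f (real_class C a) = f a"
proof -
  have "a \<in> real_class C a" by (simp add: real_class_def nerve_equiv_def)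
  then have "(SOME b. b \<in> real_class C a) \<in> real_class C a" by (rule someI)
  then have "(a, SOME b. b \<in> real_class C a) \<in> nerve_equiv C" by (simp add: real_class_def)
  from nerve_equiv_respects[of C f, OF assms this] show ?thesis by (simp add: descend_def)
qed

section \<open>The topology of the classifying space\<close>

abbreviation simplex_top :: "nat \<Rightarrow> (nat \<Rightarrow> real) topology" where
  "simplex_top p \<equiv> subtopology (powertop_real UNIV) (standard_simplex p)"

text \<open>\<open>topology\<close> returns the intended object only for a predicate satisfying
  \<open>istopology\<close>; this holds since pulling back to a simplex commutes with intersections
  and unions.\<close>

lemma openin_classifying_space:
  "openin (classifying_space C) U \<longleftrightarrow> U \<subseteq> nerve_elems C // nerve_equiv C \<and>
     (\<forall>p \<sigma>. nerve_simplex C p \<sigma> \<longrightarrow>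
        openin (simplex_top p) {t \<in> standard_simplex p. real_class C (p,\<sigma>,t) \<in> U})"
proof -
  have "istopology (\<lambda>U. U \<subseteq> nerve_elems C // nerve_equiv C \<and> (\<forall>p \<sigma>. nerve_simplex C p \<sigma> \<longrightarrow>
        openin (simplex_top p) {t \<in> standard_simplex p. real_class C (p,\<sigma>,t) \<in> U}))" (is "istopology ?O")
    unfolding istopology_def
  proof (intro conjI allI impI)
    fix S T assume S: "?O S" and T: "?O T"
    then show "S \<inter> T \<subseteq> nerve_elems C // nerve_equiv C" by blast
    fix p \<sigma> assume n: "nerve_simplex C p \<sigma>"
    have "{t \<in> standard_simplex p. real_class C (p,\<sigma>,t) \<in> S \<inter> T} =
      {t \<in> standard_simplex p. real_class C (p,\<sigma>,t) \<in> S} \<inter> {t \<in> standard_simplex p. real_class C (p,\<sigma>,t) \<in> T}"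
      by blast
    then show "openin (simplex_top p) {t \<in> standard_simplex p. real_class C (p,\<sigma>,t) \<in> S \<inter> T}"
      using S T n by (metis (no_types, lifting) openin_Int)
  next
    fix \<K> assume K: "\<forall>S\<in>\<K>. ?O S"
    then show "\<Union>\<K> \<subseteq> nerve_elems C // nerve_equiv C" by blast
    fix p \<sigma> assume n: "nerve_simplex C p \<sigma>"
    have "{t \<in> standard_simplex p. real_class C (p,\<sigma>,t) \<in> \<Union>\<K>} =
      (\<Union>S\<in>\<K>. {t \<in> standard_simplex p. real_class C (p,\<sigma>,t) \<in> S})"
      by blast
    moreover have "openin (simplex_top p) (\<Union>S\<in>\<K>. {t \<in> standard_simplex p. real_class C (p,\<sigma>,t) \<in> S})"
      using K n by (intro openin_clauses(3)) blast
    ultimately show "openin (simplex_top p) {t \<in> standard_simplex p. real_class C (p,\<sigma>,t) \<in> \<Union>\<K>}"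
      by simp
  qed
  then show ?thesis unfolding classifying_space_def by (simp add: topology_inverse')
qed

lemma nerve_classes: "nerve_elems C // nerve_equiv C = real_class C ` nerve_elems C"
  by (auto simp: quotient_def real_class_def)

lemma topspace_classifying_space: "topspace (classifying_space C) = real_class C ` nerve_elems C"
proof -
  have "openin (classifying_space C) (real_class C ` nerve_elems C)"
    unfolding openin_classifying_space nerve_classes
  proof (intro conjI allI impI subset_refl)
    fix p \<sigma> assume "nerve_simplex C p \<sigma>"
    then have "{t \<in> standard_simplex p. real_class C (p, \<sigma>, t) \<in> real_class C ` nerve_elems C} = standard_simplex p"
      by (auto simp: nerve_elems_def)
    then show "openin (simplex_top p) {t \<in> standard_simplex p. real_class C (p, \<sigma>, t) \<in> real_class C ` nerve_elems C}"
      using openin_topspace[of "simplex_top p"] by (simp only: topspace_standard_simplex)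
  qed
  moreover have "topspace (classifying_space C) \<subseteq> real_class C ` nerve_elems C"
    using openin_topspace[of "classifying_space C"] unfolding openin_classifying_space nerve_classes by blast
  ultimately show ?thesis by (intro equalityI openin_subset)
qed

abbreviation simplices :: "('o,'a,'c,'m) cat2_scheme \<Rightarrow> (nat \<times> ('o,'a,'c) simplex) set" where
  "simplices C \<equiv> {(p, \<sigma>). nerve_simplex C p \<sigma>}"

lemma ball_simplices: "(\<forall>i\<in>simplices C. Q (fst i) (snd i)) \<longleftrightarrow> (\<forall>p \<sigma>. nerve_simplex C p \<sigma> \<longrightarrow> Q p \<sigma>)"
  by auto

text \<open>Turns the weak topology into a quotient of the disjoint sum of all simplices, the form
  to which general facts on quotient maps, and on their products with a fixed space, apply.\<close>

lemma quotient_map_classifying_space: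
  "quotient_map (sum_topology (\<lambda>i. simplex_top (fst i)) (simplices C)) (classifying_space C)
     (\<lambda>(i, t). real_class C (fst i, snd i, t))"
  unfolding quotient_map_def
proof (intro conjI allI impI)
  show "(\<lambda>(i, t). real_class C (fst i, snd i, t)) ` topspace (sum_topology (\<lambda>i. simplex_top (fst i)) (simplices C))
      = topspace (classifying_space C)"
    unfolding topspace_classifying_space
  proof (intro equalityI subsetI)
    fix c assume "c \<in> real_class C ` nerve_elems C"
    then obtain p \<sigma> t where "c = real_class C (p, \<sigma>, t)" "nerve_simplex C p \<sigma>" "t \<in> standard_simplex p"
      by (auto simp: nerve_elems_def)
    then show "c \<in> (\<lambda>(i, t). real_class C (fst i, snd i, t)) `
        topspace (sum_topology (\<lambda>i. simplex_top (fst i)) (simplices C))"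
      by (intro image_eqI[where x = "((p, \<sigma>), t)"]) auto
  next
    fix c assume "c \<in> (\<lambda>(i, t). real_class C (fst i, snd i, t)) `
        topspace (sum_topology (\<lambda>i. simplex_top (fst i)) (simplices C))"
    then obtain i t where c: "c = real_class C (fst i, snd i, t)"
      and i: "nerve_simplex C (fst i) (snd i)" "t \<in> standard_simplex (fst i)"
      by auto
    show "c \<in> real_class C ` nerve_elems C"
      unfolding c by (rule imageI) (simp add: nerve_elems_def i)
  qed
  fix U assume "U \<subseteq> topspace (classifying_space C)"
  then have U: "U \<subseteq> nerve_elems C // nerve_equiv C" by (simp add: topspace_classifying_space nerve_classes)
  let ?V = "{x \<in> topspace (sum_topology (\<lambda>i. simplex_top (fst i)) (simplices C)).
       (case x of (i, t) \<Rightarrow> real_class C (fst i, snd i, t)) \<in> U}"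
  have V: "{t. (i, t) \<in> ?V} = {t \<in> standard_simplex (fst i). real_class C (fst i, snd i, t) \<in> U}"
    if "i \<in> simplices C" for i
    using that by (cases i) simp
  have "openin (sum_topology (\<lambda>i. simplex_top (fst i)) (simplices C)) ?V \<longleftrightarrow>
      (\<forall>i\<in>simplices C. openin (simplex_top (fst i)) {t. (i, t) \<in> ?V})"
    unfolding openin_sum_topology
  proof (intro iffI conjI; (elim conjE)?)
    show "?V \<subseteq> Sigma (simplices C) (topspace \<circ> (\<lambda>i. simplex_top (fst i)))"
      unfolding topspace_sum_topology[symmetric] by (rule Collect_restrict)
  qed
  also have "\<dots> \<longleftrightarrow> (\<forall>i\<in>simplices C. openin (simplex_top (fst i))
      {t \<in> standard_simplex (fst i). real_class C (fst i, snd i, t) \<in> U})"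
    by (intro ball_cong refl arg_cong[where f = "openin _"] V)
  also have "\<dots> \<longleftrightarrow> openin (classifying_space C) U"
    using U ball_simplices[where Q = "\<lambda>p \<sigma>. openin (simplex_top p) {t \<in> standard_simplex p. real_class C (p, \<sigma>, t) \<in> U}"]
    by (simp only: openin_classifying_space simp_thms)
  finally show "openin (sum_topology (\<lambda>i. simplex_top (fst i)) (simplices C)) ?V = openin (classifying_space C) U" .
qed

section \<open>Continuity of maps out of the classifying space\<close>

lemma continuous_map_real_class:
  assumes "nerve_simplex C p \<sigma>"
  shows "continuous_map (simplex_top p) (classifying_space C) (\<lambda>t. real_class C (p, \<sigma>, t))"
proof -
  have "(p, \<sigma>) \<in> simplices C" using assms by simp
  from continuous_map_compose[OF continuous_map_component_injection[OF this]
      quotient_imp_continuous_map[OF quotient_map_classifying_space]]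
  show ?thesis by (simp add: o_def)
qed

text \<open>Each summand is open in the sum, so a box in the product of \<open>Z\<close> with the
  \<open>i\<close>-th summand is a box in the whole product; continuity is thus a condition on each
  summand.\<close>

lemma continuous_map_prod_sum:
  assumes "\<And>i. i \<in> I \<Longrightarrow> continuous_map (prod_topology Z (X i)) Y (\<lambda>(z, x). g (z, i, x))"
  shows "continuous_map (prod_topology Z (sum_topology X I)) Y g"
  unfolding continuous_map_def
proof (intro conjI allI impI funcsetI)
  fix w assume "w \<in> topspace (prod_topology Z (sum_topology X I))"
  then obtain z i x where w: "w = (z, i, x)" "z \<in> topspace Z" "i \<in> I" "x \<in> topspace (X i)" by auto
  then show "g w \<in> topspace Y"
    using funcset_mem[OF continuous_map_funspace[OF assms[OF w(3)]], of "(z, x)"] by simp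
next
  fix U assume U: "openin Y U"
  let ?W = "{w \<in> topspace (prod_topology Z (sum_topology X I)). g w \<in> U}"
  have "\<exists>A B. openin Z A \<and> openin (sum_topology X I) B \<and> z \<in> A \<and> w \<in> B \<and> A \<times> B \<subseteq> ?W"
    if zw: "(z, w) \<in> ?W" for z w
  proof -
    obtain i x where w: "w = (i, x)" by (cases w)
    with zw have i: "i \<in> I" by simp
    let ?Wi = "{v \<in> topspace (prod_topology Z (X i)). (\<lambda>(z, x). g (z, i, x)) v \<in> U}"
    have W: "openin (prod_topology Z (X i)) ?Wi"
      by (rule openin_continuous_map_preimage[OF assms[OF i] U])
    have zx: "(z, x) \<in> ?Wi" using zw w by simp
    from iffD1[OF openin_prod_topology_alt W, rule_format, OF zx]
    obtain A B where AB: "openin Z A" "openin (X i) B" "z \<in> A" "x \<in> B" "A \<times> B \<subseteq> ?Wi"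
      by (elim exE conjE) (rule that)
    have "openin (sum_topology X I) (Pair i ` B)"
      using open_map_component_injection[OF i, of X] AB(2) by (simp add: open_map_def)
    moreover have "A \<times> Pair i ` B \<subseteq> ?W"
    proof (intro subsetI, elim SigmaE imageE)
      fix v z' w' x' assume v: "v = (z', w')" "z' \<in> A" "w' = (i, x')" "x' \<in> B"
      then show "v \<in> ?W"
        using subsetD[OF AB(5), of "(z', x')"] i by simp
    qed
    ultimately show ?thesis using AB(1,3,4) unfolding w by (intro exI conjI) (assumption | rule imageI)+
  qed
  then show "openin (prod_topology Z (sum_topology X I)) ?W"
    by (intro iffD2[OF openin_prod_topology_alt] allI impI)
qed

text \<open>The universal property of the quotient, with continuity on the disjoint sum checked
  simplex by simplex.\<close>

lemma continuous_map_descend: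
  assumes cont: "\<And>p \<sigma>. nerve_simplex C p \<sigma> \<Longrightarrow> continuous_map (simplex_top p) Y (\<lambda>t. f (p, \<sigma>, t))"
    and resp: "\<And>a b. (a, b) \<in> nerve_rel C \<Longrightarrow> f a = f b"
  shows "continuous_map (classifying_space C) Y (descend f)"
proof (rule iffD1[OF continuous_compose_quotient_map_eq[OF quotient_map_classifying_space]])
  have "continuous_map (sum_topology (\<lambda>i. simplex_top (fst i)) (simplices C)) Y
      (\<lambda>(i, t). f (fst i, snd i, t))"
    unfolding continuous_map_def
  proof (intro conjI allI impI funcsetI)
    fix x assume "x \<in> topspace (sum_topology (\<lambda>i. simplex_top (fst i)) (simplices C))"
    then obtain i t where x: "x = (i, t)" "nerve_simplex C (fst i) (snd i)" "t \<in> topspace (simplex_top (fst i))"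
      by auto
    then show "(case x of (i, t) \<Rightarrow> f (fst i, snd i, t)) \<in> topspace Y"
      using funcset_mem[OF continuous_map_funspace[OF cont[OF x(2)]] x(3)] by simp
  next
    fix U assume U: "openin Y U"
    let ?V = "{x \<in> topspace (sum_topology (\<lambda>i. simplex_top (fst i)) (simplices C)).
         (case x of (i, t) \<Rightarrow> f (fst i, snd i, t)) \<in> U}"
    have V: "{t. (i, t) \<in> ?V} = {t \<in> topspace (simplex_top (fst i)). f (fst i, snd i, t) \<in> U}"
      if "i \<in> simplices C" for i using that by (cases i) simp
    show "openin (sum_topology (\<lambda>i. simplex_top (fst i)) (simplices C)) ?V"
      unfolding openin_sum_topology
    proof (intro conjI ballI)
      show "?V \<subseteq> Sigma (simplices C) (topspace \<circ> (\<lambda>i. simplex_top (fst i)))"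
        unfolding topspace_sum_topology[symmetric] by (rule Collect_restrict)
      fix i assume i: "i \<in> simplices C"
      then have "nerve_simplex C (fst i) (snd i)" by (cases i) simp
      from openin_continuous_map_preimage[OF cont[OF this] U]
      show "openin (simplex_top (fst i)) {t. (i, t) \<in> ?V}" unfolding V[OF i] .
    qed
  qed
  then show "continuous_map (sum_topology (\<lambda>i. simplex_top (fst i)) (simplices C)) Y
      (descend f \<circ> (\<lambda>(i, t). real_class C (fst i, snd i, t)))"
  proof (rule continuous_map_eq)
    fix x
    show "(case x of (i, t) \<Rightarrow> f (fst i, snd i, t)) = (descend f \<circ> (\<lambda>(i, t). real_class C (fst i, snd i, t))) x"
      using descend_real_class[of C f, OF resp] by (cases x) simp
  qed
qed

text \<open>Multiplying a quotient map by \<open>Z\<close> yields a quotient map because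
  \<open>Z\<close> is locally compact and Hausdorff. For \<open>Z\<close> the unit interval this
  reduces continuity of a homotopy to single simplices.\<close>

lemma continuous_map_prod_descend:
  assumes Z: "locally_compact_space Z" "Hausdorff_space Z"
    and cont: "\<And>p \<sigma>. nerve_simplex C p \<sigma> \<Longrightarrow>
      continuous_map (prod_topology Z (simplex_top p)) Y (\<lambda>(s, t). f s (p, \<sigma>, t))"
    and resp: "\<And>s a b. s \<in> topspace Z \<Longrightarrow> (a, b) \<in> nerve_rel C \<Longrightarrow> f s a = f s b"
  shows "continuous_map (prod_topology Z (classifying_space C)) Y (\<lambda>(s, c). descend (f s) c)"
proof (rule iffD1[OF continuous_compose_quotient_map_eq[OF
        quotient_map_prod_right[OF Z(1) disjI1[OF Z(2)] quotient_map_classifying_space]]])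
  have "continuous_map (prod_topology Z (sum_topology (\<lambda>i. simplex_top (fst i)) (simplices C))) Y
      (\<lambda>(s, i, t). f s (fst i, snd i, t))"
  proof (rule continuous_map_prod_sum)
    fix i assume "i \<in> simplices C"
    then have "nerve_simplex C (fst i) (snd i)" by (cases i) simp
    from cont[OF this]
    show "continuous_map (prod_topology Z (simplex_top (fst i))) Y
        (\<lambda>(z, x). case (z, i, x) of (s, i, t) \<Rightarrow> f s (fst i, snd i, t))" by simp
  qed
  then show "continuous_map (prod_topology Z (sum_topology (\<lambda>i. simplex_top (fst i)) (simplices C))) Y
      ((\<lambda>(s, c). descend (f s) c) \<circ> (\<lambda>(x, y). (x, case y of (i, t) \<Rightarrow> real_class C (fst i, snd i, t))))"
  proof (rule continuous_map_eq)
    fix w assume "w \<in> topspace (prod_topology Z (sum_topology (\<lambda>i. simplex_top (fst i)) (simplices C)))"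
    then obtain s i t where w: "w = (s, i, t)" "s \<in> topspace Z" by (cases w) simp
    have "descend (f s) (real_class C (fst i, snd i, t)) = f s (fst i, snd i, t)"
      using descend_real_class[of C "f s", OF resp[OF w(2)]] .
    then show "(\<lambda>(s, i, t). f s (fst i, snd i, t)) w =
       ((\<lambda>(s, c). descend (f s) c) \<circ> (\<lambda>(x, y). (x, case y of (i, t) \<Rightarrow> real_class C (fst i, snd i, t)))) w"
      using w by simp
  qed
qed

section \<open>Simplicial maps and homotopies\<close>

definition realize :: "('o2,'a2,'c2,'n) cat2_scheme \<Rightarrow> (nat \<Rightarrow> ('o,'a,'c) simplex \<Rightarrow> ('o2,'a2,'c2) simplex) \<Rightarrow>
    (nat \<times> ('o,'a,'c) simplex \<times> (nat \<Rightarrow> real)) set \<Rightarrow> (nat \<times> ('o2,'a2,'c2) simplex \<times> (nat \<Rightarrow> real)) set" where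
  "realize D \<phi> = descend (\<lambda>(p, \<sigma>, t). real_class D (p, \<phi> p \<sigma>, t))"

definition simplicial_map where
  "simplicial_map C D \<phi> \<longleftrightarrow>
    (\<forall>p \<sigma>. nerve_simplex C p \<sigma> \<longrightarrow> nerve_simplex D p (\<phi> p \<sigma>)) \<and>
    (\<forall>p q \<theta> \<sigma>. mono_upto \<theta> p q \<and> nerve_simplex C q \<sigma> \<longrightarrow>
       \<phi> p (simp_op \<theta> p \<sigma>) = simp_op \<theta> p (\<phi> q \<sigma>))"

lemma realize_respects:
  assumes "simplicial_map C D \<phi>" "(a, b) \<in> nerve_rel C"
  shows "(\<lambda>(p, \<sigma>, t). real_class D (p, \<phi> p \<sigma>, t)) a = (\<lambda>(p, \<sigma>, t). real_class D (p, \<phi> p \<sigma>, t)) b"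
  using assms(2)
proof (cases rule: nerve_relE)
  case (1 p q \<theta> \<sigma> t)
  have "\<phi> p (simp_op \<theta> p \<sigma>) = simp_op \<theta> p (\<phi> q \<sigma>)" "nerve_simplex D q (\<phi> q \<sigma>)"
    using assms(1) 1 unfolding simplicial_map_def by blast+
  then show ?thesis using real_class_step[OF 1(3) _ 1(5)] 1(1,2) by simp
qed

lemma realize_real_class:
  assumes "simplicial_map C D \<phi>"
  shows "realize D \<phi> (real_class C (p, \<sigma>, t)) = real_class D (p, \<phi> p \<sigma>, t)"
  unfolding realize_def
  using descend_real_class[of C "\<lambda>(p, \<sigma>, t). real_class D (p, \<phi> p \<sigma>, t)", OF realize_respects[OF assms]]
  by simp

lemma continuous_map_realize:
  assumes "simplicial_map C D \<phi>"
  shows "continuous_map (classifying_space C) (classifying_space D) (realize D \<phi>)"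
  unfolding realize_def
proof (rule continuous_map_descend)
  fix p \<sigma> assume "nerve_simplex C p \<sigma>"
  then have "nerve_simplex D p (\<phi> p \<sigma>)" using assms unfolding simplicial_map_def by blast
  from continuous_map_real_class[OF this]
  show "continuous_map (simplex_top p) (classifying_space D)
      (\<lambda>t. (\<lambda>(p, \<sigma>, t). real_class D (p, \<phi> p \<sigma>, t)) (p, \<sigma>, t))" by simp
qed (rule realize_respects[OF assms])

text \<open>A simplicial homotopy is encoded by its value on a simplex of the domain together with a
  monotone map to the 1-simplex, given as an upward closed predicate on the vertices.\<close>

definition simplicial_htpy where
  "simplicial_htpy C D \<Phi> \<longleftrightarrow>
    (\<forall>p \<sigma> \<kappa>. nerve_simplex C p \<sigma> \<and> (\<forall>i j. i \<le> j \<and> j \<le> p \<and> \<kappa> i \<longrightarrow> \<kappa> j) \<longrightarrow>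
       nerve_simplex D p (\<Phi> \<kappa> p \<sigma>)) \<and>
    (\<forall>p q \<theta> \<sigma> \<kappa> \<kappa>'. mono_upto \<theta> p q \<and> nerve_simplex C q \<sigma> \<and>
       (\<forall>i j. i \<le> j \<and> j \<le> q \<and> \<kappa> i \<longrightarrow> \<kappa> j) \<and> (\<forall>i\<le>p. \<kappa>' i = \<kappa> (\<theta> i)) \<longrightarrow>
       \<Phi> \<kappa>' p (simp_op \<theta> p \<sigma>) = simp_op \<theta> p (\<Phi> \<kappa> q \<sigma>))"

text \<open>These are the cut points when a point of the simplex is read as a subdivision of the
  unit interval. In them a pushforward is a reindexing and a cut is an insertion, so identities
  between points become case distinctions on indices.\<close>

definition psum :: "(nat \<Rightarrow> real) \<Rightarrow> nat \<Rightarrow> real" where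
  "psum t m = (\<Sum>i<m. t i)"

lemma psum_0 [simp]: "psum t 0 = 0" and psum_Suc [simp]: "psum t (Suc m) = psum t m + t m"
  by (auto simp: psum_def)

lemma psum_eqI:
  assumes "\<And>m. psum f m = psum g m" shows "f = g"
proof
  fix i show "f i = g i" using assms[of i] assms[of "Suc i"] by simp
qed

text \<open>The bound by 1 on each coordinate is recovered from nonnegativity and the total
  mass.\<close>

lemma standard_simplex_psum:
  "t \<in> standard_simplex p \<longleftrightarrow> (\<forall>i. 0 \<le> t i) \<and> (\<forall>i>p. t i = 0) \<and> psum t (Suc p) = 1"
proof -
  have "t i \<le> 1" if "\<forall>i. 0 \<le> t i" "\<forall>i>p. t i = 0" "(\<Sum>i\<le>p. t i) = 1" for i
  proof (cases "i \<le> p")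
    case True
    then have "t i \<le> (\<Sum>i\<le>p. t i)" using that(1) by (intro member_le_sum) auto
    then show ?thesis using that by simp
  next
    case False then show ?thesis using that by simp
  qed
  then show ?thesis unfolding standard_simplex_def psum_def lessThan_Suc_atMost by auto
qed

lemma psum_mono:
  assumes "\<forall>i. 0 \<le> t i" "m \<le> n" shows "psum t m \<le> psum t n"
  unfolding psum_def using assms by (intro sum_mono2) auto

text \<open>Below \<open>m\<close> the pushforward has the mass of the vertices sent below
  \<open>m\<close>; for monotone \<open>\<theta>\<close> these form an initial segment. The cut
  \<open>c\<close> may exceed \<open>Suc p\<close>, because \<open>t\<close> vanishes above
  \<open>p\<close>.\<close>

lemma psum_push_simplex:
  assumes t: "t \<in> standard_simplex p" and c: "\<And>i. i \<le> p \<Longrightarrow> \<theta> i < m \<longleftrightarrow> i < c"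
  shows "psum (push_simplex \<theta> p t) m = psum t c"
proof -
  have "psum (push_simplex \<theta> p t) m = (\<Sum>j<m. \<Sum>i\<in>{i \<in> {i\<in>{..p}. \<theta> i < m}. \<theta> i = j}. t i)"
    unfolding psum_def push_simplex_def by (intro sum.cong refl) auto
  also have "\<dots> = (\<Sum>i\<in>{i\<in>{..p}. \<theta> i < m}. t i)"
    by (rule sum.group) auto
  also have "\<dots> = psum t c"
  proof -
    have z: "t i = 0" if "\<not> i \<le> p" for i
      using t that by (simp add: standard_simplex_def)
    have "i \<le> p" "\<theta> i < m \<longleftrightarrow> i < c" if "t i \<noteq> 0" for i
      using z[of i] c[of i] that by blast+
    then show ?thesis
      unfolding psum_def by (intro sum.mono_neutral_left) (auto simp: c)
  qed
  finally show ?thesis .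
qed

text \<open>Provides the initial segment that \<open>psum_push_simplex\<close> asks for.\<close>

lemma mono_upto_cut:
  fixes \<theta> :: "nat \<Rightarrow> nat"
  assumes "\<And>i j. i \<le> j \<Longrightarrow> j \<le> p \<Longrightarrow> \<theta> i \<le> \<theta> j"
  shows "\<exists>c. \<forall>i\<le>p. \<theta> i < m \<longleftrightarrow> i < c"
proof (cases "\<theta> p < m")
  case True
  have "\<theta> i < m" if "i \<le> p" for i using assms[OF that le_refl] True by simp
  then show ?thesis by (intro exI[of _ "Suc p"]) auto
next
  case False
  define c where "c = (LEAST i. \<not> \<theta> i < m)"
  have c: "\<not> \<theta> c < m" unfolding c_def by (rule LeastI[of _ p]) (rule False)
  have "\<theta> i < m" if "i < c" for i
    using not_less_Least[of i "\<lambda>i. \<not> \<theta> i < m"] that unfolding c_def by simp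
  moreover have "\<not> \<theta> i < m" if "i \<le> p" "\<not> i < c" for i using assms[of c i] that c by auto
  ultimately show ?thesis by (intro exI[of _ c]) auto
qed

text \<open>The prism decomposition: a point \<open>t\<close> of the p-simplex is seen as a subdivision of \<open>[0,1]\<close> into
  intervals of lengths \<open>t 0, \<dots>, t p\<close>, and the homotopy parameter \<open>s\<close> cuts the \<open>k\<close>-th interval
  in two, giving a point of the (p+1)-simplex whose vertices above \<open>k\<close> lie over the endpoint 1.\<close>

definition degen :: "nat \<Rightarrow> nat \<Rightarrow> nat" where
  "degen k i = (if i \<le> k then i else i - 1)"

definition insert_cut :: "nat \<Rightarrow> real \<Rightarrow> (nat \<Rightarrow> real) \<Rightarrow> nat \<Rightarrow> real" where
  "insert_cut k s t = (\<lambda>i. if i < k then t i else if i = k then s - psum t k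
     else if i = Suc k then psum t (Suc k) - s else t (i - 1))"

text \<open>Both inequalities are weak, so that the regions where different cuts are possible are
  closed and overlap along common faces, as pasting along closed sets requires.\<close>

definition cut_at :: "nat \<Rightarrow> real \<Rightarrow> (nat \<Rightarrow> real) \<Rightarrow> bool" where
  "cut_at k s t \<longleftrightarrow> psum t k \<le> s \<and> s \<le> psum t (Suc k)"

text \<open>The lengths \<open>s - psum t k\<close> and \<open>psum t (Suc k) - s\<close> are those
  for which \<open>s\<close> itself becomes the partial sum at \<open>Suc k\<close>, all later ones
  being shifted by one place.\<close>

lemma psum_insert_cut:
  "psum (insert_cut k s t) m = (if m \<le> k then psum t m else if m = Suc k then s else psum t (m - 1))"
proof (induction m)
  case (Suc m)
  consider "m < k" | "m = k" | "m = Suc k" | n where "m = Suc n" "k < n"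
    by (cases m) (auto, linarith)
  then show ?case
    by cases (use Suc in \<open>auto simp: insert_cut_def\<close>)
qed simp

lemma insert_cut_standard:
  assumes "t \<in> standard_simplex p" "k \<le> p" "cut_at k s t"
  shows "insert_cut k s t \<in> standard_simplex (Suc p)"
  unfolding standard_simplex_psum
proof (intro conjI allI impI)
  fix i
  show "0 \<le> insert_cut k s t i"
    using assms by (auto simp: insert_cut_def cut_at_def standard_simplex_psum)
  show "insert_cut k s t i = 0" if "i > Suc p"
    using assms that by (auto simp: insert_cut_def standard_simplex_psum)
  show "psum (insert_cut k s t) (Suc (Suc p)) = 1"
    using assms unfolding psum_insert_cut by (auto simp: standard_simplex_psum)
qed

lemma mono_upto_degen: "k \<le> p \<Longrightarrow> mono_upto (degen k) (Suc p) p"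
  by (auto simp: mono_upto_def degen_def)

text \<open>The degeneracy doubles vertex \<open>k\<close>: the predicate fails at the copy
  \<open>k\<close> and holds at the copy \<open>Suc k\<close>. The weight of the doubled vertex is
  shared between the two copies according to \<open>s\<close>.\<close>

definition htpy_piece where
  "htpy_piece D \<Phi> s k = (\<lambda>(p, \<sigma>, t).
     real_class D (Suc p, \<Phi> (\<lambda>i. k < i) (Suc p) (simp_op (degen k) (Suc p) \<sigma>), insert_cut k s t))"

context
  fixes C :: "('o,'a,'c,'m) cat2_scheme" and D :: "('o2,'a2,'c2,'n) cat2_scheme"
    and \<Phi> :: "(nat \<Rightarrow> bool) \<Rightarrow> nat \<Rightarrow> ('o,'a,'c) simplex \<Rightarrow> ('o2,'a2,'c2) simplex"
  assumes \<Phi>: "simplicial_htpy C D \<Phi>"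
begin

lemma htpy_simplex:
  assumes "nerve_simplex C p \<sigma>" "\<And>i j. i \<le> j \<Longrightarrow> j \<le> p \<Longrightarrow> \<kappa> i \<Longrightarrow> \<kappa> j"
  shows "nerve_simplex D p (\<Phi> \<kappa> p \<sigma>)"
proof -
  have "nerve_simplex C p \<sigma> \<and> (\<forall>i j. i \<le> j \<and> j \<le> p \<and> \<kappa> i \<longrightarrow> \<kappa> j)"
    by (intro conjI allI impI assms(1); elim conjE) (rule assms(2))
  then show ?thesis
    by (rule conjunct1[OF \<Phi>[unfolded simplicial_htpy_def], THEN spec, THEN spec, THEN spec, THEN mp])
qed

lemma htpy_natural:
  assumes "mono_upto \<theta> p q" "nerve_simplex C q \<sigma>" "\<And>i j. i \<le> j \<Longrightarrow> j \<le> q \<Longrightarrow> \<kappa> i \<Longrightarrow> \<kappa> j"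
    and "\<And>i. i \<le> p \<Longrightarrow> \<kappa>' i = \<kappa> (\<theta> i)"
  shows "\<Phi> \<kappa>' p (simp_op \<theta> p \<sigma>) = simp_op \<theta> p (\<Phi> \<kappa> q \<sigma>)"
proof -
  have "mono_upto \<theta> p q \<and> nerve_simplex C q \<sigma> \<and>
       (\<forall>i j. i \<le> j \<and> j \<le> q \<and> \<kappa> i \<longrightarrow> \<kappa> j) \<and> (\<forall>i\<le>p. \<kappa>' i = \<kappa> (\<theta> i))"
    by (intro conjI allI impI) (rule assms(1), rule assms(2), elim conjE, rule assms(3), assumption+, erule assms(4))
  then show ?thesis
    by (rule conjunct2[OF \<Phi>[unfolded simplicial_htpy_def], THEN spec, THEN spec, THEN spec, THEN spec,
          THEN spec, THEN spec, THEN mp])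
qed

text \<open>If the cut point lies on a face \<open>\<delta>\<close> that is a section of the
  degeneracy, the gluing relation moves the class to that face, where the degenerate simplex
  restricts to \<open>\<sigma>\<close> again and only the predicate remembers \<open>k\<close>. Both
  ends of the homotopy and the overlap of neighbouring prisms are instances.\<close>

lemma htpy_piece_face:
  assumes \<sigma>: "nerve_simplex C p \<sigma>" and t: "t \<in> standard_simplex p" and k: "k \<le> p"
    and \<delta>: "mono_upto \<delta> p (Suc p)" "\<And>i. i \<le> p \<Longrightarrow> degen k (\<delta> i) = i"
    and psh: "push_simplex \<delta> p t = insert_cut k s t"
    and \<kappa>: "\<And>i. i \<le> p \<Longrightarrow> \<kappa> i \<longleftrightarrow> k < \<delta> i"
  shows "htpy_piece D \<Phi> s k (p, \<sigma>, t) = real_class D (p, \<Phi> \<kappa> p \<sigma>, t)"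
proof -
  let ?s = "simp_op (degen k) (Suc p) \<sigma>"
  have ns: "nerve_simplex C (Suc p) ?s" by (rule nerve_simplex_simp_op[OF \<sigma> mono_upto_degen[OF k]])
  have nD: "nerve_simplex D (Suc p) (\<Phi> (\<lambda>i. k < i) (Suc p) ?s)" by (rule htpy_simplex[OF ns]) simp
  have "simp_op \<delta> p ?s = \<sigma>"
    unfolding simp_op_comp[OF \<delta>(1)] by (rule simp_op_id[OF \<sigma>]) (simp add: \<delta>(2))
  moreover have "\<Phi> \<kappa> p (simp_op \<delta> p ?s) = simp_op \<delta> p (\<Phi> (\<lambda>i. k < i) (Suc p) ?s)"
    by (rule htpy_natural[OF \<delta>(1) ns]) (auto simp: \<kappa>)
  ultimately show ?thesis
    using real_class_step[OF \<delta>(1) nD t] by (simp add: htpy_piece_def psh)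
qed

text \<open>At \<open>s = 0\<close> vertex 0 of the prism simplex, the only one where the predicate
  fails, has weight 0; the face \<open>Suc\<close> omits it.\<close>

lemma htpy_piece_start:
  assumes "nerve_simplex C p \<sigma>" and t: "t \<in> standard_simplex p" and \<kappa>: "\<And>i. i \<le> p \<Longrightarrow> \<kappa> i"
  shows "htpy_piece D \<Phi> 0 0 (p, \<sigma>, t) = real_class D (p, \<Phi> \<kappa> p \<sigma>, t)"
proof (rule htpy_piece_face[OF assms(1) t])
  show "push_simplex Suc p t = insert_cut 0 0 t"
  proof (rule psum_eqI)
    fix m
    have "psum (push_simplex Suc p t) m = psum t (m - 1)"
      by (rule psum_push_simplex[OF t]) auto
    then show "psum (push_simplex Suc p t) m = psum (insert_cut 0 0 t) m"
      unfolding psum_insert_cut by (cases m) auto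
  qed
qed (use \<kappa> in \<open>auto simp: mono_upto_def degen_def\<close>)

text \<open>At \<open>s = 1\<close> the only vertex where the predicate holds, \<open>Suc p\<close>,
  has weight 0; the face \<open>id\<close> omits it.\<close>

lemma htpy_piece_end:
  assumes "nerve_simplex C p \<sigma>" and t: "t \<in> standard_simplex p" and \<kappa>: "\<And>i. i \<le> p \<Longrightarrow> \<not> \<kappa> i"
  shows "htpy_piece D \<Phi> 1 p (p, \<sigma>, t) = real_class D (p, \<Phi> \<kappa> p \<sigma>, t)"
proof (rule htpy_piece_face[OF assms(1) t])
  show "push_simplex id p t = insert_cut p 1 t"
  proof (rule psum_eqI)
    fix m
    have *: "psum t n = 1" if "n \<ge> Suc p" for n
      using that t by (induction n rule: dec_induct) (auto simp: standard_simplex_psum)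
    have "psum (push_simplex id p t) m = psum t m"
      by (rule psum_push_simplex[OF t]) auto
    then show "psum (push_simplex id p t) m = psum (insert_cut p 1 t) m"
      unfolding psum_insert_cut using *[of m] *[of "m - 1"] by auto
  qed
qed (use \<kappa> in \<open>auto simp: mono_upto_def degen_def\<close>)

text \<open>Both cuts are possible only when \<open>s\<close> is the common endpoint of the two
  intervals. Then vertex \<open>Suc k\<close> has weight 0 in both prism simplices, and on the face
  \<open>\<delta>\<close> omitting it the two predicates become the same.\<close>

lemma htpy_piece_adjacent:
  assumes \<sigma>: "nerve_simplex C p \<sigma>" and t: "t \<in> standard_simplex p" and k: "Suc k \<le> p"
    and cut: "cut_at k s t" "cut_at (Suc k) s t"
  shows "htpy_piece D \<Phi> s k (p, \<sigma>, t) = htpy_piece D \<Phi> s (Suc k) (p, \<sigma>, t)"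
proof -
  define \<delta> where "\<delta> i = (if i \<le> k then i else Suc i)" for i
  have m: "mono_upto \<delta> p (Suc p)" by (auto simp: mono_upto_def \<delta>_def)
  have s: "s = psum t (Suc k)" using cut unfolding cut_at_def by linarith
  have P: "psum (push_simplex \<delta> p t) m = psum t (if m \<le> Suc k then m else m - 1)" for m
    by (rule psum_push_simplex[OF t]) (auto simp: \<delta>_def)
  have "push_simplex \<delta> p t = insert_cut k s t"
    by (rule psum_eqI) (auto simp: P psum_insert_cut s simp del: psum_Suc dest: le_antisym)
  then have 1: "htpy_piece D \<Phi> s k (p, \<sigma>, t) = real_class D (p, \<Phi> (\<lambda>i. k < i) p \<sigma>, t)"
    by (intro htpy_piece_face[OF \<sigma> t _ m]) (use k in \<open>auto simp: \<delta>_def degen_def\<close>)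
  have "push_simplex \<delta> p t = insert_cut (Suc k) s t"
    by (rule psum_eqI) (auto simp: P psum_insert_cut s simp del: psum_Suc dest: le_antisym)
  then have 2: "htpy_piece D \<Phi> s (Suc k) (p, \<sigma>, t) = real_class D (p, \<Phi> (\<lambda>i. k < i) p \<sigma>, t)"
    by (intro htpy_piece_face[OF \<sigma> t _ m]) (use k in \<open>auto simp: \<delta>_def degen_def\<close>)
  from 1 2 show ?thesis by simp
qed

text \<open>Every interval strictly between \<open>k\<close> and \<open>l\<close> is shrunk to the
  point \<open>s\<close>, so all of them admit the cut and neighbours can be compared one after the
  other.\<close>

lemma htpy_piece_unique:
  assumes \<sigma>: "nerve_simplex C p \<sigma>" and t: "t \<in> standard_simplex p" and kl: "k \<le> l" "l \<le> p"
    and cut: "cut_at k s t" "cut_at l s t"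
  shows "htpy_piece D \<Phi> s k (p, \<sigma>, t) = htpy_piece D \<Phi> s l (p, \<sigma>, t)"
proof -
  have nn: "\<forall>i. 0 \<le> t i" using t by (simp add: standard_simplex_psum)
  have between: "cut_at j s t" if "k \<le> j" "j \<le> l" for j
    using cut psum_mono[OF nn that(2)] psum_mono[OF nn, of "Suc k" "Suc j"] that(1)
    unfolding cut_at_def by simp
  have "j \<le> l \<Longrightarrow> htpy_piece D \<Phi> s k (p, \<sigma>, t) = htpy_piece D \<Phi> s j (p, \<sigma>, t)" if "k \<le> j" for j
    using that
  proof (induction j rule: dec_induct)
    case (step j)
    have "htpy_piece D \<Phi> s j (p, \<sigma>, t) = htpy_piece D \<Phi> s (Suc j) (p, \<sigma>, t)"
      by (rule htpy_piece_adjacent[OF \<sigma> t]) (use step kl between in auto)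
    then show ?case using step by simp
  qed simp
  then show ?thesis using kl by simp
qed

text \<open>The operator \<open>\<theta>\<close> extends to the two prism simplices once the doubled
  vertices correspond, that is, when the cut at \<open>k\<close> is matched with the cut at
  \<open>\<theta> k\<close>.\<close>

lemma htpy_piece_natural:
  assumes \<theta>: "mono_upto \<theta> p q" and \<sigma>: "nerve_simplex C q \<sigma>" and t: "t \<in> standard_simplex p"
    and k: "k \<le> p" and cut: "cut_at k s t"
  shows "htpy_piece D \<Phi> s k (p, simp_op \<theta> p \<sigma>, t) = htpy_piece D \<Phi> s (\<theta> k) (q, \<sigma>, push_simplex \<theta> p t)"
    and "cut_at (\<theta> k) s (push_simplex \<theta> p t)" and "\<theta> k \<le> q"
proof -
  have mono: "\<theta> i \<le> \<theta> j" if "i \<le> j" "j \<le> p" for i j using \<theta> that by (auto simp: mono_upto_def)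
  have le: "\<theta> i \<le> q" if "i \<le> p" for i using \<theta> that by (auto simp: mono_upto_def)
  show kq: "\<theta> k \<le> q" using le k .
  have nn: "\<forall>i. 0 \<le> t i" using t by (simp add: standard_simplex_psum)
  \<comment> \<open>The two copies of \<open>k\<close> go to the two copies of
    \<open>\<theta> k\<close>; indices beyond are shifted by one on both sides.\<close>
  define \<theta>' where "\<theta>' i = (if i \<le> k then \<theta> i else Suc (\<theta> (i - 1)))" for i
  have \<theta>': "mono_upto \<theta>' (Suc p) (Suc q)"
    unfolding mono_upto_def
  proof (intro conjI allI impI)
    show "\<theta>' i \<le> Suc q" if "i \<le> Suc p" for i
      using le[of i] le[of "i - 1"] that k by (auto simp: \<theta>'_def)
    show "\<theta>' i \<le> \<theta>' j" if "i \<le> j \<and> j \<le> Suc p" for i j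
    proof (cases "i \<le> k \<and> \<not> j \<le> k")
      case True
      then have "i \<le> j - 1" "j - 1 \<le> p" using that by auto
      from mono[OF this] True show ?thesis by (simp add: \<theta>'_def)
    next
      case False
      then show ?thesis using mono[of i j] mono[of "i - 1" "j - 1"] that k by (auto simp: \<theta>'_def)
    qed
  qed
  have dg: "mono_upto (degen k) (Suc p) p" "mono_upto (degen (\<theta> k)) (Suc q) q"
    using k kq by (auto intro: mono_upto_degen)
  have mk: "\<theta> k \<le> \<theta> (i - 1)" if "\<not> i \<le> k" "i \<le> Suc p" for i
    by (rule mono) (use that in auto)
  have comm: "degen (\<theta> k) (\<theta>' i) = \<theta> (degen k i)" if "i \<le> Suc p" for i
    using mk[of i] mono[of i k] k that by (auto simp: degen_def \<theta>'_def)
  have \<kappa>: "k < i \<longleftrightarrow> \<theta> k < \<theta>' i" if "i \<le> Suc p" for i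
    using mk[of i] mono[of i k] k that by (auto simp: \<theta>'_def)
  have cutE: "\<exists>c. \<forall>i\<le>p. \<theta> i < m \<longleftrightarrow> i < c" for m by (rule mono_upto_cut) (rule mono)
  \<comment> \<open>Vertices with the same image as \<open>k\<close> merge with it, so the interval
    of \<open>\<theta> k\<close> after the pushforward contains the interval of
    \<open>k\<close>.\<close>
  have cut': "psum (push_simplex \<theta> p t) (\<theta> k) \<le> psum t k" "psum t (Suc k) \<le> psum (push_simplex \<theta> p t) (Suc (\<theta> k))"
  proof -
    obtain c where c: "\<And>i. i \<le> p \<Longrightarrow> \<theta> i < \<theta> k \<longleftrightarrow> i < c" using cutE[of "\<theta> k"] by blast
    then have "c \<le> k" using c[OF k] by simp
    from psum_mono[OF nn this] psum_push_simplex[OF t c] show "psum (push_simplex \<theta> p t) (\<theta> k) \<le> psum t k" by (simp del: psum_Suc)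
    obtain c where c: "\<And>i. i \<le> p \<Longrightarrow> \<theta> i < Suc (\<theta> k) \<longleftrightarrow> i < c" using cutE[of "Suc (\<theta> k)"] by blast
    then have "Suc k \<le> c" using c[OF k] by simp
    from psum_mono[OF nn this] psum_push_simplex[OF t c] show "psum t (Suc k) \<le> psum (push_simplex \<theta> p t) (Suc (\<theta> k))" by (simp del: psum_Suc)
  qed
  then show "cut_at (\<theta> k) s (push_simplex \<theta> p t)" using cut unfolding cut_at_def by linarith
  have ins: "insert_cut k s t \<in> standard_simplex (Suc p)" by (rule insert_cut_standard[OF t k cut])
  \<comment> \<open>The three cases are the partial sums before, at and after the inserted cut. Past
    it, the initial segment for \<open>\<theta>\<close> at \<open>m - 1\<close> becomes one longer
    for \<open>\<theta>'\<close> at \<open>m\<close>.\<close>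
  have psh: "push_simplex \<theta>' (Suc p) (insert_cut k s t) = insert_cut (\<theta> k) s (push_simplex \<theta> p t)"
  proof (rule psum_eqI)
    fix m
    consider "m \<le> \<theta> k" | "m = Suc (\<theta> k)" | "m > Suc (\<theta> k)" by linarith
    then show "psum (push_simplex \<theta>' (Suc p) (insert_cut k s t)) m =
        psum (insert_cut (\<theta> k) s (push_simplex \<theta> p t)) m"
    proof cases
      case 1
      obtain c where c: "\<And>i. i \<le> p \<Longrightarrow> \<theta> i < m \<longleftrightarrow> i < c" using cutE[of m] by blast
      have ck: "c \<le> k" using c[OF k] 1 by simp
      have "\<theta>' i < m \<longleftrightarrow> i < c" if "i \<le> Suc p" for i
        using c[of i] ck k 1 mk[of i] that by (auto simp: \<theta>'_def)
      from psum_push_simplex[OF ins this] show ?thesis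
        using psum_push_simplex[OF t c] ck 1 by (simp add: psum_insert_cut)
    next
      case 2
      have "\<theta>' i < m \<longleftrightarrow> i < Suc k" if "i \<le> Suc p" for i
        using \<kappa>[OF that] 2 by auto
      from psum_push_simplex[OF ins this] show ?thesis
        using 2 by (simp add: psum_insert_cut del: psum_Suc)
    next
      case 3
      obtain c where c: "\<And>i. i \<le> p \<Longrightarrow> \<theta> i < m - 1 \<longleftrightarrow> i < c" using cutE[of "m - 1"] by blast
      have "\<theta> k < m - 1" using 3 by linarith
      then have ck: "k < c" using c[OF k] by blast
      have "\<theta>' i < m \<longleftrightarrow> i < Suc c" if "i \<le> Suc p" for i
      proof (cases "i \<le> k")
        case True
        then show ?thesis using mono[of i k] ck k 3 by (auto simp: \<theta>'_def)
      next
        case False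
        then have "\<theta> (i - 1) < m - 1 \<longleftrightarrow> i - 1 < c" using that by (intro c) simp
        then show ?thesis using False 3 unfolding \<theta>'_def by (simp add: less_diff_conv less_Suc_eq_le) linarith
      qed
      from psum_push_simplex[OF ins this] show ?thesis
        using psum_push_simplex[OF t c] ck 3 by (simp add: psum_insert_cut del: psum_Suc)
    qed
  qed
  let ?s = "simp_op (degen (\<theta> k)) (Suc q) \<sigma>"
  have ns: "nerve_simplex C (Suc q) ?s" by (rule nerve_simplex_simp_op[OF \<sigma> dg(2)])
  have nD: "nerve_simplex D (Suc q) (\<Phi> (\<lambda>i. \<theta> k < i) (Suc q) ?s)" by (rule htpy_simplex[OF ns]) simp
  have "simp_op (degen k) (Suc p) (simp_op \<theta> p \<sigma>) = simp_op \<theta>' (Suc p) ?s"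
    unfolding simp_op_comp[OF dg(1)] simp_op_comp[OF \<theta>'] by (rule simp_op_cong) (simp add: comm)
  moreover have "\<Phi> (\<lambda>i. k < i) (Suc p) (simp_op \<theta>' (Suc p) ?s) =
      simp_op \<theta>' (Suc p) (\<Phi> (\<lambda>i. \<theta> k < i) (Suc q) ?s)"
    by (rule htpy_natural[OF \<theta>' ns]) (auto simp: \<kappa>)
  ultimately show "htpy_piece D \<Phi> s k (p, simp_op \<theta> p \<sigma>, t) =
      htpy_piece D \<Phi> s (\<theta> k) (q, \<sigma>, push_simplex \<theta> p t)"
    using real_class_step[OF \<theta>' nD ins] by (simp add: htpy_piece_def psh)
qed

text \<open>The least index is one admissible cut; by \<open>htpy_fun_eq\<close> any other gives the
  same class.\<close>

definition htpy_fun :: "real \<Rightarrow> nat \<times> ('o,'a,'c) simplex \<times> (nat \<Rightarrow> real) \<Rightarrow> (nat \<times> ('o2,'a2,'c2) simplex \<times> (nat \<Rightarrow> real)) set" where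
  "htpy_fun s a = htpy_piece D \<Phi> s (LEAST k. s \<le> psum (snd (snd a)) (Suc k)) a"

lemma least_cut:
  assumes "0 \<le> s" "s \<le> 1" "t \<in> standard_simplex p"
  shows "(LEAST k. s \<le> psum t (Suc k)) \<le> p" "cut_at (LEAST k. s \<le> psum t (Suc k)) s t"
proof -
  let ?k = "LEAST k. s \<le> psum t (Suc k)"
  have p: "s \<le> psum t (Suc p)" using assms by (simp add: standard_simplex_psum del: psum_Suc)
  show "?k \<le> p" by (rule Least_le) (rule p)
  have 1: "s \<le> psum t (Suc ?k)" by (rule LeastI[of "\<lambda>k. s \<le> psum t (Suc k)"]) (rule p)
  have "psum t ?k \<le> s"
  proof (cases ?k)
    case (Suc j)
    then have "\<not> s \<le> psum t (Suc j)" using not_less_Least[of j "\<lambda>k. s \<le> psum t (Suc k)"] by auto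
    then show ?thesis unfolding Suc by linarith
  qed (use assms in simp)
  with 1 show "cut_at ?k s t" by (simp only: cut_at_def)
qed

lemma htpy_fun_eq:
  assumes "0 \<le> s" "s \<le> 1" "nerve_simplex C p \<sigma>" "t \<in> standard_simplex p" "k \<le> p" "cut_at k s t"
  shows "htpy_fun s (p, \<sigma>, t) = htpy_piece D \<Phi> s k (p, \<sigma>, t)"
proof -
  have "(LEAST k. s \<le> psum t (Suc k)) \<le> k" using assms(6) by (intro Least_le) (simp only: cut_at_def)
  from htpy_piece_unique[OF assms(3,4) this assms(5) least_cut(2)[OF assms(1,2,4)] assms(6)]
  show ?thesis unfolding htpy_fun_def by simp
qed

text \<open>The image \<open>\<theta> k\<close> of the least cut is admissible for the pushforward
  but may fail to be the least one there, for instance at \<open>s = 0\<close>; hence the detour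
  through \<open>htpy_fun_eq\<close>.\<close>

lemma htpy_fun_respects:
  assumes s: "0 \<le> s" "s \<le> 1" and "(a, b) \<in> nerve_rel C"
  shows "htpy_fun s a = htpy_fun s b"
  using assms(3)
proof (cases rule: nerve_relE)
  case (1 p q \<theta> \<sigma> t)
  let ?k = "LEAST k. s \<le> psum t (Suc k)"
  note k = least_cut[OF s 1(5)]
  note n = htpy_piece_natural[OF 1(3,4,5) k]
  have "htpy_fun s a = htpy_piece D \<Phi> s ?k (p, simp_op \<theta> p \<sigma>, t)"
    unfolding 1(1) by (rule htpy_fun_eq[OF s nerve_simplex_simp_op[OF 1(4,3)] 1(5) k])
  also have "\<dots> = htpy_piece D \<Phi> s (\<theta> ?k) (q, \<sigma>, push_simplex \<theta> p t)" by (rule n(1))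
  also have "\<dots> = htpy_fun s b"
    unfolding 1(2) by (rule htpy_fun_eq[OF s 1(4) push_simplex_standard[OF 1(3,5)] n(3,2), symmetric])
  finally show ?thesis .
qed

text \<open>The closed sets \<open>T k\<close> with \<open>k \<le> p\<close> are finitely many and
  cover the product; on each of them the map is the characteristic map of one prism simplex after a
  continuous cut.\<close>

lemma continuous_map_htpy_fun:
  assumes \<sigma>: "nerve_simplex C p \<sigma>"
  shows "continuous_map (prod_topology (top_of_set {0..1}) (simplex_top p)) (classifying_space D)
           (\<lambda>(s, t). htpy_fun s (p, \<sigma>, t))"
proof -
  let ?X = "prod_topology (top_of_set {0..1::real}) (simplex_top p)"
  have cs: "continuous_map ?X euclideanreal fst"
    using continuous_map_fst continuous_map_into_fulltopology by blast
  have ct: "continuous_map ?X euclideanreal (\<lambda>x. snd x i)" for i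
  proof -
    have "continuous_map ?X (powertop_real UNIV) snd"
      using continuous_map_snd continuous_map_into_fulltopology by blast
    from continuous_map_compose[OF this continuous_map_product_projection[of i]]
    show ?thesis by (simp add: o_def)
  qed
  have cp: "continuous_map ?X euclideanreal (\<lambda>x. psum (snd x) m)" for m
    unfolding psum_def by (intro continuous_map_sum ct) auto
  define T where "T k = {x \<in> topspace ?X. cut_at k (fst x) (snd x)}" for k
  have clo: "closedin ?X (T k)" for k
  proof -
    have "closedin ?X {x \<in> topspace ?X. fst x - psum (snd x) k \<in> {0..}}"
      by (rule closedin_continuous_map_preimage[OF continuous_map_diff[OF cs cp]]) simp
    moreover have "closedin ?X {x \<in> topspace ?X. psum (snd x) (Suc k) - fst x \<in> {0..}}"
      by (rule closedin_continuous_map_preimage[OF continuous_map_diff[OF cp cs]]) simp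
    ultimately have "closedin ?X ({x \<in> topspace ?X. fst x - psum (snd x) k \<in> {0..}} \<inter>
        {x \<in> topspace ?X. psum (snd x) (Suc k) - fst x \<in> {0..}})"
      by (rule closedin_Int)
    moreover have "\<dots> = T k" unfolding T_def cut_at_def by auto
    ultimately show ?thesis by simp
  qed
  have tX: "0 \<le> fst x \<and> fst x \<le> 1 \<and> snd x \<in> standard_simplex p" if "x \<in> topspace ?X" for x
    using that by auto
  have piece: "continuous_map (subtopology ?X (T k)) (classifying_space D)
      (\<lambda>x. htpy_piece D \<Phi> (fst x) k (p, \<sigma>, snd x))" if k: "k \<le> p" for k
  proof -
    have "continuous_map ?X euclideanreal (\<lambda>x. insert_cut k (fst x) (snd x) i)" for i
      unfolding insert_cut_def
      by (cases "i < k"; cases "i = k"; cases "i = Suc k")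
        (auto simp del: psum_Suc intro!: continuous_map_diff cs cp ct)
    then have "continuous_map ?X (powertop_real UNIV) (\<lambda>x. insert_cut k (fst x) (snd x))"
      by (simp add: continuous_map_componentwise_UNIV)
    then have ins: "continuous_map (subtopology ?X (T k)) (simplex_top (Suc p)) (\<lambda>x. insert_cut k (fst x) (snd x))"
      unfolding continuous_map_in_subtopology
      using insert_cut_standard[OF _ k] tX by (auto simp: T_def intro: continuous_map_from_subtopology)
    have "nerve_simplex D (Suc p) (\<Phi> (\<lambda>i. k < i) (Suc p) (simp_op (degen k) (Suc p) \<sigma>))"
      by (rule htpy_simplex[OF nerve_simplex_simp_op[OF \<sigma> mono_upto_degen[OF k]]]) simp
    from continuous_map_compose[OF ins continuous_map_real_class[OF this]]
    show ?thesis by (simp add: htpy_piece_def o_def)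
  qed
  show ?thesis
  proof (rule pasting_lemma_closed[where I = "{..p}" and T = T and f = "\<lambda>k x. htpy_piece D \<Phi> (fst x) k (p, \<sigma>, snd x)"])
    show "continuous_map (subtopology ?X (T i)) (classifying_space D)
        (\<lambda>x. htpy_piece D \<Phi> (fst x) i (p, \<sigma>, snd x))" if "i \<in> {..p}" for i
      using piece that by simp
    show "htpy_piece D \<Phi> (fst x) i (p, \<sigma>, snd x) = htpy_piece D \<Phi> (fst x) j (p, \<sigma>, snd x)"
      if "i \<in> {..p}" "j \<in> {..p}" "x \<in> topspace ?X \<inter> T i \<inter> T j" for i j x
    proof -
      have x: "x \<in> topspace ?X" "cut_at i (fst x) (snd x)" "cut_at j (fst x) (snd x)"
        using that(3) by (simp_all add: T_def)
      show ?thesis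
        using htpy_fun_eq[OF _ _ \<sigma> _ _ x(2)] htpy_fun_eq[OF _ _ \<sigma> _ _ x(3)] tX[OF x(1)] that(1,2) by simp
    qed
    show "\<exists>j. j \<in> {..p} \<and> x \<in> T j \<and> (case x of (s, t) \<Rightarrow> htpy_fun s (p, \<sigma>, t)) =
        htpy_piece D \<Phi> (fst x) j (p, \<sigma>, snd x)" if "x \<in> topspace ?X" for x
    proof -
      let ?k = "LEAST k. fst x \<le> psum (snd x) (Suc k)"
      have "?k \<le> p" "cut_at ?k (fst x) (snd x)" using least_cut[of "fst x" "snd x" p] tX[OF that] by auto
      then show ?thesis
        using that by (intro exI[of _ ?k]) (simp add: T_def htpy_fun_def case_prod_beta)
    qed
  qed (use clo in auto)
qed

lemma homotopic_realize:
  "homotopic_with (\<lambda>_. True) (classifying_space C) (classifying_space D)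
     (realize D (\<Phi> (\<lambda>_. True))) (realize D (\<Phi> (\<lambda>_. False)))"
proof -
  let ?I = "top_of_set {0..1::real}"
  define h where "h = (\<lambda>(s, c). descend (htpy_fun s) c)"
  have hr: "h (s, real_class C a) = htpy_fun s a" if "0 \<le> s" "s \<le> 1" for s a
    unfolding h_def using descend_real_class[of C "htpy_fun s" a, OF htpy_fun_respects[OF that]] by simp
  have sm: "simplicial_map C D (\<Phi> (\<lambda>_. b))" for b
    unfolding simplicial_map_def by (simp add: htpy_simplex htpy_natural)
  have "continuous_map (prod_topology ?I (classifying_space C)) (classifying_space D) h"
    unfolding h_def
  proof (rule continuous_map_prod_descend)
    show "locally_compact_space ?I"
      by (intro compact_imp_locally_compact_space) (simp add: compact_space_subtopology)
    show "Hausdorff_space ?I" by (simp add: Hausdorff_space_subtopology)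
  qed (use continuous_map_htpy_fun htpy_fun_respects in auto)
  moreover have "h (0, c) = realize D (\<Phi> (\<lambda>_. True)) c" if c: "c \<in> topspace (classifying_space C)" for c
  proof -
    obtain p \<sigma> t where c: "c = real_class C (p, \<sigma>, t)" "nerve_simplex C p \<sigma>" "t \<in> standard_simplex p"
      using c unfolding topspace_classifying_space nerve_elems_def by auto
    \<comment> \<open>The parameter 0 may be cut in interval 0, where
      \<open>htpy_piece_start\<close> leaves the predicate that is true everywhere.\<close>
    have "cut_at 0 0 t" using c(3) by (simp add: cut_at_def standard_simplex_psum)
    then show ?thesis
      unfolding c(1) realize_real_class[OF sm]
      using hr[of 0] htpy_fun_eq[OF _ _ c(2,3), of 0 0] htpy_piece_start[OF c(2,3), of "\<lambda>_. True"] by simp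
  qed
  moreover have "h (1, c) = realize D (\<Phi> (\<lambda>_. False)) c" if c: "c \<in> topspace (classifying_space C)" for c
  proof -
    obtain p \<sigma> t where c: "c = real_class C (p, \<sigma>, t)" "nerve_simplex C p \<sigma>" "t \<in> standard_simplex p"
      using c unfolding topspace_classifying_space nerve_elems_def by auto
    have "t p \<ge> 0" "psum t (Suc p) = 1" using c(3) by (auto simp: standard_simplex_psum)
    then have "cut_at p 1 t" by (simp add: cut_at_def)
    then show ?thesis
      unfolding c(1) realize_real_class[OF sm]
      using hr[of 1] htpy_fun_eq[OF _ _ c(2,3), of 1 p] htpy_piece_end[OF c(2,3), of "\<lambda>_. False"] by simp
  qed
  ultimately show ?thesis by (subst homotopic_with) auto
qed

end

section \<open>Pasting in strict 2-categories\<close>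

lemma ex1_eqD: "\<lbrakk>\<exists>!x. Q x; Q a; Q b\<rbrakk> \<Longrightarrow> a = b"
  by blast

section \<open>Rewriting rules for strict 2-categories\<close>

locale two_cat =
  fixes C :: "('o,'a,'c,'m) cat2_scheme"
  assumes strict: "strict_2cat C"
begin

abbreviation comp1 (infixr "\<cdot>" 75) where "g \<cdot> f \<equiv> cmp C g f"
abbreviation comp2 (infixr "\<odot>" 65) where "b \<odot> a \<equiv> vcmp C b a"
abbreviation wl (infixr "\<triangleright>" 70) where "f \<triangleright> a \<equiv> hcmp C (id2 C f) a"
abbreviation wr (infixl "\<triangleleft>" 71) where "a \<triangleleft> f \<equiv> hcmp C a (id2 C f)"

lemmas axioms =
  strict[unfolded strict_2cat_def, THEN conjunct1]
  strict[unfolded strict_2cat_def, THEN conjunct2, THEN conjunct1]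
  strict[unfolded strict_2cat_def, THEN conjunct2, THEN conjunct2, THEN conjunct1]
  strict[unfolded strict_2cat_def, THEN conjunct2, THEN conjunct2, THEN conjunct2, THEN conjunct1]
  strict[unfolded strict_2cat_def, THEN conjunct2, THEN conjunct2, THEN conjunct2, THEN conjunct2, THEN conjunct1]
  strict[unfolded strict_2cat_def, THEN conjunct2, THEN conjunct2, THEN conjunct2, THEN conjunct2, THEN conjunct2, THEN conjunct1]
  strict[unfolded strict_2cat_def, THEN conjunct2, THEN conjunct2, THEN conjunct2, THEN conjunct2, THEN conjunct2, THEN conjunct2, THEN conjunct1]
  strict[unfolded strict_2cat_def, THEN conjunct2, THEN conjunct2, THEN conjunct2, THEN conjunct2, THEN conjunct2, THEN conjunct2, THEN conjunct2, THEN conjunct1]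
  strict[unfolded strict_2cat_def, THEN conjunct2, THEN conjunct2, THEN conjunct2, THEN conjunct2, THEN conjunct2, THEN conjunct2, THEN conjunct2, THEN conjunct2, THEN conjunct1]
  strict[unfolded strict_2cat_def, THEN conjunct2, THEN conjunct2, THEN conjunct2, THEN conjunct2, THEN conjunct2, THEN conjunct2, THEN conjunct2, THEN conjunct2, THEN conjunct2, THEN conjunct1]
  strict[unfolded strict_2cat_def, THEN conjunct2, THEN conjunct2, THEN conjunct2, THEN conjunct2, THEN conjunct2, THEN conjunct2, THEN conjunct2, THEN conjunct2, THEN conjunct2, THEN conjunct2, THEN conjunct1]
  strict[unfolded strict_2cat_def, THEN conjunct2, THEN conjunct2, THEN conjunct2, THEN conjunct2, THEN conjunct2, THEN conjunct2, THEN conjunct2, THEN conjunct2, THEN conjunct2, THEN conjunct2, THEN conjunct2, THEN conjunct1]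
  strict[unfolded strict_2cat_def, THEN conjunct2, THEN conjunct2, THEN conjunct2, THEN conjunct2, THEN conjunct2, THEN conjunct2, THEN conjunct2, THEN conjunct2, THEN conjunct2, THEN conjunct2, THEN conjunct2, THEN conjunct2, THEN conjunct1]
  strict[unfolded strict_2cat_def, THEN conjunct2, THEN conjunct2, THEN conjunct2, THEN conjunct2, THEN conjunct2, THEN conjunct2, THEN conjunct2, THEN conjunct2, THEN conjunct2, THEN conjunct2, THEN conjunct2, THEN conjunct2, THEN conjunct2, THEN conjunct1]
  strict[unfolded strict_2cat_def, THEN conjunct2, THEN conjunct2, THEN conjunct2, THEN conjunct2, THEN conjunct2, THEN conjunct2, THEN conjunct2, THEN conjunct2, THEN conjunct2, THEN conjunct2, THEN conjunct2, THEN conjunct2, THEN conjunct2, THEN conjunct2]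

lemma src_Obj [simp]: "f \<in> Hom C \<Longrightarrow> src C f \<in> Obj C"
  and tgt_Obj [simp]: "f \<in> Hom C \<Longrightarrow> tgt C f \<in> Obj C"
  using axioms(1) by auto

lemma idm_Hom [simp]: "x \<in> Obj C \<Longrightarrow> idm C x \<in> Hom C"
  and src_idm [simp]: "x \<in> Obj C \<Longrightarrow> src C (idm C x) = x"
  and tgt_idm [simp]: "x \<in> Obj C \<Longrightarrow> tgt C (idm C x) = x"
  using axioms(2) by auto

lemma comp_Hom [simp]: "\<lbrakk>f \<in> Hom C; g \<in> Hom C; tgt C f = src C g\<rbrakk> \<Longrightarrow> g \<cdot> f \<in> Hom C"
  and src_comp [simp]: "\<lbrakk>f \<in> Hom C; g \<in> Hom C; tgt C f = src C g\<rbrakk> \<Longrightarrow> src C (g \<cdot> f) = src C f"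
  and tgt_comp [simp]: "\<lbrakk>f \<in> Hom C; g \<in> Hom C; tgt C f = src C g\<rbrakk> \<Longrightarrow> tgt C (g \<cdot> f) = tgt C g"
  using axioms(3) by auto

lemma comp_assoc [simp]:
  "\<lbrakk>f \<in> Hom C; g \<in> Hom C; h \<in> Hom C; tgt C f = src C g; tgt C g = src C h\<rbrakk> \<Longrightarrow> (h \<cdot> g) \<cdot> f = h \<cdot> g \<cdot> f"
  using axioms(4) by metis

lemma comp_idm_left [simp]: "\<lbrakk>f \<in> Hom C; tgt C f = x\<rbrakk> \<Longrightarrow> idm C x \<cdot> f = f"
  and comp_idm_right [simp]: "\<lbrakk>f \<in> Hom C; src C f = x\<rbrakk> \<Longrightarrow> f \<cdot> idm C x = f"
  using axioms(5) by auto

lemma dom2_Hom [simp]: "a \<in> Cell C \<Longrightarrow> dom2 C a \<in> Hom C"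
  and cod2_Hom [simp]: "a \<in> Cell C \<Longrightarrow> cod2 C a \<in> Hom C"
  and src_cod2 [simp]: "a \<in> Cell C \<Longrightarrow> src C (cod2 C a) = src C (dom2 C a)"
  and tgt_cod2 [simp]: "a \<in> Cell C \<Longrightarrow> tgt C (cod2 C a) = tgt C (dom2 C a)"
  using axioms(6) by auto

lemma id2_Cell [simp]: "f \<in> Hom C \<Longrightarrow> id2 C f \<in> Cell C"
  and dom2_id2 [simp]: "f \<in> Hom C \<Longrightarrow> dom2 C (id2 C f) = f"
  and cod2_id2 [simp]: "f \<in> Hom C \<Longrightarrow> cod2 C (id2 C f) = f"
  using axioms(7) by auto

lemma vcomp_Cell [simp]: "\<lbrakk>a \<in> Cell C; b \<in> Cell C; cod2 C a = dom2 C b\<rbrakk> \<Longrightarrow> b \<odot> a \<in> Cell C"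
  and dom2_vcomp [simp]: "\<lbrakk>a \<in> Cell C; b \<in> Cell C; cod2 C a = dom2 C b\<rbrakk> \<Longrightarrow> dom2 C (b \<odot> a) = dom2 C a"
  and cod2_vcomp [simp]: "\<lbrakk>a \<in> Cell C; b \<in> Cell C; cod2 C a = dom2 C b\<rbrakk> \<Longrightarrow> cod2 C (b \<odot> a) = cod2 C b"
  using axioms(8) by auto

lemma vcomp_assoc [simp]:
  "\<lbrakk>a \<in> Cell C; b \<in> Cell C; c \<in> Cell C; cod2 C a = dom2 C b; cod2 C b = dom2 C c\<rbrakk>
    \<Longrightarrow> (c \<odot> b) \<odot> a = c \<odot> b \<odot> a"
  using axioms(9) by metis

lemma vcomp_id2_left [simp]: "\<lbrakk>a \<in> Cell C; cod2 C a = f\<rbrakk> \<Longrightarrow> id2 C f \<odot> a = a"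
  and vcomp_id2_right [simp]: "\<lbrakk>a \<in> Cell C; dom2 C a = f\<rbrakk> \<Longrightarrow> a \<odot> id2 C f = a"
  using axioms(10) by auto

lemma hcomp_Cell [simp]:
    "\<lbrakk>a \<in> Cell C; b \<in> Cell C; tgt C (dom2 C a) = src C (dom2 C b)\<rbrakk> \<Longrightarrow> hcmp C b a \<in> Cell C"
  and dom2_hcomp [simp]: "\<lbrakk>a \<in> Cell C; b \<in> Cell C; tgt C (dom2 C a) = src C (dom2 C b)\<rbrakk>
    \<Longrightarrow> dom2 C (hcmp C b a) = dom2 C b \<cdot> dom2 C a"
  and cod2_hcomp [simp]: "\<lbrakk>a \<in> Cell C; b \<in> Cell C; tgt C (dom2 C a) = src C (dom2 C b)\<rbrakk>
    \<Longrightarrow> cod2 C (hcmp C b a) = cod2 C b \<cdot> cod2 C a"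
  using axioms(11) by auto

lemma hcomp_assoc:
  "\<lbrakk>a \<in> Cell C; b \<in> Cell C; c \<in> Cell C; tgt C (dom2 C a) = src C (dom2 C b); tgt C (dom2 C b) = src C (dom2 C c)\<rbrakk>
    \<Longrightarrow> hcmp C c (hcmp C b a) = hcmp C (hcmp C c b) a"
  using axioms(12) by metis

lemma wl_idm [simp]: "\<lbrakk>a \<in> Cell C; tgt C (dom2 C a) = x\<rbrakk> \<Longrightarrow> idm C x \<triangleright> a = a"
  and wr_idm [simp]: "\<lbrakk>a \<in> Cell C; src C (dom2 C a) = x\<rbrakk> \<Longrightarrow> a \<triangleleft> idm C x = a"
  using axioms(13) by auto

lemma hcomp_id2 [simp]: "\<lbrakk>f \<in> Hom C; g \<in> Hom C; tgt C f = src C g\<rbrakk> \<Longrightarrow> g \<triangleright> id2 C f = id2 C (g \<cdot> f)"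
  using axioms(14) by auto

lemma interchange:
  "\<lbrakk>a \<in> Cell C; a' \<in> Cell C; b \<in> Cell C; b' \<in> Cell C; cod2 C a = dom2 C a'; cod2 C b = dom2 C b';
    tgt C (dom2 C a) = src C (dom2 C b)\<rbrakk>
    \<Longrightarrow> hcmp C (b' \<odot> b) (a' \<odot> a) = hcmp C b' a' \<odot> hcmp C b a"
  using axioms(15) by metis

lemma wl_vcomp:
  assumes "a \<in> Cell C" "b \<in> Cell C" "cod2 C a = dom2 C b" "f \<in> Hom C" "tgt C (dom2 C a) = src C f"
  shows "f \<triangleright> (b \<odot> a) = (f \<triangleright> b) \<odot> (f \<triangleright> a)"
  using interchange[of a b "id2 C f" "id2 C f"] assms by simp

lemma wr_vcomp:
  assumes "a \<in> Cell C" "b \<in> Cell C" "cod2 C a = dom2 C b" "f \<in> Hom C" "src C (dom2 C a) = tgt C f"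
  shows "(b \<odot> a) \<triangleleft> f = (b \<triangleleft> f) \<odot> (a \<triangleleft> f)"
  using interchange[of "id2 C f" "id2 C f" a b] assms by simp

text \<open>With \<open>wr_wr\<close> and \<open>wl_wr\<close> this brings a whiskered cell to the
  form \<open>g \<triangleright> a \<triangleleft> f\<close> with at most one 1-cell on each side,
  so that after distributing whiskering over vertical composites two pastings can be compared by
  \<open>simp\<close>.\<close>

lemma wl_wl [simp]:
  assumes "a \<in> Cell C" "f \<in> Hom C" "g \<in> Hom C" "tgt C (dom2 C a) = src C f" "tgt C f = src C g"
  shows "g \<triangleright> f \<triangleright> a = (g \<cdot> f) \<triangleright> a"
  using hcomp_assoc[of a "id2 C f" "id2 C g"] assms by simp

lemma wr_wr [simp]:
  assumes "a \<in> Cell C" "f \<in> Hom C" "g \<in> Hom C" "src C (dom2 C a) = tgt C g" "tgt C f = src C g"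
  shows "(a \<triangleleft> g) \<triangleleft> f = a \<triangleleft> (g \<cdot> f)"
  using hcomp_assoc[of "id2 C f" "id2 C g" a] assms by simp

lemma wl_wr [simp]:
  assumes "a \<in> Cell C" "f \<in> Hom C" "g \<in> Hom C" "tgt C (dom2 C a) = src C g" "src C (dom2 C a) = tgt C f"
  shows "(g \<triangleright> a) \<triangleleft> f = g \<triangleright> (a \<triangleleft> f)"
  using hcomp_assoc[of "id2 C f" a "id2 C g"] assms by simp

text \<open>Both sides split the horizontal composite of \<open>b\<close> and \<open>a\<close> by
  the interchange law, in the two possible orders.\<close>

lemma whisker_exchange:
  assumes "a \<in> Cell C" "b \<in> Cell C" "tgt C (dom2 C a) = src C (dom2 C b)"
  shows "(cod2 C b \<triangleright> a) \<odot> (b \<triangleleft> dom2 C a) = (b \<triangleleft> cod2 C a) \<odot> (dom2 C b \<triangleright> a)"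
  using interchange[of "id2 C (dom2 C a)" a b "id2 C (cod2 C b)"] interchange[of a "id2 C (cod2 C a)" "id2 C (dom2 C b)" b] assms
  by simp

lemma hcomp_whisker:
  assumes "a \<in> Cell C" "b \<in> Cell C" "tgt C (dom2 C a) = src C (dom2 C b)"
  shows "hcmp C b a = (b \<triangleleft> cod2 C a) \<odot> (dom2 C b \<triangleright> a)"
  using interchange[of a "id2 C (cod2 C a)" "id2 C (dom2 C b)" b] assms by simp

text \<open>Two adjacent lax squares and the four 2-cells between their sides: this is the
  compatibility law for horizontal composites in the comma object, stated inside one 2-category.
  First \<open>p\<close> is moved past \<open>\<beta>\<close>, then the two given laws apply, then
  \<open>d\<close> is moved past \<open>\<alpha>'\<close>.\<close>

lemma lax_square_paste:
  assumes f: "f \<in> Hom C" "f' \<in> Hom C" "f'' \<in> Hom C"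
    and "p \<in> Cell C" "dom2 C p = s" "cod2 C p = s'" "src C s = src C f" "tgt C s = src C f'"
    and "q \<in> Cell C" "dom2 C q = u" "cod2 C q = u'" "src C u = src C f'" "tgt C u = src C f''"
    and "c \<in> Cell C" "dom2 C c = t" "cod2 C c = t'" "src C t = tgt C f" "tgt C t = tgt C f'"
    and "d \<in> Cell C" "dom2 C d = v" "cod2 C d = v'" "src C v = tgt C f'" "tgt C v = tgt C f''"
    and "\<alpha> \<in> Cell C" "dom2 C \<alpha> = t \<cdot> f" "cod2 C \<alpha> = f' \<cdot> s"
    and "\<alpha>' \<in> Cell C" "dom2 C \<alpha>' = t' \<cdot> f" "cod2 C \<alpha>' = f' \<cdot> s'"
    and "\<beta> \<in> Cell C" "dom2 C \<beta> = v \<cdot> f'" "cod2 C \<beta> = f'' \<cdot> u"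
    and "\<beta>' \<in> Cell C" "dom2 C \<beta>' = v' \<cdot> f'" "cod2 C \<beta>' = f'' \<cdot> u'"
    and eq1: "(f' \<triangleright> p) \<odot> \<alpha> = \<alpha>' \<odot> (c \<triangleleft> f)"
    and eq2: "(f'' \<triangleright> q) \<odot> \<beta> = \<beta>' \<odot> (d \<triangleleft> f')"
  shows "(f'' \<triangleright> hcmp C q p) \<odot> (\<beta> \<triangleleft> s) \<odot> (v \<triangleright> \<alpha>) = (\<beta>' \<triangleleft> s') \<odot> (v' \<triangleright> \<alpha>') \<odot> (hcmp C d c \<triangleleft> f)"
proof -
  note [simp] = assms(1-35)
  have par: "s \<in> Hom C" "s' \<in> Hom C" "src C s' = src C s" "tgt C s' = tgt C s"
    "u \<in> Hom C" "u' \<in> Hom C" "src C u' = src C u" "tgt C u' = tgt C u"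
    "t \<in> Hom C" "t' \<in> Hom C" "src C t' = src C t" "tgt C t' = tgt C t"
    "v \<in> Hom C" "v' \<in> Hom C" "src C v' = src C v" "tgt C v' = tgt C v"
    using dom2_Hom[OF assms(4)] cod2_Hom[OF assms(4)] src_cod2[OF assms(4)] tgt_cod2[OF assms(4)]
      dom2_Hom[OF assms(9)] cod2_Hom[OF assms(9)] src_cod2[OF assms(9)] tgt_cod2[OF assms(9)]
      dom2_Hom[OF assms(14)] cod2_Hom[OF assms(14)] src_cod2[OF assms(14)] tgt_cod2[OF assms(14)]
      dom2_Hom[OF assms(19)] cod2_Hom[OF assms(19)] src_cod2[OF assms(19)] tgt_cod2[OF assms(19)]
    by simp_all
  note [simp] = par
  have qp: "hcmp C q p = (q \<triangleleft> s') \<odot> (u \<triangleright> p)" using hcomp_whisker[of p q] by simp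
  have dc: "hcmp C d c = (d \<triangleleft> t') \<odot> (v \<triangleright> c)" using hcomp_whisker[of c d] by simp
  have "(f'' \<triangleright> hcmp C q p) \<odot> (\<beta> \<triangleleft> s) \<odot> (v \<triangleright> \<alpha>) =
      (f'' \<triangleright> q \<triangleleft> s') \<odot> (((f'' \<cdot> u) \<triangleright> p) \<odot> (\<beta> \<triangleleft> s)) \<odot> (v \<triangleright> \<alpha>)"
    unfolding qp by (simp add: wl_vcomp)
  also have "((f'' \<cdot> u) \<triangleright> p) \<odot> (\<beta> \<triangleleft> s) = (\<beta> \<triangleleft> s') \<odot> ((v \<cdot> f') \<triangleright> p)"
    using whisker_exchange[of p \<beta>] by simp
  also have "(f'' \<triangleright> q \<triangleleft> s') \<odot> ((\<beta> \<triangleleft> s') \<odot> ((v \<cdot> f') \<triangleright> p)) \<odot> (v \<triangleright> \<alpha>) =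
      (((f'' \<triangleright> q) \<odot> \<beta>) \<triangleleft> s') \<odot> (v \<triangleright> ((f' \<triangleright> p) \<odot> \<alpha>))"
    by (simp add: wl_vcomp wr_vcomp)
  also have "\<dots> = (\<beta>' \<triangleleft> s') \<odot> ((d \<triangleleft> (f' \<cdot> s')) \<odot> (v \<triangleright> \<alpha>')) \<odot> (v \<triangleright> c \<triangleleft> f)"
    unfolding eq1 eq2 by (simp add: wl_vcomp wr_vcomp)
  also have "(d \<triangleleft> (f' \<cdot> s')) \<odot> (v \<triangleright> \<alpha>') = (v' \<triangleright> \<alpha>') \<odot> (d \<triangleleft> (t' \<cdot> f))"
    using whisker_exchange[of \<alpha>' d] by simp
  also have "(\<beta>' \<triangleleft> s') \<odot> ((v' \<triangleright> \<alpha>') \<odot> (d \<triangleleft> (t' \<cdot> f))) \<odot> (v \<triangleright> c \<triangleleft> f) =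
      (\<beta>' \<triangleleft> s') \<odot> (v' \<triangleright> \<alpha>') \<odot> (hcmp C d c \<triangleleft> f)"
    unfolding dc by (simp add: wr_vcomp)
  finally show ?thesis .
qed

text \<open>The vertical counterpart: the laws of the two 2-cells are stacked, sharing the middle
  filler \<open>\<alpha>'\<close>.\<close>

lemma lax_square_vcomp:
  assumes "f \<in> Hom C" "f' \<in> Hom C"
    and "p \<in> Cell C" "p' \<in> Cell C" "cod2 C p = dom2 C p'" "tgt C (dom2 C p) = src C f'" "src C (dom2 C p) = src C f"
    and "c \<in> Cell C" "c' \<in> Cell C" "cod2 C c = dom2 C c'" "src C (dom2 C c) = tgt C f" "tgt C (dom2 C c) = tgt C f'"
    and "\<alpha> \<in> Cell C" "dom2 C \<alpha> = dom2 C c \<cdot> f" "cod2 C \<alpha> = f' \<cdot> dom2 C p"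
    and "\<alpha>' \<in> Cell C" "dom2 C \<alpha>' = dom2 C c' \<cdot> f" "cod2 C \<alpha>' = f' \<cdot> dom2 C p'"
    and "\<alpha>'' \<in> Cell C" "dom2 C \<alpha>'' = cod2 C c' \<cdot> f" "cod2 C \<alpha>'' = f' \<cdot> cod2 C p'"
    and eq1: "(f' \<triangleright> p) \<odot> \<alpha> = \<alpha>' \<odot> (c \<triangleleft> f)"
    and eq2: "(f' \<triangleright> p') \<odot> \<alpha>' = \<alpha>'' \<odot> (c' \<triangleleft> f)"
  shows "(f' \<triangleright> (p' \<odot> p)) \<odot> \<alpha> = \<alpha>'' \<odot> ((c' \<odot> c) \<triangleleft> f)"
proof -
  note [simp] = assms(1-21)
  have [simp]: "src C (dom2 C p') = src C f" "tgt C (dom2 C p') = src C f'"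
    "src C (dom2 C c') = tgt C f" "tgt C (dom2 C c') = tgt C f'"
    using src_cod2[OF assms(3)] tgt_cod2[OF assms(3)] src_cod2[OF assms(8)] tgt_cod2[OF assms(8)] by simp_all
  have "(f' \<triangleright> (p' \<odot> p)) \<odot> \<alpha> = (f' \<triangleright> p') \<odot> ((f' \<triangleright> p) \<odot> \<alpha>)"
    by (simp add: wl_vcomp)
  also have "\<dots> = ((f' \<triangleright> p') \<odot> \<alpha>') \<odot> (c \<triangleleft> f)"
    unfolding eq1 by simp
  also have "\<dots> = \<alpha>'' \<odot> ((c' \<odot> c) \<triangleleft> f)"
    unfolding eq2 by (simp add: wr_vcomp)
  finally show ?thesis .
qed

section \<open>Invertible 2-cells and bijective whiskering\<close>

lemma iso2_Cell: "iso2 C a \<Longrightarrow> a \<in> Cell C"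
  by (simp add: iso2_def)

lemma iso2_id2: "f \<in> Hom C \<Longrightarrow> iso2 C (id2 C f)"
  unfolding iso2_def by (auto intro!: bexI[of _ "id2 C f"])

lemma iso2_inverse:
  assumes "iso2 C a"
  obtains b where "iso2 C b" "b \<in> Cell C" "dom2 C b = cod2 C a" "cod2 C b = dom2 C a"
    "b \<odot> a = id2 C (dom2 C a)" "a \<odot> b = id2 C (cod2 C a)"
  using assms that unfolding iso2_def by metis

lemma iso2_vcomp:
  assumes "iso2 C a" "iso2 C b" "cod2 C a = dom2 C b"
  shows "iso2 C (b \<odot> a)"
proof -
  obtain a' where a': "a' \<in> Cell C" "dom2 C a' = cod2 C a" "cod2 C a' = dom2 C a"
    "a' \<odot> a = id2 C (dom2 C a)" "a \<odot> a' = id2 C (cod2 C a)" using iso2_inverse[OF assms(1)] .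
  obtain b' where b': "b' \<in> Cell C" "dom2 C b' = cod2 C b" "cod2 C b' = dom2 C b"
    "b' \<odot> b = id2 C (dom2 C b)" "b \<odot> b' = id2 C (cod2 C b)" using iso2_inverse[OF assms(2)] .
  note c = iso2_Cell[OF assms(1)] iso2_Cell[OF assms(2)] a'(1) b'(1)
  have "(a' \<odot> b') \<odot> (b \<odot> a) = a' \<odot> (b' \<odot> b) \<odot> a" using c a'(2,3) b'(2,3) assms(3) by simp
  then have 1: "(a' \<odot> b') \<odot> (b \<odot> a) = id2 C (dom2 C a)"
    unfolding b'(4) using c a'(2-4) assms(3) by simp
  have "(b \<odot> a) \<odot> (a' \<odot> b') = b \<odot> (a \<odot> a') \<odot> b'" using c a'(2,3) b'(2,3) assms(3) by simp
  then have 2: "(b \<odot> a) \<odot> (a' \<odot> b') = id2 C (cod2 C b)"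
    unfolding a'(5) using c b'(2-5) assms(3) by simp
  show ?thesis unfolding iso2_def
    using 1 2 c a'(2,3) b'(2,3) assms(3) by (intro conjI bexI[of _ "a' \<odot> b'"]) simp_all
qed

lemma iso2_wl:
  assumes "iso2 C a" "f \<in> Hom C" "tgt C (dom2 C a) = src C f"
  shows "iso2 C (f \<triangleright> a)"
proof -
  obtain b where b: "b \<in> Cell C" "dom2 C b = cod2 C a" "cod2 C b = dom2 C a"
    "b \<odot> a = id2 C (dom2 C a)" "a \<odot> b = id2 C (cod2 C a)" using iso2_inverse[OF assms(1)] .
  note a = iso2_Cell[OF assms(1)]
  have "(f \<triangleright> b) \<odot> (f \<triangleright> a) = id2 C (f \<cdot> dom2 C a)" "(f \<triangleright> a) \<odot> (f \<triangleright> b) = id2 C (f \<cdot> cod2 C a)"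
    using wl_vcomp[of a b f] wl_vcomp[of b a f] a b assms(2,3) by simp_all
  then show ?thesis unfolding iso2_def
    using a b assms(2,3) by (intro conjI bexI[of _ "f \<triangleright> b"]) simp_all
qed

lemma iso2_wr:
  assumes "iso2 C a" "f \<in> Hom C" "src C (dom2 C a) = tgt C f"
  shows "iso2 C (a \<triangleleft> f)"
proof -
  obtain b where b: "b \<in> Cell C" "dom2 C b = cod2 C a" "cod2 C b = dom2 C a"
    "b \<odot> a = id2 C (dom2 C a)" "a \<odot> b = id2 C (cod2 C a)" using iso2_inverse[OF assms(1)] .
  note a = iso2_Cell[OF assms(1)]
  have "(b \<triangleleft> f) \<odot> (a \<triangleleft> f) = id2 C (dom2 C a \<cdot> f)" "(a \<triangleleft> f) \<odot> (b \<triangleleft> f) = id2 C (cod2 C a \<cdot> f)"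
    using wr_vcomp[of a b f] wr_vcomp[of b a f] a b assms(2,3) by simp_all
  then show ?thesis unfolding iso2_def
    using a b assms(2,3) by (intro conjI bexI[of _ "b \<triangleleft> f"]) simp_all
qed

lemma iso2_cancel_left:
  assumes "iso2 C t" "a \<in> Cell C" "b \<in> Cell C" "cod2 C a = dom2 C t" "cod2 C b = dom2 C t" "t \<odot> a = t \<odot> b"
  shows "a = b"
proof -
  obtain s where s: "s \<in> Cell C" "dom2 C s = cod2 C t" "cod2 C s = dom2 C t"
    "s \<odot> t = id2 C (dom2 C t)" "t \<odot> s = id2 C (cod2 C t)" using iso2_inverse[OF assms(1)] .
  note t = iso2_Cell[OF assms(1)]
  have "(s \<odot> t) \<odot> a = (s \<odot> t) \<odot> b" using assms s(1-3) t by simp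
  then show ?thesis unfolding s(4) using assms by simp
qed

lemma iso2_solve:
  assumes "iso2 C t" "b \<in> Cell C" "cod2 C b = cod2 C t"
  shows "\<exists>a. a \<in> Cell C \<and> dom2 C a = dom2 C b \<and> cod2 C a = dom2 C t \<and> t \<odot> a = b"
proof -
  obtain s where s: "s \<in> Cell C" "dom2 C s = cod2 C t" "cod2 C s = dom2 C t"
    "s \<odot> t = id2 C (dom2 C t)" "t \<odot> s = id2 C (cod2 C t)" using iso2_inverse[OF assms(1)] .
  note t = iso2_Cell[OF assms(1)]
  have "t \<odot> (s \<odot> b) = (t \<odot> s) \<odot> b" using assms s(1-3) t by simp
  also have "\<dots> = b" unfolding s(5) using assms by simp
  finally show ?thesis using assms s(1-3) t by (intro exI[of _ "s \<odot> b"]) simp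
qed

text \<open>Full faithfulness of precomposition with \<open>e\<close>, stated for one pair of
  1-cells at a time because in the application it is available only when both lie in the
  sub-2-category.\<close>

definition whisker_bij :: "'a \<Rightarrow> 'a \<Rightarrow> 'a \<Rightarrow> bool" where
  "whisker_bij e g g' \<longleftrightarrow> (\<forall>\<rho>. \<rho> \<in> Cell C \<and> dom2 C \<rho> = g \<cdot> e \<and> cod2 C \<rho> = g' \<cdot> e \<longrightarrow>
     (\<exists>!\<nu>. \<nu> \<in> Cell C \<and> dom2 C \<nu> = g \<and> cod2 C \<nu> = g' \<and> \<nu> \<triangleleft> e = \<rho>))"

lemma whisker_bij_idm:
  assumes "g \<in> Hom C" "g' \<in> Hom C" "src C g = x" "src C g' = x"
  shows "whisker_bij (idm C x) g g'"
proof -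
  have "\<exists>!\<nu>. \<nu> \<in> Cell C \<and> dom2 C \<nu> = g \<and> cod2 C \<nu> = g' \<and> \<nu> \<triangleleft> idm C x = \<rho>"
    if "\<rho> \<in> Cell C" "dom2 C \<rho> = g" "cod2 C \<rho> = g'" for \<rho>
    using that assms by (intro ex1I[of _ \<rho>]) auto
  then show ?thesis unfolding whisker_bij_def using assms by simp
qed

lemma whisker_bijD:
  assumes "whisker_bij e g g'" "\<nu> \<in> Cell C" "\<nu>' \<in> Cell C" "dom2 C \<nu> = g" "dom2 C \<nu>' = g"
    "cod2 C \<nu> = g'" "cod2 C \<nu>' = g'" "\<nu> \<triangleleft> e = \<nu>' \<triangleleft> e" "e \<in> Hom C" "tgt C e = src C g"
  shows "\<nu> = \<nu>'"
proof -
  have "\<exists>!\<mu>. \<mu> \<in> Cell C \<and> dom2 C \<mu> = g \<and> cod2 C \<mu> = g' \<and> \<mu> \<triangleleft> e = \<nu> \<triangleleft> e"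
    using assms(1)[unfolded whisker_bij_def, rule_format, of "\<nu> \<triangleleft> e"] assms(2-) by simp
  then show ?thesis by (rule ex1_eqD) (use assms in simp_all)
qed

text \<open>A triangular prism with ends \<open>\<nu>\<close> and \<open>c\<close>, lateral squares
  \<open>tij\<close>, \<open>tjk\<close>, \<open>tik\<close> and vertical edges \<open>ei\<close>,
  \<open>ek\<close>, the third being implicit in the squares. The equation says that the prism
  commutes.\<close>

definition tri_prop where
  "tri_prop ei ek gik gjk gij tjk tij tik f c \<nu> \<longleftrightarrow>
    \<nu> \<in> Cell C \<and> dom2 C \<nu> = gik \<and> cod2 C \<nu> = gjk \<cdot> gij \<and>
    (tjk \<triangleleft> f) \<odot> (gjk \<triangleright> tij) \<odot> (\<nu> \<triangleleft> ei) = (ek \<triangleright> c) \<odot> tik"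

text \<open>The lateral squares \<open>tij\<close> and \<open>tjk\<close> paste to an invertible
  cell, so commutativity of the prism prescribes \<open>\<nu> \<triangleleft> ei\<close>;
  bijectivity of whiskering then determines \<open>\<nu>\<close>.\<close>

lemma tri_prop_ex1:
  assumes "ei \<in> Hom C" "ej \<in> Hom C" "ek \<in> Hom C"
    and "gij \<in> Hom C" "gjk \<in> Hom C" "gik \<in> Hom C" "f \<in> Hom C" "h \<in> Hom C" "l \<in> Hom C"
    and "src C gij = tgt C ei" "src C gjk = tgt C ej" "src C gik = tgt C ei"
    and "tgt C gij = tgt C ej" "tgt C gjk = tgt C ek" "tgt C gik = tgt C ek"
    and "src C f = src C ei" "tgt C f = src C ej" "src C h = src C ej" "tgt C h = src C ek"
    and "src C l = src C ei" "tgt C l = src C ek"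
    and "iso2 C tij" "dom2 C tij = gij \<cdot> ei" "cod2 C tij = ej \<cdot> f"
    and "iso2 C tjk" "dom2 C tjk = gjk \<cdot> ej" "cod2 C tjk = ek \<cdot> h"
    and "iso2 C tik" "dom2 C tik = gik \<cdot> ei" "cod2 C tik = ek \<cdot> l"
    and "c \<in> Cell C" "dom2 C c = l" "cod2 C c = h \<cdot> f"
    and "whisker_bij ei gik (gjk \<cdot> gij)"
  shows "\<exists>!\<nu>. tri_prop ei ek gik gjk gij tjk tij tik f c \<nu>"
proof -
  let ?T = "(tjk \<triangleleft> f) \<odot> (gjk \<triangleright> tij)"
  note cells = iso2_Cell[OF assms(22)] iso2_Cell[OF assms(25)] iso2_Cell[OF assms(28)]
  note [simp] = cells assms(1-21,23,24,26,27,29-33)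
  have "iso2 C (tjk \<triangleleft> f)" "iso2 C (gjk \<triangleright> tij)"
    by (auto intro!: iso2_wr iso2_wl assms(22,25))
  then have T: "iso2 C ?T" using iso2_vcomp[of "gjk \<triangleright> tij" "tjk \<triangleleft> f"] by simp
  obtain \<rho> where \<rho>: "\<rho> \<in> Cell C" "dom2 C \<rho> = gik \<cdot> ei" "cod2 C \<rho> = gjk \<cdot> gij \<cdot> ei" "?T \<odot> \<rho> = (ek \<triangleright> c) \<odot> tik"
    using iso2_solve[OF T, of "(ek \<triangleright> c) \<odot> tik"] by auto
  have E: "\<exists>!\<nu>. \<nu> \<in> Cell C \<and> dom2 C \<nu> = gik \<and> cod2 C \<nu> = gjk \<cdot> gij \<and> \<nu> \<triangleleft> ei = \<rho>"
    using assms(34)[unfolded whisker_bij_def, rule_format, of \<rho>] \<rho> by simp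
  have eq: "\<nu> \<triangleleft> ei = \<rho> \<longleftrightarrow> (tjk \<triangleleft> f) \<odot> (gjk \<triangleright> tij) \<odot> (\<nu> \<triangleleft> ei) = (ek \<triangleright> c) \<odot> tik"
    if \<nu>: "\<nu> \<in> Cell C" "dom2 C \<nu> = gik" "cod2 C \<nu> = gjk \<cdot> gij" for \<nu>
  proof
    assume "\<nu> \<triangleleft> ei = \<rho>"
    then show "(tjk \<triangleleft> f) \<odot> (gjk \<triangleright> tij) \<odot> (\<nu> \<triangleleft> ei) = (ek \<triangleright> c) \<odot> tik"
      using \<rho> by simp
  next
    assume "(tjk \<triangleleft> f) \<odot> (gjk \<triangleright> tij) \<odot> (\<nu> \<triangleleft> ei) = (ek \<triangleright> c) \<odot> tik"
    then have "?T \<odot> (\<nu> \<triangleleft> ei) = ?T \<odot> \<rho>" unfolding \<rho>(4) using \<nu> by simp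
    then show "\<nu> \<triangleleft> ei = \<rho>" by (rule iso2_cancel_left[OF T, rotated -1]) (use \<nu> \<rho> in auto)
  qed
  have "tri_prop ei ek gik gjk gij tjk tij tik f c = (\<lambda>\<nu>. \<nu> \<in> Cell C \<and> dom2 C \<nu> = gik \<and>
      cod2 C \<nu> = gjk \<cdot> gij \<and> \<nu> \<triangleleft> ei = \<rho>)"
    unfolding tri_prop_def by (intro ext conj_cong refl) (simp add: eq)
  then show ?thesis using E by simp
qed

text \<open>Together with uniqueness this shows that moving along identities changes no
  2-cell.\<close>

lemma tri_prop_trivial:
  assumes "c \<in> Cell C" "dom2 C c = l" "cod2 C c = h \<cdot> f" "f \<in> Hom C" "h \<in> Hom C" "tgt C f = src C h"
    and "src C l = x" "tgt C l = z"
  shows "tri_prop (idm C x) (idm C z) l h f (id2 C h) (id2 C f) (id2 C l) f c c"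
proof -
  have "l \<in> Hom C" "tgt C h = z" "src C f = x"
    using dom2_Hom[OF assms(1)] tgt_cod2[OF assms(1)] src_cod2[OF assms(1)] assms by simp_all
  then show ?thesis using assms by (simp add: tri_prop_def)
qed

section \<open>Constructing and transporting simplices\<close>

lemma nerve_simplexI:
  assumes "\<And>i. i \<le> p \<Longrightarrow> x i \<in> Obj C"
    and "\<And>i j. i \<le> j \<Longrightarrow> j \<le> p \<Longrightarrow> f i j \<in> Hom C \<and> src C (f i j) = x i \<and> tgt C (f i j) = x j"
    and "\<And>i. i \<le> p \<Longrightarrow> f i i = idm C (x i)"
    and "\<And>i j k. i \<le> j \<Longrightarrow> j \<le> k \<Longrightarrow> k \<le> p \<Longrightarrow>
        c i j k \<in> Cell C \<and> dom2 C (c i j k) = f i k \<and> cod2 C (c i j k) = f j k \<cdot> f i j"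
    and "\<And>i j. i \<le> j \<Longrightarrow> j \<le> p \<Longrightarrow> c i i j = id2 C (f i j) \<and> c i j j = id2 C (f i j)"
    and "\<And>i j k l. i \<le> j \<Longrightarrow> j \<le> k \<Longrightarrow> k \<le> l \<Longrightarrow> l \<le> p \<Longrightarrow>
        (c j k l \<triangleleft> f i j) \<odot> c i j l = (f k l \<triangleright> c i j k) \<odot> c i k l"
  shows "nerve_simplex C p (\<lambda>i. if i \<le> p then x i else undefined,
      \<lambda>i j. if i \<le> j \<and> j \<le> p then f i j else undefined,
      \<lambda>i j k. if i \<le> j \<and> j \<le> k \<and> k \<le> p then c i j k else undefined)"
proof -
  have tr: "i \<le> k" if "i \<le> j" "j \<le> k" for i j k :: nat using that by simp
  show ?thesis
    unfolding nerve_simplex_def prod.case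
  proof (intro conjI allI impI)
    fix i j k l assume "i \<le> j \<and> j \<le> k \<and> k \<le> l \<and> l \<le> p"
    moreover from this have "i \<le> k" "j \<le> l" "k \<le> p" "j \<le> p" "i \<le> l" by auto
    ultimately show "((if j \<le> k \<and> k \<le> l \<and> l \<le> p then c j k l else undefined)
           \<triangleleft> (if i \<le> j \<and> j \<le> p then f i j else undefined)) \<odot>
          (if i \<le> j \<and> j \<le> l \<and> l \<le> p then c i j l else undefined) =
          ((if k \<le> l \<and> l \<le> p then f k l else undefined)
           \<triangleright> (if i \<le> j \<and> j \<le> k \<and> k \<le> p then c i j k else undefined)) \<odot>
          (if i \<le> k \<and> k \<le> l \<and> l \<le> p then c i k l else undefined)"
      using assms(6)[of i j k l] by simp
  next
    fix i j k assume a: "i \<le> j \<and> j \<le> k \<and> k \<le> p"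
    then have b: "i \<le> k" "j \<le> p" by auto
    note c = assms(4)[of i j k]
    show "(if i \<le> j \<and> j \<le> k \<and> k \<le> p then c i j k else undefined) \<in> Cell C"
      using a c by simp
    show "dom2 C (if i \<le> j \<and> j \<le> k \<and> k \<le> p then c i j k else undefined) =
        (if i \<le> k \<and> k \<le> p then f i k else undefined)"
      using a b c by simp
    show "cod2 C (if i \<le> j \<and> j \<le> k \<and> k \<le> p then c i j k else undefined) =
        (if j \<le> k \<and> k \<le> p then f j k else undefined) \<cdot> (if i \<le> j \<and> j \<le> p then f i j else undefined)"
      using a b c by simp
  qed (use assms in \<open>auto simp: not_le dest: tr\<close>)
qed

text \<open>The cells \<open>\<nu>\<close> are determined by their whiskerings with \<open>e\<close>, so the coherence law for them
  reduces, after pasting with the invertible squares \<open>t\<close>, to that of the original simplex.\<close>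

lemma transport_simplex:
  assumes \<sigma>: "nerve_simplex C p (x, f, c)"
    and e: "\<And>i. i \<le> p \<Longrightarrow> e i \<in> Hom C \<and> src C (e i) = x i \<and> tgt C (e i) = y i"
    and g: "\<And>i j. i \<le> j \<Longrightarrow> j \<le> p \<Longrightarrow> g i j \<in> Hom C \<and> src C (g i j) = y i \<and> tgt C (g i j) = y j"
    and g_idm: "\<And>i. i \<le> p \<Longrightarrow> g i i = idm C (y i)"
    and t: "\<And>i j. i \<le> j \<Longrightarrow> j \<le> p \<Longrightarrow> iso2 C (t i j) \<and> dom2 C (t i j) = g i j \<cdot> e i \<and> cod2 C (t i j) = e j \<cdot> f i j"
    and t_id2: "\<And>i. i \<le> p \<Longrightarrow> t i i = id2 C (e i)"
    and S_g: "\<And>i j. i \<le> j \<Longrightarrow> j \<le> p \<Longrightarrow> g i j \<in> S i"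
    and S_comp: "\<And>i j k h. i \<le> j \<Longrightarrow> j \<le> k \<Longrightarrow> k \<le> p \<Longrightarrow> h \<in> S i \<Longrightarrow> h \<in> Hom C \<Longrightarrow> tgt C h = y j \<Longrightarrow> g j k \<cdot> h \<in> S i"
    and bij: "\<And>i h h'. i \<le> p \<Longrightarrow> h \<in> S i \<Longrightarrow> h' \<in> S i \<Longrightarrow> h \<in> Hom C \<Longrightarrow> h' \<in> Hom C \<Longrightarrow> src C h = y i \<Longrightarrow>
      src C h' = y i \<Longrightarrow> tgt C h = tgt C h' \<Longrightarrow> whisker_bij (e i) h h'"
    and nu: "\<And>i j k. i \<le> j \<Longrightarrow> j \<le> k \<Longrightarrow> k \<le> p \<Longrightarrow>
      tri_prop (e i) (e k) (g i k) (g j k) (g i j) (t j k) (t i j) (t i k) (f i j) (c i j k) (\<nu> i j k)"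
  shows "nerve_simplex C p (\<lambda>i. if i \<le> p then y i else undefined,
      \<lambda>i j. if i \<le> j \<and> j \<le> p then g i j else undefined,
      \<lambda>i j k. if i \<le> j \<and> j \<le> k \<and> k \<le> p then \<nu> i j k else undefined)"
proof -
  have f: "f i j \<in> Hom C" "src C (f i j) = x i" "tgt C (f i j) = x j" if "i \<le> j" "j \<le> p" for i j
    using \<sigma> that unfolding nerve_simplex_def by auto
  have f_idm: "f i i = idm C (x i)" if "i \<le> p" for i
    using \<sigma> that unfolding nerve_simplex_def by auto
  have x: "x i \<in> Obj C" if "i \<le> p" for i
    using \<sigma> that unfolding nerve_simplex_def by auto
  have c: "c i j k \<in> Cell C" "dom2 C (c i j k) = f i k" "cod2 C (c i j k) = f j k \<cdot> f i j"
    if "i \<le> j" "j \<le> k" "k \<le> p" for i j k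
    using \<sigma> that unfolding nerve_simplex_def by auto
  have c_id2: "c i i j = id2 C (f i j)" "c i j j = id2 C (f i j)" if "i \<le> j" "j \<le> p" for i j
    using \<sigma> that unfolding nerve_simplex_def by auto
  have c_coh: "(c j k l \<triangleleft> f i j) \<odot> c i j l = (f k l \<triangleright> c i j k) \<odot> c i k l"
    if "i \<le> j" "j \<le> k" "k \<le> l" "l \<le> p" for i j k l
    using \<sigma> that unfolding nerve_simplex_def by auto
  have n: "\<nu> i j k \<in> Cell C" "dom2 C (\<nu> i j k) = g i k" "cod2 C (\<nu> i j k) = g j k \<cdot> g i j"
    "(t j k \<triangleleft> f i j) \<odot> (g j k \<triangleright> t i j) \<odot> (\<nu> i j k \<triangleleft> e i) = (e k \<triangleright> c i j k) \<odot> t i k"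
    if "i \<le> j" "j \<le> k" "k \<le> p" for i j k
    using nu[OF that] unfolding tri_prop_def by simp_all
  have tc: "t i j \<in> Cell C" if "i \<le> j" "j \<le> p" for i j using t[OF that] iso2_Cell by simp
  show ?thesis
  proof (rule nerve_simplexI)
    show "y i \<in> Obj C" if "i \<le> p" for i using e[OF that] tgt_Obj by metis
    show "g i j \<in> Hom C \<and> src C (g i j) = y i \<and> tgt C (g i j) = y j" if "i \<le> j" "j \<le> p" for i j
      using g that .
    show "g i i = idm C (y i)" if "i \<le> p" for i using g_idm that .
    show "\<nu> i j k \<in> Cell C \<and> dom2 C (\<nu> i j k) = g i k \<and> cod2 C (\<nu> i j k) = g j k \<cdot> g i j"
      if "i \<le> j" "j \<le> k" "k \<le> p" for i j k using n[OF that] by simp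
  next
    fix i j assume ij: "i \<le> j" "j \<le> p"
    then have ip: "i \<le> p" by simp
    note [simp] = e[OF ip] e[OF ij(2)] g[OF ij] g_idm[OF ip] g_idm[OF ij(2)] f[OF ij] f_idm[OF ip] f_idm[OF ij(2)]
      t[OF ij] t_id2[OF ip] t_id2[OF ij(2)] tc[OF ij] c_id2[OF ij]
    have bij': "whisker_bij (e i) (g i j) (g i j)"
      by (rule bij[OF ip]) (simp_all add: S_g[OF ij])
    \<comment> \<open>The prism over a degenerate triangle has an identity as one end and as one
      lateral square, so its equation says that \<open>t i j\<close> absorbs the whiskered cell;
      cancelling \<open>t i j\<close> leaves an identity.\<close>
    have "\<nu> i i j \<triangleleft> e i = id2 C (g i j) \<triangleleft> e i"
    proof (rule iso2_cancel_left[of "t i j"])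
      show "t i j \<odot> (\<nu> i i j \<triangleleft> e i) = t i j \<odot> (id2 C (g i j) \<triangleleft> e i)"
        using n[OF le_refl ij] by simp
    qed (use n[OF le_refl ij] in simp_all)
    from whisker_bijD[OF bij' _ _ _ _ _ _ this] have 1: "\<nu> i i j = id2 C (g i j)"
      using n[OF le_refl ij] by simp
    have "\<nu> i j j \<triangleleft> e i = id2 C (g i j) \<triangleleft> e i"
    proof (rule iso2_cancel_left[of "t i j"])
      show "t i j \<odot> (\<nu> i j j \<triangleleft> e i) = t i j \<odot> (id2 C (g i j) \<triangleleft> e i)"
        using n[OF ij(1) le_refl ij(2)] by simp
    qed (use n[OF ij(1) le_refl ij(2)] in simp_all)
    from whisker_bijD[OF bij' _ _ _ _ _ _ this] have 2: "\<nu> i j j = id2 C (g i j)"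
      using n[OF ij(1) le_refl ij(2)] by simp
    from 1 2 show "\<nu> i i j = id2 C (g i j) \<and> \<nu> i j j = id2 C (g i j)" ..
  next
    fix i j k l assume o: "i \<le> j" "j \<le> k" "k \<le> l" "l \<le> p"
    then have o': "i \<le> k" "i \<le> l" "j \<le> l" "k \<le> p" "j \<le> p" "i \<le> p" by auto
    note [simp] = e[OF o'(6)] e[OF o'(5)] e[OF o'(4)] e[OF o(4)]
      g[OF o(1) o'(5)] g[OF o'(1) o'(4)] g[OF o'(2) o(4)] g[OF o(2) o'(4)] g[OF o'(3) o(4)] g[OF o(3,4)]
      f[OF o(1) o'(5)] f[OF o'(1) o'(4)] f[OF o'(2) o(4)] f[OF o(2) o'(4)] f[OF o'(3) o(4)] f[OF o(3,4)]
      t[OF o(1) o'(5)] t[OF o'(1) o'(4)] t[OF o'(2) o(4)] t[OF o(2) o'(4)] t[OF o'(3) o(4)] t[OF o(3,4)]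
      tc[OF o(1) o'(5)] tc[OF o'(1) o'(4)] tc[OF o'(2) o(4)] tc[OF o(2) o'(4)] tc[OF o'(3) o(4)] tc[OF o(3,4)]
      c[OF o(1,2) o'(4)] c[OF o(1) o'(3) o(4)] c[OF o'(1) o(3,4)] c[OF o(2,3,4)]
      n(1-3)[OF o(1,2) o'(4)] n(1-3)[OF o(1) o'(3) o(4)] n(1-3)[OF o'(1) o(3,4)] n(1-3)[OF o(2,3,4)]
    note nijk = n(4)[OF o(1,2) o'(4)] and nijl = n(4)[OF o(1) o'(3) o(4)]
      and nikl = n(4)[OF o'(1) o(3,4)] and njkl = n(4)[OF o(2,3,4)]
    \<comment> \<open>The three squares along the path from \<open>i\<close> through
      \<open>j\<close> and \<open>k\<close> to \<open>l\<close>, pasted. Since \<open>?T\<close> is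
      invertible it can be cancelled, so the coherence law is tested after whiskering with
      \<open>e i\<close> and composing with \<open>?T\<close>.\<close>
    let ?T = "(t k l \<triangleleft> (f j k \<cdot> f i j)) \<odot> (g k l \<triangleright> t j k \<triangleleft> f i j) \<odot> ((g k l \<cdot> g j k) \<triangleright> t i j)"
    have T: "iso2 C ?T"
      using iso2_wr[of "t k l" "f j k \<cdot> f i j"] iso2_wl[of "t j k \<triangleleft> f i j" "g k l"] iso2_wr[of "t j k" "f i j"]
        iso2_wl[of "t i j" "g k l \<cdot> g j k"] by (intro iso2_vcomp) simp_all
    let ?L = "(\<nu> j k l \<triangleleft> g i j) \<odot> \<nu> i j l" and ?R = "(g k l \<triangleright> \<nu> i j k) \<odot> \<nu> i k l"
    have "?T \<odot> (?L \<triangleleft> e i) = (t k l \<triangleleft> (f j k \<cdot> f i j)) \<odot> (g k l \<triangleright> t j k \<triangleleft> f i j) \<odot>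
        (((g k l \<cdot> g j k) \<triangleright> t i j) \<odot> (\<nu> j k l \<triangleleft> (g i j \<cdot> e i))) \<odot> (\<nu> i j l \<triangleleft> e i)"
      by (simp add: wr_vcomp)
    \<comment> \<open>Exchanging \<open>\<nu> j k l\<close> with \<open>t i j\<close> brings it next
      to the squares of its own prism.\<close>
    also have "((g k l \<cdot> g j k) \<triangleright> t i j) \<odot> (\<nu> j k l \<triangleleft> (g i j \<cdot> e i)) =
        (\<nu> j k l \<triangleleft> (e j \<cdot> f i j)) \<odot> (g j l \<triangleright> t i j)"
      using whisker_exchange[of "t i j" "\<nu> j k l"] by simp
    also have "(t k l \<triangleleft> (f j k \<cdot> f i j)) \<odot> (g k l \<triangleright> t j k \<triangleleft> f i j) \<odot>
        ((\<nu> j k l \<triangleleft> (e j \<cdot> f i j)) \<odot> (g j l \<triangleright> t i j)) \<odot> (\<nu> i j l \<triangleleft> e i) =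
      (((t k l \<triangleleft> f j k) \<odot> (g k l \<triangleright> t j k) \<odot> (\<nu> j k l \<triangleleft> e j)) \<triangleleft> f i j) \<odot>
        (g j l \<triangleright> t i j) \<odot> (\<nu> i j l \<triangleleft> e i)"
      by (simp add: wr_vcomp)
    also have "\<dots> = ((e l \<triangleright> c j k l) \<triangleleft> f i j) \<odot> (t j l \<triangleleft> f i j) \<odot> (g j l \<triangleright> t i j) \<odot> (\<nu> i j l \<triangleleft> e i)"
      unfolding njkl by (simp add: wr_vcomp)
    also have "\<dots> = (e l \<triangleright> ((c j k l \<triangleleft> f i j) \<odot> c i j l)) \<odot> t i l"
      unfolding nijl by (simp add: wl_vcomp)
    finally have L: "?T \<odot> (?L \<triangleleft> e i) = (e l \<triangleright> ((c j k l \<triangleleft> f i j) \<odot> c i j l)) \<odot> t i l" .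
    have "?T \<odot> (?R \<triangleleft> e i) = (t k l \<triangleleft> (f j k \<cdot> f i j)) \<odot>
        (g k l \<triangleright> ((t j k \<triangleleft> f i j) \<odot> (g j k \<triangleright> t i j) \<odot> (\<nu> i j k \<triangleleft> e i))) \<odot> (\<nu> i k l \<triangleleft> e i)"
      by (simp add: wr_vcomp wl_vcomp)
    also have "\<dots> = ((t k l \<triangleleft> (f j k \<cdot> f i j)) \<odot> ((g k l \<cdot> e k) \<triangleright> c i j k)) \<odot> (g k l \<triangleright> t i k) \<odot> (\<nu> i k l \<triangleleft> e i)"
      unfolding nijk by (simp add: wl_vcomp)
    also have "(t k l \<triangleleft> (f j k \<cdot> f i j)) \<odot> ((g k l \<cdot> e k) \<triangleright> c i j k) = ((e l \<cdot> f k l) \<triangleright> c i j k) \<odot> (t k l \<triangleleft> f i k)"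
      using whisker_exchange[of "c i j k" "t k l"] by simp
    also have "(((e l \<cdot> f k l) \<triangleright> c i j k) \<odot> (t k l \<triangleleft> f i k)) \<odot> (g k l \<triangleright> t i k) \<odot> (\<nu> i k l \<triangleleft> e i) =
        ((e l \<cdot> f k l) \<triangleright> c i j k) \<odot> (t k l \<triangleleft> f i k) \<odot> (g k l \<triangleright> t i k) \<odot> (\<nu> i k l \<triangleleft> e i)"
      by simp
    also have "\<dots> = (e l \<triangleright> ((f k l \<triangleright> c i j k) \<odot> c i k l)) \<odot> t i l"
      unfolding nikl by (simp add: wl_vcomp)
    finally have R: "?T \<odot> (?R \<triangleleft> e i) = (e l \<triangleright> ((f k l \<triangleright> c i j k) \<odot> c i k l)) \<odot> t i l" .
    have "?L \<triangleleft> e i = ?R \<triangleleft> e i"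
      by (rule iso2_cancel_left[OF T]) (simp_all add: L R c_coh[OF o])
    \<comment> \<open>The classes \<open>S i\<close> serve this step: they contain both the edge
      from \<open>i\<close> to \<open>l\<close> and the composite of three edges, and whiskering is
      bijective between members.\<close>
    moreover have "whisker_bij (e i) (g i l) (g k l \<cdot> g j k \<cdot> g i j)"
      by (rule bij[OF o'(6)]) (use S_g[OF o'(2) o(4)] S_comp[OF o'(1) o(3,4)] S_comp[OF o(1,2) o'(4)] S_g[OF o(1) o'(5)] in simp_all)
    ultimately show "?L = ?R"
      by (elim whisker_bijD[rotated 7]) simp_all
  qed
qed

end

section \<open>Deformation onto a locally full sub-2-category\<close>

lemma nerve_map_simp_op:
  assumes "mono_upto \<theta> p q"
  shows "nerve_map G p (simp_op \<theta> p \<sigma>) = simp_op \<theta> p (nerve_map G q \<sigma>)"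
proof -
  have m: "\<theta> i \<le> \<theta> j" if "i \<le> j" "j \<le> p" for i j using assms that by (auto simp: mono_upto_def)
  have u: "\<theta> i \<le> q" if "i \<le> p" for i using assms that by (auto simp: mono_upto_def)
  show ?thesis
    by (cases \<sigma>) (simp add: nerve_map_def simp_op_def fun_eq_iff m u)
qed

locale two_functor = dom: two_cat C + cod: two_cat D
  for C :: "('o,'a,'c,'m) cat2_scheme" and D :: "('o2,'a2,'c2,'n) cat2_scheme" +
  fixes G :: "('o,'a,'c,'o2,'a2,'c2) fun2"
  assumes is_functor: "strict_2functor C D G"
begin

lemmas functor_axioms =
  is_functor[unfolded strict_2functor_def, THEN conjunct1]
  is_functor[unfolded strict_2functor_def, THEN conjunct2, THEN conjunct1]
  is_functor[unfolded strict_2functor_def, THEN conjunct2, THEN conjunct2, THEN conjunct1]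
  is_functor[unfolded strict_2functor_def, THEN conjunct2, THEN conjunct2, THEN conjunct2, THEN conjunct1]
  is_functor[unfolded strict_2functor_def, THEN conjunct2, THEN conjunct2, THEN conjunct2, THEN conjunct2, THEN conjunct1]
  is_functor[unfolded strict_2functor_def, THEN conjunct2, THEN conjunct2, THEN conjunct2, THEN conjunct2, THEN conjunct2, THEN conjunct1]
  is_functor[unfolded strict_2functor_def, THEN conjunct2, THEN conjunct2, THEN conjunct2, THEN conjunct2, THEN conjunct2, THEN conjunct2, THEN conjunct1]
  is_functor[unfolded strict_2functor_def, THEN conjunct2, THEN conjunct2, THEN conjunct2, THEN conjunct2, THEN conjunct2, THEN conjunct2, THEN conjunct2]

lemma fob_Obj [simp]: "x \<in> Obj C \<Longrightarrow> fob G x \<in> Obj D"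
  using functor_axioms(1) by blast

lemma fhom_Hom [simp]: "f \<in> Hom C \<Longrightarrow> fhom G f \<in> Hom D"
  and src_fhom [simp]: "f \<in> Hom C \<Longrightarrow> src D (fhom G f) = fob G (src C f)"
  and tgt_fhom [simp]: "f \<in> Hom C \<Longrightarrow> tgt D (fhom G f) = fob G (tgt C f)"
  using functor_axioms(2) by auto

lemma fcell_Cell [simp]: "a \<in> Cell C \<Longrightarrow> fcell G a \<in> Cell D"
  and dom2_fcell [simp]: "a \<in> Cell C \<Longrightarrow> dom2 D (fcell G a) = fhom G (dom2 C a)"
  and cod2_fcell [simp]: "a \<in> Cell C \<Longrightarrow> cod2 D (fcell G a) = fhom G (cod2 C a)"
  using functor_axioms(3) by auto

lemma fhom_idm [simp]: "x \<in> Obj C \<Longrightarrow> fhom G (idm C x) = idm D (fob G x)"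
  using functor_axioms(4) by blast

lemma fhom_comp [simp]: "\<lbrakk>f \<in> Hom C; g \<in> Hom C; tgt C f = src C g\<rbrakk>
    \<Longrightarrow> fhom G (cmp C g f) = cmp D (fhom G g) (fhom G f)"
  using functor_axioms(5) by blast

lemma fcell_id2 [simp]: "f \<in> Hom C \<Longrightarrow> fcell G (id2 C f) = id2 D (fhom G f)"
  using functor_axioms(6) by blast

lemma fcell_vcomp [simp]: "\<lbrakk>a \<in> Cell C; b \<in> Cell C; cod2 C a = dom2 C b\<rbrakk>
    \<Longrightarrow> fcell G (vcmp C b a) = vcmp D (fcell G b) (fcell G a)"
  using functor_axioms(7) by blast

lemma fcell_hcomp [simp]: "\<lbrakk>a \<in> Cell C; b \<in> Cell C; tgt C (dom2 C a) = src C (dom2 C b)\<rbrakk>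
    \<Longrightarrow> fcell G (hcmp C b a) = hcmp D (fcell G b) (fcell G a)"
  using functor_axioms(8) by blast

lemma nerve_map_simplex:
  assumes "nerve_simplex C p \<sigma>"
  shows "nerve_simplex D p (nerve_map G p \<sigma>)"
proof (cases \<sigma>)
  case (fields x f c)
  have f: "f i j \<in> Hom C" "src C (f i j) = x i" "tgt C (f i j) = x j" if "i \<le> j" "j \<le> p" for i j
    using assms that unfolding fields nerve_simplex_def by auto
  have f_idm: "f i i = idm C (x i)" if "i \<le> p" for i
    using assms that unfolding fields nerve_simplex_def by auto
  have x: "x i \<in> Obj C" if "i \<le> p" for i
    using assms that unfolding fields nerve_simplex_def by auto
  have c: "c i j k \<in> Cell C" "dom2 C (c i j k) = f i k" "cod2 C (c i j k) = cmp C (f j k) (f i j)"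
    if "i \<le> j" "j \<le> k" "k \<le> p" for i j k
    using assms that unfolding fields nerve_simplex_def by auto
  have c_id2: "c i i j = id2 C (f i j)" "c i j j = id2 C (f i j)" if "i \<le> j" "j \<le> p" for i j
    using assms that unfolding fields nerve_simplex_def by auto
  have c_coh: "vcmp C (hcmp C (c j k l) (id2 C (f i j))) (c i j l) = vcmp C (hcmp C (id2 C (f k l)) (c i j k)) (c i k l)"
    if "i \<le> j" "j \<le> k" "k \<le> l" "l \<le> p" for i j k l
    using assms that unfolding fields nerve_simplex_def by auto
  show ?thesis
    unfolding fields nerve_map_def prod.case
  proof (rule cod.nerve_simplexI)
    fix i j k l assume o: "i \<le> j" "j \<le> k" "k \<le> l" "l \<le> p"
    then have o': "i \<le> k" "i \<le> l" "j \<le> l" "k \<le> p" "j \<le> p" "i \<le> p" by auto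
    note s = f[OF o(1) o'(5)] f[OF o'(1) o'(4)] f[OF o'(2) o(4)] f[OF o(2) o'(4)] f[OF o'(3) o(4)] f[OF o(3,4)]
      c[OF o(1,2) o'(4)] c[OF o(1) o'(3) o(4)] c[OF o'(1) o(3,4)] c[OF o(2,3,4)]
    show "vcmp D (hcmp D (fcell G (c j k l)) (id2 D (fhom G (f i j)))) (fcell G (c i j l)) =
        vcmp D (hcmp D (id2 D (fhom G (f k l))) (fcell G (c i j k))) (fcell G (c i k l))"
      using arg_cong[OF c_coh[OF o], of "fcell G"] by (simp add: s)
  next
    fix i j k assume o: "i \<le> j" "j \<le> k" "k \<le> p"
    then have "j \<le> p" by simp
    then show "fcell G (c i j k) \<in> Cell D \<and> dom2 D (fcell G (c i j k)) = fhom G (f i k) \<and>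
        cod2 D (fcell G (c i j k)) = cmp D (fhom G (f j k)) (fhom G (f i j))"
      using c[OF o] f[of i j] f[of j k] o by simp
  qed (simp_all add: x f f_idm c_id2)
qed

lemma simplicial_map_nerve_map: "simplicial_map C D (nerve_map G)"
  unfolding simplicial_map_def
proof (intro conjI allI impI; (elim conjE)?)
  show "nerve_simplex D p (nerve_map G p \<sigma>)" if "nerve_simplex C p \<sigma>" for p \<sigma>
    using that by (rule nerve_map_simplex)
  show "nerve_map G p (simp_op \<theta> p \<sigma>) = simp_op \<theta> p (nerve_map G q \<sigma>)" if "mono_upto \<theta> p q" for p q \<theta> \<sigma>
    using that by (rule nerve_map_simp_op)
qed

end

text \<open>The situation in abstract form, with \<open>B\<close> the pullback, \<open>A\<close> the
  comma object and \<open>E X\<close> the 1-cell \<open>[h, 1, 1]\<close>. The squares are merely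
  required to exist; \<open>locally_full\<close> and \<open>E_bij\<close> turn them into simplices
  of \<open>B\<close>.\<close>

locale deformation = two_functor B A I
  for B :: "('o,'a,'c,'m) cat2_scheme" and A :: "('o2,'a2,'c2,'n) cat2_scheme"
    and I :: "('o,'a,'c,'o2,'a2,'c2) fun2" +
  fixes E :: "'o2 \<Rightarrow> 'a2"
  assumes inj_ob: "inj_on (fob I) (Obj B)"
    and inj_hom: "inj_on (fhom I) (Hom B)"
    and inj_cell: "inj_on (fcell I) (Cell B)"
    and locally_full: "\<lbrakk>g \<in> Hom B; h \<in> Hom B; c \<in> Cell A; dom2 A c = fhom I g; cod2 A c = fhom I h\<rbrakk>
      \<Longrightarrow> c \<in> fcell I ` Cell B"
    and E: "X \<in> Obj A \<Longrightarrow> E X \<in> Hom A \<and> src A (E X) = X \<and> tgt A (E X) \<in> fob I ` Obj B"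
    and E_image: "b \<in> Obj B \<Longrightarrow> E (fob I b) = idm A (fob I b)"
    and E_bij: "\<lbrakk>X \<in> Obj A; u \<in> fhom I ` Hom B; u' \<in> fhom I ` Hom B; src A u = tgt A (E X); src A u' = tgt A (E X);
      tgt A u = tgt A u'\<rbrakk> \<Longrightarrow> cod.whisker_bij (E X) u u'"
    and E_square: "M \<in> Hom A \<Longrightarrow> \<exists>g\<in>fhom I ` Hom B. \<exists>t. src A g = tgt A (E (src A M)) \<and> tgt A g = tgt A (E (tgt A M)) \<and>
      iso2 A t \<and> dom2 A t = cmp A g (E (src A M)) \<and> cod2 A t = cmp A (E (tgt A M)) M"
begin

text \<open>Composability in \<open>A\<close> descends to \<open>B\<close> because \<open>I\<close>
  is injective on objects.\<close>

lemma comp_image: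
  assumes "g \<in> fhom I ` Hom B" "h \<in> fhom I ` Hom B" "tgt A h = src A g"
  shows "cmp A g h \<in> fhom I ` Hom B"
proof -
  obtain g' h' where gh: "g' \<in> Hom B" "g = fhom I g'" "h' \<in> Hom B" "h = fhom I h'" using assms by blast
  have "fob I (tgt B h') = fob I (src B g')" using assms(3) gh by simp
  then have "tgt B h' = src B g'" using inj_ob gh by (simp add: inj_on_eq_iff)
  then have "cmp A g h = fhom I (cmp B g' h')" "cmp B g' h' \<in> Hom B" using gh by simp_all
  then show ?thesis by blast
qed

text \<open>The last two conjuncts make the retraction the identity on the image and normal.\<close>

definition square :: "'a2 \<Rightarrow> 'a2 \<times> 'c2 \<Rightarrow> bool" where
  "square M gt \<longleftrightarrow> fst gt \<in> fhom I ` Hom B \<and>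
     src A (fst gt) = tgt A (E (src A M)) \<and> tgt A (fst gt) = tgt A (E (tgt A M)) \<and>
     iso2 A (snd gt) \<and> dom2 A (snd gt) = cmp A (fst gt) (E (src A M)) \<and> cod2 A (snd gt) = cmp A (E (tgt A M)) M \<and>
     (M \<in> fhom I ` Hom B \<longrightarrow> gt = (M, id2 A M)) \<and>
     (M = idm A (src A M) \<longrightarrow> gt = (idm A (tgt A (E (src A M))), id2 A (E (src A M))))"

lemma square_ex:
  assumes M: "M \<in> Hom A"
  shows "\<exists>gt. square M gt"
proof -
  have s: "src A M \<in> Obj A" using M by simp
  note Es = E[OF s]
  consider (im) "M \<in> fhom I ` Hom B" | (idm) "M \<notin> fhom I ` Hom B" "M = idm A (src A M)"
    | (other) "M \<notin> fhom I ` Hom B" "M \<noteq> idm A (src A M)" by blast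
  then show ?thesis
  proof cases
    case im
    then obtain m where m: "m \<in> Hom B" "M = fhom I m" by blast
    have e: "E (src A M) = idm A (src A M)" "E (tgt A M) = idm A (tgt A M)"
      using m E_image by simp_all
    \<comment> \<open>For an identity in the image both normalizations apply; they agree because
      \<open>E\<close> is an identity there.\<close>
    have "M = idm A (src A M) \<longrightarrow> (M, id2 A M) = (idm A (tgt A (E (src A M))), id2 A (E (src A M)))"
    proof
      assume iM: "M = idm A (src A M)"
      have "tgt A M = src A M" using arg_cong[OF iM, of "tgt A"] s by simp
      with iM[symmetric] show "(M, id2 A M) = (idm A (tgt A (E (src A M))), id2 A (E (src A M)))"
        using s by (simp add: e)
    qed
    then show ?thesis
      using im M by (intro exI[of _ "(M, id2 A M)"]) (simp add: square_def e cod.iso2_id2)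
  next
    case idm
    \<comment> \<open>Although \<open>M\<close> is outside the image, the identity replacing it is
      inside, since the target of \<open>E\<close> comes from an object of \<open>B\<close>.\<close>
    obtain b where b: "b \<in> Obj B" "tgt A (E (src A M)) = fob I b" using Es by blast
    then have "idm A (tgt A (E (src A M))) = fhom I (idm B b)" by simp
    then have "idm A (tgt A (E (src A M))) \<in> fhom I ` Hom B" using b by (metis dom.idm_Hom imageI)
    moreover have "tgt A M = src A M" using s arg_cong[OF idm(2), of "tgt A"] by simp
    moreover have "cmp A (E (src A M)) M = E (src A M)"
      using Es s by (subst idm(2)) simp
    ultimately show ?thesis
      using idm(1) Es by (intro exI[of _ "(idm A (tgt A (E (src A M))), id2 A (E (src A M)))"])
        (simp add: square_def cod.iso2_id2)
  next
    case other
    then show ?thesis using E_square[OF M] unfolding square_def by auto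
  qed
qed

text \<open>Chosen per 1-cell, independently of any simplex containing it. This is why moving
  simplices commutes strictly with faces and degeneracies.\<close>

definition R :: "'a2 \<Rightarrow> 'a2" where "R M = fst (SOME gt. square M gt)"
definition T :: "'a2 \<Rightarrow> 'c2" where "T M = snd (SOME gt. square M gt)"

lemma square_RT: "M \<in> Hom A \<Longrightarrow> square M (R M, T M)"
  unfolding R_def T_def using someI_ex[OF square_ex] by simp

lemma
  assumes "M \<in> Hom A"
  shows R_image: "R M \<in> fhom I ` Hom B"
    and R_Hom: "R M \<in> Hom A"
    and src_R: "src A (R M) = tgt A (E (src A M))"
    and tgt_R: "tgt A (R M) = tgt A (E (tgt A M))"
    and T_iso: "iso2 A (T M)"
    and dom2_T: "dom2 A (T M) = cmp A (R M) (E (src A M))"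
    and cod2_T: "cod2 A (T M) = cmp A (E (tgt A M)) M"
proof -
  note s = square_RT[OF assms, unfolded square_def fst_conv snd_conv]
  from s show im: "R M \<in> fhom I ` Hom B" and "src A (R M) = tgt A (E (src A M))"
    and "tgt A (R M) = tgt A (E (tgt A M))" and "iso2 A (T M)"
    and "dom2 A (T M) = cmp A (R M) (E (src A M))" and "cod2 A (T M) = cmp A (E (tgt A M)) M"
    by - (elim conjE; assumption)+
  from im show "R M \<in> Hom A" by (rule imageE) simp
qed

lemma
  assumes "m \<in> Hom B"
  shows R_on_image: "R (fhom I m) = fhom I m" and T_on_image: "T (fhom I m) = id2 A (fhom I m)"
proof -
  have "fhom I m \<in> fhom I ` Hom B" using assms by (rule imageI)
  with square_RT[OF fhom_Hom[OF assms], unfolded square_def]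
  have "(R (fhom I m), T (fhom I m)) = (fhom I m, id2 A (fhom I m))" by (elim conjE) (erule mp)
  then show "R (fhom I m) = fhom I m" "T (fhom I m) = id2 A (fhom I m)" by simp_all
qed

lemma
  assumes "X \<in> Obj A"
  shows R_idm: "R (idm A X) = idm A (tgt A (E X))" and T_idm: "T (idm A X) = id2 A (E X)"
proof -
  have "idm A X = idm A (src A (idm A X))" using assms by simp
  with square_RT[OF cod.idm_Hom[OF assms], unfolded square_def]
  have "(R (idm A X), T (idm A X)) = (idm A (tgt A (E (src A (idm A X)))), id2 A (E (src A (idm A X))))"
    by (elim conjE) (erule mp)
  then show "R (idm A X) = idm A (tgt A (E X))" "T (idm A X) = id2 A (E X)" using assms by simp_all
qed

text \<open>Below, the vertices satisfying the upward closed predicate \<open>\<kappa>\<close> are moved along \<open>E\<close>;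
  an edge from an unmoved to a moved vertex becomes \<open>E (x j) \<circ> f i j\<close>, so that its square commutes
  strictly.\<close>

definition unit_at :: "(nat \<Rightarrow> bool) \<Rightarrow> (nat \<Rightarrow> 'o2) \<Rightarrow> nat \<Rightarrow> 'a2" where
  "unit_at \<kappa> x i = (if \<kappa> i then E (x i) else idm A (x i))"

definition hom_at :: "(nat \<Rightarrow> bool) \<Rightarrow> (nat \<Rightarrow> 'o2) \<Rightarrow> (nat \<Rightarrow> nat \<Rightarrow> 'a2) \<Rightarrow> nat \<Rightarrow> nat \<Rightarrow> 'a2" where
  "hom_at \<kappa> x f i j = (if \<kappa> i then R (f i j) else if \<kappa> j then cmp A (E (x j)) (f i j) else f i j)"

definition square_at :: "(nat \<Rightarrow> bool) \<Rightarrow> (nat \<Rightarrow> 'o2) \<Rightarrow> (nat \<Rightarrow> nat \<Rightarrow> 'a2) \<Rightarrow> nat \<Rightarrow> nat \<Rightarrow> 'c2" where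
  "square_at \<kappa> x f i j = (if \<kappa> i then T (f i j) else id2 A (hom_at \<kappa> x f i j))"

text \<open>A definite description suffices: by \<open>cell_at_ex1\<close> exactly one such cell
  exists over each triangle of a simplex, so no choices of 2-cells have to be made compatible with
  faces and degeneracies.\<close>

definition cell_at :: "(nat \<Rightarrow> bool) \<Rightarrow> (nat \<Rightarrow> 'o2) \<Rightarrow> (nat \<Rightarrow> nat \<Rightarrow> 'a2) \<Rightarrow> (nat \<Rightarrow> nat \<Rightarrow> nat \<Rightarrow> 'c2) \<Rightarrow>
    nat \<Rightarrow> nat \<Rightarrow> nat \<Rightarrow> 'c2" where
  "cell_at \<kappa> x f c i j k = (THE \<nu>. cod.tri_prop (unit_at \<kappa> x i) (unit_at \<kappa> x k) (hom_at \<kappa> x f i k) (hom_at \<kappa> x f j k) (hom_at \<kappa> x f i j)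
     (square_at \<kappa> x f j k) (square_at \<kappa> x f i j) (square_at \<kappa> x f i k) (f i j) (c i j k) \<nu>)"

definition deform :: "(nat \<Rightarrow> bool) \<Rightarrow> nat \<Rightarrow> ('o2,'a2,'c2) simplex \<Rightarrow> ('o2,'a2,'c2) simplex" where
  "deform \<kappa> p = (\<lambda>(x, f, c).
     (\<lambda>i. if i \<le> p then tgt A (unit_at \<kappa> x i) else undefined,
      \<lambda>i j. if i \<le> j \<and> j \<le> p then hom_at \<kappa> x f i j else undefined,
      \<lambda>i j k. if i \<le> j \<and> j \<le> k \<and> k \<le> p then cell_at \<kappa> x f c i j k else undefined))"

section \<open>Moving the vertices of a single simplex\<close>

context
  fixes p :: nat and x f c and \<kappa> :: "nat \<Rightarrow> bool"
  assumes \<sigma>: "nerve_simplex A p (x, f, c)"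
    and \<kappa>: "\<And>i j. i \<le> j \<Longrightarrow> j \<le> p \<Longrightarrow> \<kappa> i \<Longrightarrow> \<kappa> j"
begin

lemma simplex_Hom: "f i j \<in> Hom A" "src A (f i j) = x i" "tgt A (f i j) = x j" if "i \<le> j" "j \<le> p"
  using \<sigma> that unfolding nerve_simplex_def by auto

lemma simplex_idm: "f i i = idm A (x i)" if "i \<le> p"
  using \<sigma> that unfolding nerve_simplex_def by auto

lemma simplex_Obj: "x i \<in> Obj A" if "i \<le> p"
  using \<sigma> that unfolding nerve_simplex_def by auto

lemma simplex_Cell: "c i j k \<in> Cell A" "dom2 A (c i j k) = f i k" "cod2 A (c i j k) = cmp A (f j k) (f i j)"
  if "i \<le> j" "j \<le> k" "k \<le> p"
  using \<sigma> that unfolding nerve_simplex_def by auto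

lemma unit_at: "unit_at \<kappa> x i \<in> Hom A" "src A (unit_at \<kappa> x i) = x i" if "i \<le> p"
  using E[OF simplex_Obj[OF that]] simplex_Obj[OF that] by (auto simp: unit_at_def)

lemma hom_at: "hom_at \<kappa> x f i j \<in> Hom A" "src A (hom_at \<kappa> x f i j) = tgt A (unit_at \<kappa> x i)" "tgt A (hom_at \<kappa> x f i j) = tgt A (unit_at \<kappa> x j)"
  if "i \<le> j" "j \<le> p"
proof -
  have i: "i \<le> p" using that by simp
  note E[OF simplex_Obj[OF i]] E[OF simplex_Obj[OF that(2)]] simplex_Obj[OF i] simplex_Obj[OF that(2)] simplex_Hom[OF that] \<kappa>[OF that] R_Hom[OF simplex_Hom(1)[OF that]]
    src_R[OF simplex_Hom(1)[OF that]] tgt_R[OF simplex_Hom(1)[OF that]]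
  then show "hom_at \<kappa> x f i j \<in> Hom A" "src A (hom_at \<kappa> x f i j) = tgt A (unit_at \<kappa> x i)" "tgt A (hom_at \<kappa> x f i j) = tgt A (unit_at \<kappa> x j)"
    by (cases "\<kappa> i"; cases "\<kappa> j"; simp add: hom_at_def unit_at_def)+
qed

lemma square_at: "iso2 A (square_at \<kappa> x f i j)" "dom2 A (square_at \<kappa> x f i j) = cmp A (hom_at \<kappa> x f i j) (unit_at \<kappa> x i)"
    "cod2 A (square_at \<kappa> x f i j) = cmp A (unit_at \<kappa> x j) (f i j)" if "i \<le> j" "j \<le> p"
proof -
  have i: "i \<le> p" using that by simp
  note E[OF simplex_Obj[OF i]] E[OF simplex_Obj[OF that(2)]] simplex_Obj[OF i] simplex_Obj[OF that(2)] simplex_Hom[OF that] \<kappa>[OF that] hom_at[OF that]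
    T_iso[OF simplex_Hom(1)[OF that]] dom2_T[OF simplex_Hom(1)[OF that]] cod2_T[OF simplex_Hom(1)[OF that]] cod.iso2_id2[OF hom_at(1)[OF that]]
  then show "iso2 A (square_at \<kappa> x f i j)" "dom2 A (square_at \<kappa> x f i j) = cmp A (hom_at \<kappa> x f i j) (unit_at \<kappa> x i)"
    "cod2 A (square_at \<kappa> x f i j) = cmp A (unit_at \<kappa> x j) (f i j)"
    by (cases "\<kappa> i"; cases "\<kappa> j"; simp add: hom_at_def unit_at_def square_at_def)+
qed

text \<open>A class of 1-cells out of vertex \<open>i\<close> on which whiskering with its unit is
  known to be bijective. At an unmoved vertex the unit is an identity, so every 1-cell
  qualifies.\<close>

definition strict_homs :: "nat \<Rightarrow> 'a2 set" where "strict_homs i = (if \<kappa> i then fhom I ` Hom B else UNIV)"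

lemma strict_homs_gg: "hom_at \<kappa> x f i j \<in> strict_homs i" if "i \<le> j" "j \<le> p"
  using R_image[OF simplex_Hom(1)[OF that]] by (simp add: strict_homs_def hom_at_def)

text \<open>Upward closure of \<open>\<kappa>\<close> enters here: if \<open>i\<close> is moved then
  so is \<open>j\<close>, hence the edge out of \<open>j\<close> also comes from
  \<open>B\<close>.\<close>

lemma strict_homs_comp: "cmp A (hom_at \<kappa> x f j k) h \<in> strict_homs i"
  if "i \<le> j" "j \<le> k" "k \<le> p" "h \<in> strict_homs i" "tgt A h = tgt A (unit_at \<kappa> x j)"
proof (cases "\<kappa> i")
  case True
  then have "\<kappa> j" using \<kappa>[of i j] that by simp
  then have "hom_at \<kappa> x f j k \<in> fhom I ` Hom B" using strict_homs_gg[OF that(2,3)] by (simp add: strict_homs_def)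
  then show ?thesis using True that hom_at[OF that(2,3)] comp_image by (simp add: strict_homs_def)
qed (simp add: strict_homs_def)

lemma strict_homs_bij: "cod.whisker_bij (unit_at \<kappa> x i) h h'"
  if "i \<le> p" "h \<in> strict_homs i" "h' \<in> strict_homs i" "h \<in> Hom A" "h' \<in> Hom A" "src A h = tgt A (unit_at \<kappa> x i)"
    "src A h' = tgt A (unit_at \<kappa> x i)" "tgt A h = tgt A h'"
proof (cases "\<kappa> i")
  case True
  then show ?thesis using that E_bij[OF simplex_Obj[OF that(1)], of h h'] by (simp add: strict_homs_def unit_at_def)
next
  case False
  then show ?thesis using that simplex_Obj[OF that(1)] cod.whisker_bij_idm[of h h' "x i"] by (simp add: unit_at_def)
qed

lemma cell_at_ex1: "\<exists>!\<nu>. cod.tri_prop (unit_at \<kappa> x i) (unit_at \<kappa> x k) (hom_at \<kappa> x f i k) (hom_at \<kappa> x f j k) (hom_at \<kappa> x f i j)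
     (square_at \<kappa> x f j k) (square_at \<kappa> x f i j) (square_at \<kappa> x f i k) (f i j) (c i j k) \<nu>"
  if o: "i \<le> j" "j \<le> k" "k \<le> p"
proof -
  have o': "i \<le> p" "j \<le> p" "i \<le> k" using o by auto
  note s = unit_at[OF o'(1)] unit_at[OF o'(2)] unit_at[OF o(3)] hom_at[OF o(1) o'(2)] hom_at[OF o(2,3)] hom_at[OF o'(3) o(3)]
    simplex_Hom[OF o(1) o'(2)] simplex_Hom[OF o(2,3)] simplex_Hom[OF o'(3) o(3)] square_at[OF o(1) o'(2)] square_at[OF o(2,3)] square_at[OF o'(3) o(3)] simplex_Cell[OF o]
  show ?thesis
  proof (rule cod.tri_prop_ex1[where ej = "unit_at \<kappa> x j" and h = "f j k" and l = "f i k"])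
    show "cod.whisker_bij (unit_at \<kappa> x i) (hom_at \<kappa> x f i k) (cmp A (hom_at \<kappa> x f j k) (hom_at \<kappa> x f i j))"
      by (rule strict_homs_bij[OF o'(1) strict_homs_gg[OF o'(3) o(3)] strict_homs_comp[OF o strict_homs_gg[OF o(1) o'(2)]]]) (simp_all add: s)
  qed (simp_all add: s)
qed

lemmas cell_at_prop = theI'[OF cell_at_ex1, folded cell_at_def]

lemma nerve_simplex_deform: "nerve_simplex A p (deform \<kappa> p (x, f, c))"
  unfolding deform_def prod.case
proof (rule cod.transport_simplex[OF \<sigma>, where t = "square_at \<kappa> x f" and S = strict_homs])
  \<comment> \<open>Normality: at a moved vertex it comes from the normalization of
    \<open>square\<close> on identities.\<close>
  show "hom_at \<kappa> x f i i = idm A (tgt A (unit_at \<kappa> x i))" "square_at \<kappa> x f i i = id2 A (unit_at \<kappa> x i)" if "i \<le> p" for i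
    using simplex_Obj[OF that] simplex_idm[OF that] by (auto simp: hom_at_def unit_at_def square_at_def R_idm T_idm)
qed (use unit_at hom_at square_at strict_homs_gg strict_homs_comp strict_homs_bij cell_at_prop in simp_all)

text \<open>When units and squares are identities and edges are unchanged, the original
  \<open>c i j k\<close> solves the equation defining \<open>cell_at\<close>, whose solution is
  unique.\<close>

lemma deform_trivial: "deform \<kappa> p (x, f, c) = (x, f, c)"
  if triv: "\<And>i. i \<le> p \<Longrightarrow> unit_at \<kappa> x i = idm A (x i)" "\<And>i j. i \<le> j \<Longrightarrow> j \<le> p \<Longrightarrow> hom_at \<kappa> x f i j = f i j"
    "\<And>i j. i \<le> j \<Longrightarrow> j \<le> p \<Longrightarrow> square_at \<kappa> x f i j = id2 A (f i j)"
proof -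
  have "cell_at \<kappa> x f c i j k = c i j k" if o: "i \<le> j" "j \<le> k" "k \<le> p" for i j k
  proof -
    have o': "i \<le> p" "j \<le> p" "i \<le> k" using o by auto
    note s = simplex_Hom[OF o(1) o'(2)] simplex_Hom[OF o(2,3)] simplex_Hom[OF o'(3) o(3)] simplex_Cell[OF o]
    have "cod.tri_prop (idm A (x i)) (idm A (x k)) (f i k) (f j k) (f i j) (id2 A (f j k)) (id2 A (f i j)) (id2 A (f i k))
        (f i j) (c i j k) (c i j k)"
      by (rule cod.tri_prop_trivial) (simp_all add: s)
    then have "cod.tri_prop (unit_at \<kappa> x i) (unit_at \<kappa> x k) (hom_at \<kappa> x f i k) (hom_at \<kappa> x f j k) (hom_at \<kappa> x f i j)
        (square_at \<kappa> x f j k) (square_at \<kappa> x f i j) (square_at \<kappa> x f i k) (f i j) (c i j k) (c i j k)"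
      unfolding triv(1)[OF o'(1)] triv(1)[OF o(3)] triv(2)[OF o(1) o'(2)] triv(2)[OF o(2,3)] triv(2)[OF o'(3) o(3)]
        triv(3)[OF o(1) o'(2)] triv(3)[OF o(2,3)] triv(3)[OF o'(3) o(3)] .
    then show ?thesis unfolding cell_at_def by (rule the1_equality[OF cell_at_ex1[OF o]])
  qed
  then show ?thesis
    using triv \<sigma> simplex_Obj unfolding deform_def nerve_simplex_def prod.case
    by (simp add: fun_eq_iff)
qed

end

section \<open>The deformation as a simplicial homotopy\<close>

lemma deform_simplex:
  assumes "nerve_simplex A p \<sigma>" "\<And>i j. i \<le> j \<Longrightarrow> j \<le> p \<Longrightarrow> \<kappa> i \<Longrightarrow> \<kappa> j"
  shows "nerve_simplex A p (deform \<kappa> p \<sigma>)"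
  using nerve_simplex_deform assms by (cases \<sigma>) blast

text \<open>All ingredients at given indices depend only on the vertices, edges and 2-cell at those
  indices and on the predicate there, so reindexing leaves literally the same terms.\<close>

lemma deform_natural:
  assumes \<theta>: "mono_upto \<theta> p q" and \<kappa>: "\<And>i. i \<le> p \<Longrightarrow> \<kappa>' i = \<kappa> (\<theta> i)"
  shows "deform \<kappa>' p (simp_op \<theta> p \<sigma>) = simp_op \<theta> p (deform \<kappa> q \<sigma>)"
proof (cases \<sigma>)
  case (fields x f c)
  have m: "\<theta> i \<le> \<theta> j" if "i \<le> j" "j \<le> p" for i j using \<theta> that by (auto simp: mono_upto_def)
  have u: "\<theta> i \<le> q" if "i \<le> p" for i using \<theta> that by (auto simp: mono_upto_def)
  let ?x = "\<lambda>i. if i \<le> p then x (\<theta> i) else undefined"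
  let ?f = "\<lambda>i j. if i \<le> j \<and> j \<le> p then f (\<theta> i) (\<theta> j) else undefined"
  let ?c = "\<lambda>i j k. if i \<le> j \<and> j \<le> k \<and> k \<le> p then c (\<theta> i) (\<theta> j) (\<theta> k) else undefined"
  have e: "unit_at \<kappa>' ?x i = unit_at \<kappa> x (\<theta> i)" if "i \<le> p" for i
    using that by (simp add: unit_at_def \<kappa>)
  have g: "hom_at \<kappa>' ?x ?f i j = hom_at \<kappa> x f (\<theta> i) (\<theta> j)" if "i \<le> j" "j \<le> p" for i j
    using that by (simp add: hom_at_def \<kappa>)
  have t: "square_at \<kappa>' ?x ?f i j = square_at \<kappa> x f (\<theta> i) (\<theta> j)" if "i \<le> j" "j \<le> p" for i j
    using that g[OF that] by (simp add: square_at_def \<kappa>)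
  have n: "cell_at \<kappa>' ?x ?f ?c i j k = cell_at \<kappa> x f c (\<theta> i) (\<theta> j) (\<theta> k)" if o: "i \<le> j" "j \<le> k" "k \<le> p" for i j k
  proof -
    have o': "i \<le> p" "j \<le> p" "i \<le> k" using o by auto
    show ?thesis
      unfolding cell_at_def e[OF o'(1)] e[OF o(3)] g[OF o(1) o'(2)] g[OF o(2,3)] g[OF o'(3) o(3)]
        t[OF o(1) o'(2)] t[OF o(2,3)] t[OF o'(3) o(3)] using o o' by simp
  qed
  show ?thesis
    unfolding fields deform_def simp_op_def prod.case by (simp add: fun_eq_iff e g n m u)
qed

lemma simplicial_htpy_deform: "simplicial_htpy A A deform"
  unfolding simplicial_htpy_def
proof (intro conjI allI impI; elim conjE)
  fix p \<sigma> and \<kappa> :: "nat \<Rightarrow> bool"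
  assume "nerve_simplex A p \<sigma>" "\<forall>i j. i \<le> j \<and> j \<le> p \<and> \<kappa> i \<longrightarrow> \<kappa> j"
  then show "nerve_simplex A p (deform \<kappa> p \<sigma>)" by (intro deform_simplex) simp_all
next
  fix p q \<theta> \<sigma> and \<kappa> \<kappa>' :: "nat \<Rightarrow> bool"
  assume "mono_upto \<theta> p q" "\<forall>i\<le>p. \<kappa>' i = \<kappa> (\<theta> i)"
  then show "deform \<kappa>' p (simp_op \<theta> p \<sigma>) = simp_op \<theta> p (deform \<kappa> q \<sigma>)"
    by (intro deform_natural) simp_all
qed

lemma deform_False:
  assumes "nerve_simplex A p \<sigma>" shows "deform (\<lambda>_. False) p \<sigma> = \<sigma>"
proof (cases \<sigma>)
  case (fields x f c)
  show ?thesis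
    unfolding fields by (rule deform_trivial) (use assms fields in \<open>simp_all add: unit_at_def hom_at_def square_at_def\<close>)
qed

text \<open>\<open>E_image\<close> and the normalizations of \<open>square\<close> make every unit
  and filler trivial on the image, so the retraction is strict and not merely up to
  homotopy.\<close>

lemma deform_image:
  assumes "nerve_simplex B p \<tau>"
  shows "deform (\<lambda>_. True) p (nerve_map I p \<tau>) = nerve_map I p \<tau>"
proof -
  obtain x f c where \<tau>: "\<tau> = (x, f, c)" by (cases \<tau>)
  have x: "x i \<in> Obj B" if "i \<le> p" for i
    using assms that unfolding \<tau> nerve_simplex_def by auto
  have f: "f i j \<in> Hom B" if "i \<le> j" "j \<le> p" for i j
    using assms that unfolding \<tau> nerve_simplex_def by auto
  have "nerve_simplex A p (nerve_map I p \<tau>)" using assms by (rule nerve_map_simplex)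
  then show ?thesis
    unfolding \<tau> nerve_map_def prod.case
    by (rule deform_trivial) (simp_all add: unit_at_def hom_at_def square_at_def x f E_image R_on_image T_on_image)
qed

text \<open>This is only a cellwise inverse on the image, not a 2-functor on \<open>A\<close>;
  \<open>nerve_map\<close> just applies the three functions to the data of a simplex.\<close>

definition incl_inv :: "('o2,'a2,'c2,'o,'a,'c) fun2" where
  "incl_inv = \<lparr>fob = inv_into (Obj B) (fob I), fhom = inv_into (Hom B) (fhom I), fcell = inv_into (Cell B) (fcell I)\<rparr>"

lemma nerve_map_incl_inv:
  assumes "nerve_simplex B p \<tau>"
  shows "nerve_map incl_inv p (nerve_map I p \<tau>) = \<tau>"
proof -
  obtain x f c where \<tau>: "\<tau> = (x, f, c)" by (cases \<tau>)
  note n = assms[unfolded \<tau> nerve_simplex_def prod.case]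
  have "x i \<in> Obj B" if "i \<le> p" for i using n that by auto
  moreover have "f i j \<in> Hom B" if "i \<le> j" "j \<le> p" for i j using n that by auto
  moreover have "c i j k \<in> Cell B" if "i \<le> j" "j \<le> k" "k \<le> p" for i j k using n that by auto
  moreover have "x i = undefined" if "\<not> i \<le> p" for i using n that by auto
  moreover have "f i j = undefined" if "\<not> (i \<le> j \<and> j \<le> p)" for i j
    using n[THEN conjunct2, THEN conjunct1] that by simp
  moreover have "c i j k = undefined" if "\<not> (i \<le> j \<and> j \<le> k \<and> k \<le> p)" for i j k
    using n[THEN conjunct2, THEN conjunct2, THEN conjunct1] that by simp
  ultimately show ?thesis
    by (simp add: \<tau> nerve_map_def incl_inv_def fun_eq_iff inv_into_f_f inj_ob inj_hom inj_cell)
qed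

text \<open>Preimages are taken cell by cell; each simplex law holds for them because it holds after
  applying \<open>I\<close>, which is injective in every dimension.\<close>

lemma image_simplex:
  assumes \<sigma>: "nerve_simplex A p (x, f, c)"
    and x: "\<And>i. i \<le> p \<Longrightarrow> x i \<in> fob I ` Obj B"
    and f: "\<And>i j. i \<le> j \<Longrightarrow> j \<le> p \<Longrightarrow> f i j \<in> fhom I ` Hom B"
    and c: "\<And>i j k. i \<le> j \<Longrightarrow> j \<le> k \<Longrightarrow> k \<le> p \<Longrightarrow> c i j k \<in> fcell I ` Cell B"
  shows "\<exists>\<tau>. nerve_simplex B p \<tau> \<and> nerve_map I p \<tau> = (x, f, c)"
proof -
  note n = \<sigma>[unfolded nerve_simplex_def prod.case]
  define u where "u i = inv_into (Obj B) (fob I) (x i)" for i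
  define v where "v i j = inv_into (Hom B) (fhom I) (f i j)" for i j
  define w where "w i j k = inv_into (Cell B) (fcell I) (c i j k)" for i j k
  have u: "u i \<in> Obj B" "fob I (u i) = x i" if "i \<le> p" for i
    using x[OF that] unfolding u_def by (rule inv_into_into, rule f_inv_into_f)
  have v: "v i j \<in> Hom B" "fhom I (v i j) = f i j" if "i \<le> j" "j \<le> p" for i j
    using f[OF that] unfolding v_def by (rule inv_into_into, rule f_inv_into_f)
  have w: "w i j k \<in> Cell B" "fcell I (w i j k) = c i j k" if "i \<le> j" "j \<le> k" "k \<le> p" for i j k
    using c[OF that] unfolding w_def by (rule inv_into_into, rule f_inv_into_f)
  have f': "src A (f i j) = x i" "tgt A (f i j) = x j" if "i \<le> j" "j \<le> p" for i j
    using n that by auto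
  have f_idm: "f i i = idm A (x i)" if "i \<le> p" for i using n that by auto
  have c': "dom2 A (c i j k) = f i k" "cod2 A (c i j k) = cmp A (f j k) (f i j)" if "i \<le> j" "j \<le> k" "k \<le> p" for i j k
    using n that by auto
  have c_id2: "c i i j = id2 A (f i j)" "c i j j = id2 A (f i j)" if "i \<le> j" "j \<le> p" for i j
    using n that by auto
  have c_coh: "vcmp A (hcmp A (c j k l) (id2 A (f i j))) (c i j l) = vcmp A (hcmp A (id2 A (f k l)) (c i j k)) (c i k l)"
    if "i \<le> j" "j \<le> k" "k \<le> l" "l \<le> p" for i j k l
    using n that by auto
  have v': "src B (v i j) = u i" "tgt B (v i j) = u j" if o: "i \<le> j" "j \<le> p" for i j
  proof -
    have "i \<le> p" using o by simp
    then show "src B (v i j) = u i" "tgt B (v i j) = u j"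
      using f'[OF o] v[OF o] u[of i] u[of j] o by (auto intro!: inj_onD[OF inj_ob] simp flip: src_fhom tgt_fhom)
  qed
  have v_idm: "v i i = idm B (u i)" if "i \<le> p" for i
    using f_idm[OF that] v[OF le_refl that] u[OF that] by (intro inj_onD[OF inj_hom]) simp_all
  have w': "dom2 B (w i j k) = v i k" "cod2 B (w i j k) = cmp B (v j k) (v i j)" if o: "i \<le> j" "j \<le> k" "k \<le> p" for i j k
  proof -
    have o': "i \<le> p" "j \<le> p" "i \<le> k" using o by auto
    note s = v[OF o(1) o'(2)] v[OF o(2,3)] v[OF o'(3) o(3)] v'[OF o(1) o'(2)] v'[OF o(2,3)] v'[OF o'(3) o(3)] w[OF o]
    have "fhom I (dom2 B (w i j k)) = fhom I (v i k)" "fhom I (cod2 B (w i j k)) = fhom I (cmp B (v j k) (v i j))"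
      using dom2_fcell[OF w(1)[OF o]] cod2_fcell[OF w(1)[OF o]] by (simp_all add: s c'[OF o])
    then show "dom2 B (w i j k) = v i k" "cod2 B (w i j k) = cmp B (v j k) (v i j)"
      by (auto intro!: inj_onD[OF inj_hom] simp: s)
  qed
  have "nerve_simplex B p (\<lambda>i. if i \<le> p then u i else undefined,
      \<lambda>i j. if i \<le> j \<and> j \<le> p then v i j else undefined,
      \<lambda>i j k. if i \<le> j \<and> j \<le> k \<and> k \<le> p then w i j k else undefined)" (is "nerve_simplex B p ?\<tau>")
  proof (rule dom.nerve_simplexI)
    fix i j assume o: "i \<le> j" "j \<le> p"
    then have i: "i \<le> p" by simp
    have "w i i j = id2 B (v i j)" "w i j j = id2 B (v i j)"
      by (rule inj_onD[OF inj_cell]; simp add: w[OF le_refl o] w[OF o(1) le_refl o(2)] v[OF o] c_id2[OF o])+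
    then show "w i i j = id2 B (v i j) \<and> w i j j = id2 B (v i j)" ..
  next
    fix i j k l assume o: "i \<le> j" "j \<le> k" "k \<le> l" "l \<le> p"
    then have o': "i \<le> k" "i \<le> l" "j \<le> l" "k \<le> p" "j \<le> p" "i \<le> p" by auto
    note s = v[OF o(1) o'(5)] v[OF o'(1) o'(4)] v[OF o'(2) o(4)] v[OF o(2) o'(4)] v[OF o'(3) o(4)] v[OF o(3,4)]
      v'[OF o(1) o'(5)] v'[OF o'(1) o'(4)] v'[OF o'(2) o(4)] v'[OF o(2) o'(4)] v'[OF o'(3) o(4)] v'[OF o(3,4)]
      w[OF o(1,2) o'(4)] w[OF o(1) o'(3) o(4)] w[OF o'(1) o(3,4)] w[OF o(2,3,4)]
      w'[OF o(1,2) o'(4)] w'[OF o(1) o'(3) o(4)] w'[OF o'(1) o(3,4)] w'[OF o(2,3,4)]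
    show "vcmp B (hcmp B (w j k l) (id2 B (v i j))) (w i j l) = vcmp B (hcmp B (id2 B (v k l)) (w i j k)) (w i k l)"
      by (rule inj_onD[OF inj_cell]) (simp_all add: s c_coh[OF o])
  qed (simp_all add: u v v' v_idm w w')
  moreover have "nerve_map I p ?\<tau> = (x, f, c)"
    using n by (simp add: nerve_map_def fun_eq_iff u v w)
  ultimately show ?thesis by blast
qed

text \<open>Moved vertices and edges come from \<open>B\<close> by construction; the 2-cells follow
  by local fullness, their boundaries being in the image.\<close>

lemma deform_True_image:
  assumes \<sigma>: "nerve_simplex A p \<sigma>"
  shows "\<exists>\<tau>. nerve_simplex B p \<tau> \<and> nerve_map I p \<tau> = deform (\<lambda>_. True) p \<sigma>"
proof (cases \<sigma>)
  case (fields x f c)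
  note s = \<sigma>[unfolded fields]
  let ?T = "\<lambda>_::nat. True"
  have gI: "hom_at ?T x f i j \<in> fhom I ` Hom B" if "i \<le> j" "j \<le> p" for i j
    using R_image[OF simplex_Hom(1)[OF s _ that]] by (simp add: hom_at_def)
  show ?thesis
    unfolding fields deform_def prod.case
  proof (rule image_simplex)
    show "nerve_simplex A p (\<lambda>i. if i \<le> p then tgt A (unit_at ?T x i) else undefined,
        \<lambda>i j. if i \<le> j \<and> j \<le> p then hom_at ?T x f i j else undefined,
        \<lambda>i j k. if i \<le> j \<and> j \<le> k \<and> k \<le> p then cell_at ?T x f c i j k else undefined)"
      using nerve_simplex_deform[OF s, of ?T] by (simp add: deform_def)
    show "(if i \<le> p then tgt A (unit_at ?T x i) else undefined) \<in> fob I ` Obj B" if "i \<le> p" for i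
      using that E[OF simplex_Obj[OF s _ that, of ?T]] by (simp add: unit_at_def)
    show "(if i \<le> j \<and> j \<le> p then hom_at ?T x f i j else undefined) \<in> fhom I ` Hom B" if "i \<le> j" "j \<le> p" for i j
      using that gI[OF that] by simp
    show "(if i \<le> j \<and> j \<le> k \<and> k \<le> p then cell_at ?T x f c i j k else undefined) \<in> fcell I ` Cell B"
      if o: "i \<le> j" "j \<le> k" "k \<le> p" for i j k
    proof -
      have o': "i \<le> p" "j \<le> p" "i \<le> k" using o by auto
      have tri: "cell_at ?T x f c i j k \<in> Cell A" "dom2 A (cell_at ?T x f c i j k) = hom_at ?T x f i k"
          "cod2 A (cell_at ?T x f c i j k) = cmp A (hom_at ?T x f j k) (hom_at ?T x f i j)"
        using cell_at_prop[OF s _ o, of ?T] unfolding cod.tri_prop_def by simp_all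
      have "cmp A (hom_at ?T x f j k) (hom_at ?T x f i j) \<in> fhom I ` Hom B"
        by (rule comp_image[OF gI[OF o(2,3)] gI[OF o(1) o'(2)]])
          (simp add: hom_at(2)[OF s _ o(2,3), of ?T] hom_at(3)[OF s _ o(1) o'(2), of ?T])
      then obtain h where h: "h \<in> Hom B" "cmp A (hom_at ?T x f j k) (hom_at ?T x f i j) = fhom I h" by blast
      obtain g where g: "g \<in> Hom B" "hom_at ?T x f i k = fhom I g" using gI[OF o'(3) o(3)] by blast
      show ?thesis using locally_full[OF g(1) h(1) tri(1)] tri(2,3) g(2) h(2) o by simp
    qed
  qed
qed

lemma homotopy_equivalence_B_map:
  "homotopy_equivalence_map (classifying_space B) (classifying_space A) (B_map A I)"
proof -
  \<comment> \<open>Since the fully moved simplex lies in the image, \<open>incl_inv\<close> reads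
    it as a simplex of \<open>B\<close>; this is the homotopy inverse on the level of
    nerves.\<close>
  define r where "r p \<sigma> = nerve_map incl_inv p (deform (\<lambda>_. True) p \<sigma>)" for p \<sigma>
  have r: "nerve_simplex B p (r p \<sigma>)" "nerve_map I p (r p \<sigma>) = deform (\<lambda>_. True) p \<sigma>"
    if n: "nerve_simplex A p \<sigma>" for p \<sigma>
  proof -
    obtain \<tau> where \<tau>: "nerve_simplex B p \<tau>" "nerve_map I p \<tau> = deform (\<lambda>_. True) p \<sigma>"
      using deform_True_image[OF n] by blast
    have "r p \<sigma> = \<tau>" unfolding r_def \<tau>(2)[symmetric] by (rule nerve_map_incl_inv[OF \<tau>(1)])
    then show "nerve_simplex B p (r p \<sigma>)" "nerve_map I p (r p \<sigma>) = deform (\<lambda>_. True) p \<sigma>"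
      using \<tau> by simp_all
  qed
  have rm: "simplicial_map A B r"
    unfolding simplicial_map_def
  proof (intro conjI allI impI; (elim conjE)?)
    show "r p (simp_op \<theta> p \<sigma>) = simp_op \<theta> p (r q \<sigma>)" if "mono_upto \<theta> p q" for p q \<theta> \<sigma>
      unfolding r_def nerve_map_simp_op[OF that, symmetric]
      by (simp add: deform_natural[OF that, of "\<lambda>_. True" "\<lambda>_. True"])
  qed (rule r(1))
  have im: "simplicial_map B A (nerve_map I)" by (rule simplicial_map_nerve_map)
  have BI: "B_map A I = realize A (nerve_map I)"
    by (intro ext) (simp add: B_map_def realize_def descend_def)
  let ?f = "realize A (nerve_map I)" and ?g = "realize B r"
  have dm: "simplicial_map A A (deform (\<lambda>_. b))" for b
    unfolding simplicial_map_def by (simp add: deform_simplex deform_natural)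
  have 1: "homotopic_with (\<lambda>h. True) (classifying_space B) (classifying_space B) (?g \<circ> ?f) id"
  proof (rule homotopic_with_equal)
    show "continuous_map (classifying_space B) (classifying_space B) (?g \<circ> ?f)"
      using continuous_map_realize[OF im] continuous_map_realize[OF rm] by (rule continuous_map_compose)
    fix c assume "c \<in> topspace (classifying_space B)"
    then obtain p \<tau> t where c: "c = real_class B (p, \<tau>, t)" "nerve_simplex B p \<tau>"
      unfolding topspace_classifying_space nerve_elems_def by auto
    show "(?g \<circ> ?f) c = id c"
      by (simp add: c realize_real_class[OF im] realize_real_class[OF rm] r_def deform_image nerve_map_incl_inv)
  qed simp_all
  have 2: "homotopic_with (\<lambda>h. True) (classifying_space A) (classifying_space A) (?f \<circ> ?g) id"
  proof -
    \<comment> \<open>On simplices this composite is \<open>deform\<close> with every vertex moved,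
      the end of the simplicial homotopy opposite to the identity.\<close>
    have "homotopic_with (\<lambda>h. True) (classifying_space A) (classifying_space A) (?f \<circ> ?g) (realize A (deform (\<lambda>_. True)))"
    proof (rule homotopic_with_equal)
      show "continuous_map (classifying_space A) (classifying_space A) (?f \<circ> ?g)"
        using continuous_map_realize[OF rm] continuous_map_realize[OF im] by (rule continuous_map_compose)
      fix c assume "c \<in> topspace (classifying_space A)"
      then obtain p \<sigma> t where c: "c = real_class A (p, \<sigma>, t)" "nerve_simplex A p \<sigma>"
        unfolding topspace_classifying_space nerve_elems_def by auto
      show "(?f \<circ> ?g) c = realize A (deform (\<lambda>_. True)) c"
        by (simp add: c r realize_real_class[OF im] realize_real_class[OF rm] realize_real_class[OF dm])
    qed simp_all
    moreover have "homotopic_with (\<lambda>h. True) (classifying_space A) (classifying_space A) (realize A (deform (\<lambda>_. False))) id"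
    proof (rule homotopic_with_equal)
      show "continuous_map (classifying_space A) (classifying_space A) (realize A (deform (\<lambda>_. False)))"
        by (rule continuous_map_realize[OF dm])
      fix c assume "c \<in> topspace (classifying_space A)"
      then obtain p \<sigma> t where c: "c = real_class A (p, \<sigma>, t)" "nerve_simplex A p \<sigma>"
        unfolding topspace_classifying_space nerve_elems_def by auto
      show "realize A (deform (\<lambda>_. False)) c = id c"
        by (simp add: c deform_False realize_real_class[OF dm])
    qed simp_all
    ultimately show ?thesis
      using homotopic_with_trans homotopic_realize[OF simplicial_htpy_deform] by blast
  qed
  show ?thesis
    unfolding homotopy_equivalence_map_def BI
    using 1 2 continuous_map_realize[OF im] continuous_map_realize[OF rm] by blast
qed

end

section \<open>Strict pullbacks and lax comma objects\<close>

locale cospan = P: two_functor K L P + F: two_functor J L F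
  for K :: "('ok,'ak,'ck) cat2" and L :: "('ol,'al,'cl) cat2" and J :: "('oj,'aj,'cj) cat2"
    and P :: "('ok,'ak,'ck,'ol,'al,'cl) fun2" and F :: "('oj,'aj,'cj,'ol,'al,'cl) fun2"
begin

section \<open>The pullback 2-category\<close>

abbreviation "PB \<equiv> pb K J P F"
abbreviation "CM \<equiv> comma K L J P F"

lemma pb_mem [simp]:
  "(k, j) \<in> Obj PB \<longleftrightarrow> k \<in> Obj K \<and> j \<in> Obj J \<and> fob P k = fob F j"
  "(s, t) \<in> Hom PB \<longleftrightarrow> s \<in> Hom K \<and> t \<in> Hom J \<and> fhom P s = fhom F t"
  "(\<phi>, \<gamma>) \<in> Cell PB \<longleftrightarrow> \<phi> \<in> Cell K \<and> \<gamma> \<in> Cell J \<and> fcell P \<phi> = fcell F \<gamma>"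
  by (simp_all add: pb_def)

lemma pb_ops [simp]:
  "src PB (s, t) = (src K s, src J t)" "tgt PB (s, t) = (tgt K s, tgt J t)" "idm PB (k, j) = (idm K k, idm J j)"
  "cmp PB (s', t') (s, t) = (cmp K s' s, cmp J t' t)"
  "dom2 PB (\<phi>, \<gamma>) = (dom2 K \<phi>, dom2 J \<gamma>)" "cod2 PB (\<phi>, \<gamma>) = (cod2 K \<phi>, cod2 J \<gamma>)"
  "id2 PB (s, t) = (id2 K s, id2 J t)"
  "vcmp PB (\<phi>', \<gamma>') (\<phi>, \<gamma>) = (vcmp K \<phi>' \<phi>, vcmp J \<gamma>' \<gamma>)"
  "hcmp PB (\<phi>', \<gamma>') (\<phi>, \<gamma>) = (hcmp K \<phi>' \<phi>, hcmp J \<gamma>' \<gamma>)"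
  by (simp_all add: pb_def)

text \<open>Boundaries of a matching pair match, as seen by comparing boundaries in
  \<open>L\<close>; this is the closure needed for componentwise operations on the pullback.\<close>

lemma pb_parallel:
  "\<phi> \<in> Cell K \<Longrightarrow> \<gamma> \<in> Cell J \<Longrightarrow> fcell P \<phi> = fcell F \<gamma> \<Longrightarrow> fhom P (dom2 K \<phi>) = fhom F (dom2 J \<gamma>)"
  "\<phi> \<in> Cell K \<Longrightarrow> \<gamma> \<in> Cell J \<Longrightarrow> fcell P \<phi> = fcell F \<gamma> \<Longrightarrow> fhom P (cod2 K \<phi>) = fhom F (cod2 J \<gamma>)"
  "s \<in> Hom K \<Longrightarrow> t \<in> Hom J \<Longrightarrow> fhom P s = fhom F t \<Longrightarrow> fob P (src K s) = fob F (src J t)"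
  "s \<in> Hom K \<Longrightarrow> t \<in> Hom J \<Longrightarrow> fhom P s = fhom F t \<Longrightarrow> fob P (tgt K s) = fob F (tgt J t)"
  by (simp_all flip: P.dom2_fcell F.dom2_fcell P.cod2_fcell F.cod2_fcell P.src_fhom F.src_fhom P.tgt_fhom F.tgt_fhom)

lemma strict_2cat_pb: "strict_2cat PB"
  unfolding strict_2cat_def
  by (intro conjI ballI impI; clarsimp simp: pb_parallel P.dom.interchange F.dom.interchange
      P.dom.hcomp_assoc F.dom.hcomp_assoc)

section \<open>The comma 2-category\<close>

lemma comma_Obj [simp]:
  "(x, f, z) \<in> Obj CM \<longleftrightarrow> x \<in> Obj K \<and> z \<in> Obj J \<and> f \<in> Hom L \<and> src L f = fob P x \<and> tgt L f = fob F z"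
  by (simp add: comma_def)

lemma comma_Hom [simp]:
  "((x, f, z), s, \<alpha>, t, (x', f', z')) \<in> Hom CM \<longleftrightarrow> (x, f, z) \<in> Obj CM \<and> (x', f', z') \<in> Obj CM \<and>
     s \<in> Hom K \<and> src K s = x \<and> tgt K s = x' \<and> t \<in> Hom J \<and> src J t = z \<and> tgt J t = z' \<and>
     \<alpha> \<in> Cell L \<and> dom2 L \<alpha> = cmp L (fhom F t) f \<and> cod2 L \<alpha> = cmp L f' (fhom P s)"
  by (auto simp: comma_def)

lemma comma_Cell [simp]:
  "(((x, f, z), s, \<alpha>, t, (x', f', z')), \<phi>, \<gamma>, (Y, s', \<alpha>', t', Y')) \<in> Cell CM \<longleftrightarrow>
     Y = (x, f, z) \<and> Y' = (x', f', z') \<and>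
     ((x, f, z), s, \<alpha>, t, (x', f', z')) \<in> Hom CM \<and> ((x, f, z), s', \<alpha>', t', (x', f', z')) \<in> Hom CM \<and>
     \<phi> \<in> Cell K \<and> dom2 K \<phi> = s \<and> cod2 K \<phi> = s' \<and> \<gamma> \<in> Cell J \<and> dom2 J \<gamma> = t \<and> cod2 J \<gamma> = t' \<and>
     vcmp L (hcmp L (id2 L f') (fcell P \<phi>)) \<alpha> = vcmp L \<alpha>' (hcmp L (fcell F \<gamma>) (id2 L f))"
  by (auto simp: comma_def)

lemma comma_ops [simp]:
  "src CM (X, s, \<alpha>, t, X') = X" "tgt CM (X, s, \<alpha>, t, X') = X'"
  "idm CM (x, f, z) = ((x, f, z), idm K x, id2 L f, idm J z, (x, f, z))"
  "cmp CM m' m = comma_cmp L P F K J m' m"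
  "dom2 CM (m, \<phi>, \<gamma>, m') = m" "cod2 CM (m, \<phi>, \<gamma>, m') = m'"
  "id2 CM (X, s, \<alpha>, t, X') = ((X, s, \<alpha>, t, X'), id2 K s, id2 J t, (X, s, \<alpha>, t, X'))"
  "vcmp CM (n, \<phi>', \<gamma>', n') (m, \<phi>, \<gamma>, m') = (m, vcmp K \<phi>' \<phi>, vcmp J \<gamma>' \<gamma>, n')"
  "hcmp CM (n, \<phi>', \<gamma>', n') (m, \<phi>, \<gamma>, m') =
     (comma_cmp L P F K J n m, hcmp K \<phi>' \<phi>, hcmp J \<gamma>' \<gamma>, comma_cmp L P F K J n' m')"
  by (simp_all add: comma_def)

lemma comma_cmp_simp [simp]:
  "comma_cmp L P F K J (Y, s', \<alpha>', t', Z) (X, s, \<alpha>, t, Y') =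
     (X, cmp K s' s, vcmp L (hcmp L \<alpha>' (id2 L (fhom P s))) (hcmp L (id2 L (fhom F t')) \<alpha>), cmp J t' t, Z)"
  by (simp add: comma_cmp_def)

lemma comma_dom2_cod2 [simp]:
  assumes "A \<in> Cell CM"
  shows "dom2 CM A \<in> Hom CM" "cod2 CM A \<in> Hom CM" "src CM (cod2 CM A) = src CM (dom2 CM A)"
    "tgt CM (cod2 CM A) = tgt CM (dom2 CM A)"
  using assms by (cases A; auto)+

lemma comma_comp:
  assumes "m \<in> Hom CM" "n \<in> Hom CM" "tgt CM m = src CM n"
  shows "cmp CM n m \<in> Hom CM" "src CM (cmp CM n m) = src CM m" "tgt CM (cmp CM n m) = tgt CM n"
  using assms by (cases m; cases n; auto)+

text \<open>After whiskering is distributed, both fillers are the same stack of three whiskered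
  2-cells.\<close>

lemma comma_comp_assoc:
  assumes "m \<in> Hom CM" "n \<in> Hom CM" "l \<in> Hom CM" "tgt CM m = src CM n" "tgt CM n = src CM l"
  shows "cmp CM l (cmp CM n m) = cmp CM (cmp CM l n) m"
  using assms by (cases m; cases n; cases l) (auto simp: P.cod.wl_vcomp P.cod.wr_vcomp)

lemma comma_CellE:
  assumes "A \<in> Cell CM"
  obtains x f z s \<alpha> t x' f' z' \<phi> \<gamma> s' \<alpha>' t'
  where "A = (((x, f, z), s, \<alpha>, t, (x', f', z')), \<phi>, \<gamma>, ((x, f, z), s', \<alpha>', t', (x', f', z')))"
  using assms by (cases A) auto

lemma comma_CellD:
  assumes "(m, \<phi>, \<gamma>, m') \<in> Cell CM"
  shows "\<phi> \<in> Cell K" "src K (dom2 K \<phi>) = fst (src CM m)" "tgt K (dom2 K \<phi>) = fst (tgt CM m)"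
    "dom2 K \<phi> = fst (snd m)" "cod2 K \<phi> = fst (snd m')" "dom2 J \<gamma> = fst (snd (snd (snd m)))"
    "cod2 J \<gamma> = fst (snd (snd (snd m')))" "\<gamma> \<in> Cell J" "src J (dom2 J \<gamma>) = snd (snd (src CM m))" "tgt J (dom2 J \<gamma>) = snd (snd (tgt CM m))"
  using assms by (cases m; cases m'; auto)+

lemma comma_vcomp:
  assumes "A \<in> Cell CM" "B \<in> Cell CM" "cod2 CM A = dom2 CM B"
  shows "vcmp CM B A \<in> Cell CM"
proof -
  obtain x f z s \<alpha> t x' f' z' \<phi> \<gamma> s' \<alpha>' t'
    where A: "A = (((x, f, z), s, \<alpha>, t, (x', f', z')), \<phi>, \<gamma>, ((x, f, z), s', \<alpha>', t', (x', f', z')))"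
    using comma_CellE[OF assms(1)] .
  obtain \<psi> \<delta> s'' \<alpha>'' t''
    where B: "B = (((x, f, z), s', \<alpha>', t', (x', f', z')), \<psi>, \<delta>, ((x, f, z), s'', \<alpha>'', t'', (x', f', z')))"
    by (rule comma_CellE[OF assms(2)]) (use assms(3) A in auto)
  note a = assms(1)[unfolded A, simplified] and b = assms(2)[unfolded B, simplified]
  have "vcmp L (hcmp L (id2 L f') (vcmp L (fcell P \<psi>) (fcell P \<phi>))) \<alpha> =
      vcmp L \<alpha>'' (hcmp L (vcmp L (fcell F \<delta>) (fcell F \<gamma>)) (id2 L f))"
    by (rule P.cod.lax_square_vcomp[where \<alpha>' = \<alpha>']) (use a b in auto)
  then show ?thesis using a b by (auto simp: A B)
qed

text \<open>Only the compatibility law needs an argument; it is \<open>lax_square_paste\<close> for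
  two squares placed side by side.\<close>

lemma comma_hcomp:
  assumes "A \<in> Cell CM" "B \<in> Cell CM" "tgt CM (dom2 CM A) = src CM (dom2 CM B)"
  shows "hcmp CM B A \<in> Cell CM"
proof -
  obtain x f z s \<alpha> t x' f' z' \<phi> \<gamma> s' \<alpha>' t'
    where A: "A = (((x, f, z), s, \<alpha>, t, (x', f', z')), \<phi>, \<gamma>, ((x, f, z), s', \<alpha>', t', (x', f', z')))"
    using comma_CellE[OF assms(1)] .
  obtain u \<beta> v x'' f'' z'' \<psi> \<delta> u' \<beta>' v'
    where B: "B = (((x', f', z'), u, \<beta>, v, (x'', f'', z'')), \<psi>, \<delta>, ((x', f', z'), u', \<beta>', v', (x'', f'', z'')))"
    by (rule comma_CellE[OF assms(2)]) (use assms(3) A in auto)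
  note a = assms(1)[unfolded A, simplified] and b = assms(2)[unfolded B, simplified]
  have "vcmp L (hcmp L (id2 L f'') (hcmp L (fcell P \<psi>) (fcell P \<phi>)))
        (vcmp L (hcmp L \<beta> (id2 L (fhom P s))) (hcmp L (id2 L (fhom F v)) \<alpha>)) =
      vcmp L (hcmp L \<beta>' (id2 L (fhom P s'))) (vcmp L (hcmp L (id2 L (fhom F v')) \<alpha>')
        (hcmp L (hcmp L (fcell F \<delta>) (fcell F \<gamma>)) (id2 L f)))"
    by (rule P.cod.lax_square_paste[where f' = f']) (use a b in auto)
  then show ?thesis using a b by (auto simp: A B)
qed

lemma strict_2cat_comma: "strict_2cat CM"
  unfolding strict_2cat_def
proof (intro conjI ballI impI; (elim conjE)?)
  fix f g assume "f \<in> Hom CM" "g \<in> Hom CM" "tgt CM f = src CM g"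
  then show "cmp CM g f \<in> Hom CM" "src CM (cmp CM g f) = src CM f" "tgt CM (cmp CM g f) = tgt CM g"
    by (rule comma_comp)+
next
  fix f g h assume "f \<in> Hom CM" "g \<in> Hom CM" "h \<in> Hom CM" "tgt CM f = src CM g" "tgt CM g = src CM h"
  then show "cmp CM h (cmp CM g f) = cmp CM (cmp CM h g) f" by (rule comma_comp_assoc)
next
  fix a b assume "a \<in> Cell CM" "b \<in> Cell CM" "cod2 CM a = dom2 CM b"
  then show "vcmp CM b a \<in> Cell CM" by (rule comma_vcomp)
next
  fix a b assume "a \<in> Cell CM" "b \<in> Cell CM" "tgt CM (dom2 CM a) = src CM (dom2 CM b)"
  then show "hcmp CM b a \<in> Cell CM" by (rule comma_hcomp)
next
  fix a b c assume a: "a \<in> Cell CM" "b \<in> Cell CM" "c \<in> Cell CM"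
    "tgt CM (dom2 CM a) = src CM (dom2 CM b)" "tgt CM (dom2 CM b) = src CM (dom2 CM c)"
  \<comment> \<open>A 2-cell of the comma object carries its boundary 1-cells, so associativity has
    to be verified for these as well as for the components.\<close>
  have d: "cmp CM (dom2 CM c) (cmp CM (dom2 CM b) (dom2 CM a)) = cmp CM (cmp CM (dom2 CM c) (dom2 CM b)) (dom2 CM a)"
    by (rule comma_comp_assoc) (use a in simp_all)
  have e: "cmp CM (cod2 CM c) (cmp CM (cod2 CM b) (cod2 CM a)) = cmp CM (cmp CM (cod2 CM c) (cod2 CM b)) (cod2 CM a)"
    by (rule comma_comp_assoc) (use a in simp_all)
  have k: "hcmp K \<theta> (hcmp K \<psi> \<phi>) = hcmp K (hcmp K \<theta> \<psi>) \<phi> \<and> hcmp J \<epsilon> (hcmp J \<delta> \<gamma>) = hcmp J (hcmp J \<epsilon> \<delta>) \<gamma>"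
    if "a = (m, \<phi>, \<gamma>, m')" "b = (n, \<psi>, \<delta>, n')" "c = (l, \<theta>, \<epsilon>, l')" for m \<phi> \<gamma> m' n \<psi> \<delta> n' l \<theta> \<epsilon> l'
    using a[unfolded that] comma_CellD[of m \<phi> \<gamma> m'] comma_CellD[of n \<psi> \<delta> n'] comma_CellD[of l \<theta> \<epsilon> l']
    by (simp add: P.dom.hcomp_assoc F.dom.hcomp_assoc)
  show "hcmp CM c (hcmp CM b a) = hcmp CM (hcmp CM c b) a"
    by (cases a; cases b; cases c) (use d e k in \<open>simp del: comma_cmp_simp\<close>)
next
  fix a a' b b' assume h: "a \<in> Cell CM" "a' \<in> Cell CM" "b \<in> Cell CM" "b' \<in> Cell CM"
    "cod2 CM a = dom2 CM a'" "cod2 CM b = dom2 CM b'" "tgt CM (dom2 CM a) = src CM (dom2 CM b)"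
  have "hcmp K (vcmp K \<psi>' \<psi>) (vcmp K \<phi>' \<phi>) = vcmp K (hcmp K \<psi>' \<phi>') (hcmp K \<psi> \<phi>)"
      "hcmp J (vcmp J \<delta>' \<delta>) (vcmp J \<gamma>' \<gamma>) = vcmp J (hcmp J \<delta>' \<gamma>') (hcmp J \<delta> \<gamma>)"
    if e: "a = (m, \<phi>, \<gamma>, m')" "a' = (m', \<phi>', \<gamma>', m'')" "b = (n, \<psi>, \<delta>, n')" "b' = (n', \<psi>', \<delta>', n'')"
    for m \<phi> \<gamma> m' \<phi>' \<gamma>' m'' n \<psi> \<delta> n' \<psi>' \<delta>' n''
  proof -
    note d = comma_CellD[OF h(1)[unfolded e]] comma_CellD[OF h(2)[unfolded e]]
      comma_CellD[OF h(3)[unfolded e]] comma_CellD[OF h(4)[unfolded e]]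
    have t: "tgt CM m = src CM n" using h(7) by (simp add: e)
    have "tgt K (dom2 K \<phi>) = src K (dom2 K \<psi>)" "tgt J (dom2 J \<gamma>) = src J (dom2 J \<delta>)"
      by (simp_all only: comma_CellD(3,10)[OF h(1)[unfolded e(1)]] comma_CellD(2,9)[OF h(3)[unfolded e(3)]] t)
    then show "hcmp K (vcmp K \<psi>' \<psi>) (vcmp K \<phi>' \<phi>) = vcmp K (hcmp K \<psi>' \<phi>') (hcmp K \<psi> \<phi>)"
      "hcmp J (vcmp J \<delta>' \<delta>) (vcmp J \<gamma>' \<gamma>) = vcmp J (hcmp J \<delta>' \<gamma>') (hcmp J \<delta> \<gamma>)"
      by (intro P.dom.interchange F.dom.interchange; simp add: d)+
  qed
  then show "hcmp CM (vcmp CM b' b) (vcmp CM a' a) = vcmp CM (hcmp CM b' a') (hcmp CM b a)"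
    using h(5,6) by (cases a; cases a'; cases b; cases b') (simp del: comma_cmp_simp)
qed (auto elim: comma_CellE)

end

section \<open>Opcartesian lifts\<close>

context two_functor
begin

text \<open>Factoring the identity through the cartesian cell, over the inverse \<open>b\<close>,
  gives a right inverse. It is also a left inverse by uniqueness of the factorization of
  \<open>\<gamma>\<close> through itself over an identity.\<close>

lemma cartesian2_iso2:
  assumes c: "cartesian2 C D G \<gamma>" and i: "iso2 D (fcell G \<gamma>)"
  shows "iso2 C \<gamma>"
proof -
  have \<gamma>: "\<gamma> \<in> Cell C" using c by (simp add: cartesian2_def)
  obtain b where b: "b \<in> Cell D" "dom2 D b = fhom G (cod2 C \<gamma>)" "cod2 D b = fhom G (dom2 C \<gamma>)"
    "vcmp D b (fcell G \<gamma>) = id2 D (fhom G (dom2 C \<gamma>))" "vcmp D (fcell G \<gamma>) b = id2 D (fhom G (cod2 C \<gamma>))"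
    using cod.iso2_inverse[OF i] \<gamma> by (metis dom2_fcell cod2_fcell)
  note U = c[unfolded cartesian2_def, THEN conjunct2, rule_format]
  have "\<exists>!\<phi>. \<phi> \<in> Cell C \<and> dom2 C \<phi> = cod2 C \<gamma> \<and> cod2 C \<phi> = dom2 C \<gamma> \<and> fcell G \<phi> = b \<and> vcmp C \<gamma> \<phi> = id2 C (cod2 C \<gamma>)"
    by (rule U) (use b \<gamma> in simp)
  then obtain \<phi> where \<phi>: "\<phi> \<in> Cell C" "dom2 C \<phi> = cod2 C \<gamma>" "cod2 C \<phi> = dom2 C \<gamma>" "fcell G \<phi> = b"
    "vcmp C \<gamma> \<phi> = id2 C (cod2 C \<gamma>)" by blast
  have ex: "\<exists>!\<psi>. \<psi> \<in> Cell C \<and> dom2 C \<psi> = dom2 C \<gamma> \<and> cod2 C \<psi> = dom2 C \<gamma> \<and> fcell G \<psi> = id2 D (fhom G (dom2 C \<gamma>))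
      \<and> vcmp C \<gamma> \<psi> = \<gamma>"
    by (rule U) (use \<gamma> in simp)
  have "vcmp C \<phi> \<gamma> = id2 C (dom2 C \<gamma>)"
  proof (rule ex1_eqD[OF ex])
    have "vcmp C \<gamma> (vcmp C \<phi> \<gamma>) = vcmp C (vcmp C \<gamma> \<phi>) \<gamma>" using \<gamma> \<phi>(1-3) by simp
    also have "\<dots> = \<gamma>" unfolding \<phi>(5) using \<gamma> by simp
    finally show "vcmp C \<phi> \<gamma> \<in> Cell C \<and> dom2 C (vcmp C \<phi> \<gamma>) = dom2 C \<gamma> \<and> cod2 C (vcmp C \<phi> \<gamma>) = dom2 C \<gamma> \<and>
        fcell G (vcmp C \<phi> \<gamma>) = id2 D (fhom G (dom2 C \<gamma>)) \<and> vcmp C \<gamma> (vcmp C \<phi> \<gamma>) = \<gamma>"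
      using \<gamma> \<phi>(1-4) b(4) by simp
  qed (use \<gamma> in simp)
  then show ?thesis unfolding iso2_def using \<gamma> \<phi> by blast
qed

text \<open>The two consequences of opcartesianness used below: lifts can be chosen strictly over
  the given 1-cell, and 2-cells out of the target are determined by whiskering.\<close>

definition strictly_opcartesian :: "'a \<Rightarrow> bool" where
  "strictly_opcartesian h \<longleftrightarrow> h \<in> Hom C \<and>
    (\<forall>u t \<alpha>. u \<in> Hom C \<and> src C u = src C h \<and> t \<in> Hom D \<and> src D t = fob G (tgt C h) \<and> tgt D t = fob G (tgt C u) \<and>
       iso2 D \<alpha> \<and> dom2 D \<alpha> = cmp D t (fhom G h) \<and> cod2 D \<alpha> = fhom G u \<longrightarrow>
       (\<exists>n \<theta>. n \<in> Hom C \<and> src C n = tgt C h \<and> tgt C n = tgt C u \<and> fhom G n = t \<and>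
          iso2 C \<theta> \<and> dom2 C \<theta> = cmp C n h \<and> cod2 C \<theta> = u \<and> fcell G \<theta> = \<alpha>)) \<and>
    (\<forall>n n' \<rho> \<beta>. n \<in> Hom C \<and> n' \<in> Hom C \<and> src C n = tgt C h \<and> src C n' = tgt C h \<and> tgt C n = tgt C n' \<and>
       \<rho> \<in> Cell C \<and> dom2 C \<rho> = cmp C n h \<and> cod2 C \<rho> = cmp C n' h \<and>
       \<beta> \<in> Cell D \<and> dom2 D \<beta> = fhom G n \<and> cod2 D \<beta> = fhom G n' \<and>
       fcell G \<rho> = hcmp D \<beta> (id2 D (fhom G h)) \<longrightarrow>
       (\<exists>!\<nu>. \<nu> \<in> Cell C \<and> dom2 C \<nu> = n \<and> cod2 C \<nu> = n' \<and> fcell G \<nu> = \<beta> \<and> hcmp C \<nu> (id2 C h) = \<rho>))"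

text \<open>A cartesian lift of an invertible 2-cell is invertible, so \<open>u\<close> may be
  replaced by an isomorphic 1-cell lying exactly over the domain of \<open>\<alpha>\<close>.\<close>

lemma strict_lift_over:
  assumes lf: "local_fibration C D G" and "u \<in> Hom C" "iso2 D \<alpha>" "cod2 D \<alpha> = fhom G u"
  obtains n \<theta> where "n \<in> Hom C" "src C n = src C u" "tgt C n = tgt C u" "fhom G n = dom2 D \<alpha>"
    "iso2 C \<theta>" "dom2 C \<theta> = n" "cod2 C \<theta> = u" "fcell G \<theta> = \<alpha>"
proof -
  obtain \<theta> where \<theta>: "\<theta> \<in> Cell C" "cod2 C \<theta> = u" "fcell G \<theta> = \<alpha>" "cartesian2 C D G \<theta>"
    using lf[unfolded local_fibration_def, rule_format, OF cod.iso2_Cell[OF assms(3)] assms(2,4)] by blast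
  have "iso2 C \<theta>" by (rule cartesian2_iso2[OF \<theta>(4)]) (simp add: \<theta> assms)
  moreover have "src C (dom2 C \<theta>) = src C u" "tgt C (dom2 C \<theta>) = tgt C u"
    using dom.src_cod2[OF \<theta>(1)] dom.tgt_cod2[OF \<theta>(1)] \<theta>(2) by simp_all
  moreover have "fhom G (dom2 C \<theta>) = dom2 D \<alpha>" using dom2_fcell[OF \<theta>(1)] \<theta>(3) by simp
  ultimately show ?thesis using \<theta> by (intro that[of "dom2 C \<theta>" \<theta>]) simp_all
qed

text \<open>The lift chosen over an identity has to be the identity, while an opfibration only
  provides some opcartesian lift; so the identity must be shown to qualify. Existence of its lifts
  is the cartesian correction alone.\<close>

lemma strictly_opcartesian_idm:
  assumes lf: "local_fibration C D G" and k: "k \<in> Obj C"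
  shows "strictly_opcartesian (idm C k)"
  unfolding strictly_opcartesian_def
proof (intro conjI allI impI; (elim conjE)?)
  show "idm C k \<in> Hom C" using k by simp
next
  fix u t \<alpha>
  assume a: "u \<in> Hom C" "src C u = src C (idm C k)" "t \<in> Hom D" "src D t = fob G (tgt C (idm C k))"
    "tgt D t = fob G (tgt C u)" "iso2 D \<alpha>" "dom2 D \<alpha> = cmp D t (fhom G (idm C k))" "cod2 D \<alpha> = fhom G u"
  obtain n \<theta> where n: "n \<in> Hom C" "src C n = src C u" "tgt C n = tgt C u" "fhom G n = dom2 D \<alpha>"
    "iso2 C \<theta>" "dom2 C \<theta> = n" "cod2 C \<theta> = u" "fcell G \<theta> = \<alpha>"
    using strict_lift_over[OF lf a(1,6,8)] .
  show "\<exists>n \<theta>. n \<in> Hom C \<and> src C n = tgt C (idm C k) \<and> tgt C n = tgt C u \<and> fhom G n = t \<and>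
      iso2 C \<theta> \<and> dom2 C \<theta> = cmp C n (idm C k) \<and> cod2 C \<theta> = u \<and> fcell G \<theta> = \<alpha>"
    using n a k by (intro exI[of _ n] exI[of _ \<theta>]) simp
next
  fix n n' \<rho> \<beta>
  assume a: "n \<in> Hom C" "n' \<in> Hom C" "src C n = tgt C (idm C k)" "src C n' = tgt C (idm C k)" "tgt C n = tgt C n'"
    "\<rho> \<in> Cell C" "dom2 C \<rho> = cmp C n (idm C k)" "cod2 C \<rho> = cmp C n' (idm C k)"
    "\<beta> \<in> Cell D" "dom2 D \<beta> = fhom G n" "cod2 D \<beta> = fhom G n'"
    "fcell G \<rho> = hcmp D \<beta> (id2 D (fhom G (idm C k)))"
  then have "fcell G \<rho> = \<beta>" "dom2 C \<rho> = n" "cod2 C \<rho> = n'" using k by simp_all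
  then show "\<exists>!\<nu>. \<nu> \<in> Cell C \<and> dom2 C \<nu> = n \<and> cod2 C \<nu> = n' \<and> fcell G \<nu> = \<beta> \<and> hcmp C \<nu> (id2 C (idm C k)) = \<rho>"
    using a k by (intro ex1I[of _ \<rho>]) auto
qed

lemma opcartesian1_strictly:
  assumes lf: "local_fibration C D G" and oc: "opcartesian1 C D G h"
  shows "strictly_opcartesian h"
  unfolding strictly_opcartesian_def
proof (intro conjI allI impI; (elim conjE)?)
  show h: "h \<in> Hom C" using oc by (simp add: opcartesian1_def)
  fix u t \<alpha>
  assume a: "u \<in> Hom C" "src C u = src C h" "t \<in> Hom D" "src D t = fob G (tgt C h)"
    "tgt D t = fob G (tgt C u)" "iso2 D \<alpha>" "dom2 D \<alpha> = cmp D t (fhom G h)" "cod2 D \<alpha> = fhom G u"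
  have "\<exists>tt a1 a2. opc_lift C D G h u t \<alpha> tt a1 a2"
    by (rule oc[unfolded opcartesian1_def, THEN conjunct2, THEN conjunct1, THEN spec, THEN spec, THEN spec, THEN mp])
      (use a in simp)
  then obtain tt a1 a2 where l: "tt \<in> Hom C" "src C tt = tgt C h" "tgt C tt = tgt C u" "iso2 D a1" "dom2 D a1 = t"
    "cod2 D a1 = fhom G tt" "iso2 C a2" "dom2 C a2 = cmp C tt h" "cod2 C a2 = u"
    "\<alpha> = vcmp D (fcell G a2) (hcmp D a1 (id2 D (fhom G h)))"
    unfolding opc_lift_def by (elim exE conjE) (rule that)
  \<comment> \<open>\<open>tt\<close> lies over \<open>t\<close> only up to \<open>a1\<close>; a
    cartesian lift of \<open>a1\<close> ending at \<open>tt\<close> starts at a 1-cell lying over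
    \<open>t\<close> exactly.\<close>
  obtain n \<theta> where n: "n \<in> Hom C" "src C n = src C tt" "tgt C n = tgt C tt" "fhom G n = dom2 D a1"
    "iso2 C \<theta>" "dom2 C \<theta> = n" "cod2 C \<theta> = tt" "fcell G \<theta> = a1"
    using strict_lift_over[OF lf l(1,4,6)] .
  note c = dom.iso2_Cell[OF n(5)] dom.iso2_Cell[OF l(7)]
  have w: "iso2 C (hcmp C \<theta> (id2 C h))" by (rule dom.iso2_wr[OF n(5) h]) (simp add: n l)
  have "iso2 C (vcmp C a2 (hcmp C \<theta> (id2 C h)))"
    by (rule dom.iso2_vcomp[OF w l(7)]) (simp add: n l c h)
  moreover have "fcell G (vcmp C a2 (hcmp C \<theta> (id2 C h))) = \<alpha>"
    by (simp add: n l c h)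
  ultimately show "\<exists>n \<theta>. n \<in> Hom C \<and> src C n = tgt C h \<and> tgt C n = tgt C u \<and> fhom G n = t \<and>
      iso2 C \<theta> \<and> dom2 C \<theta> = cmp C n h \<and> cod2 C \<theta> = u \<and> fcell G \<theta> = \<alpha>"
    by (intro exI[of _ n] exI[of _ "vcmp C a2 (hcmp C \<theta> (id2 C h))"]) (simp add: n l c h)
next
  have h: "h \<in> Hom C" using oc by (simp add: opcartesian1_def)
  fix n n' \<rho> \<beta>
  assume a: "n \<in> Hom C" "n' \<in> Hom C" "src C n = tgt C h" "src C n' = tgt C h" "tgt C n = tgt C n'"
    "\<rho> \<in> Cell C" "dom2 C \<rho> = cmp C n h" "cod2 C \<rho> = cmp C n' h"
    "\<beta> \<in> Cell D" "dom2 D \<beta> = fhom G n" "cod2 D \<beta> = fhom G n'"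
    "fcell G \<rho> = hcmp D \<beta> (id2 D (fhom G h))"
  \<comment> \<open>Every \<open>m\<close> is a lift of its own composite with \<open>h\<close>,
    with identity comparisons. The clause of opcartesianness on 2-cells, for two such lifts, gives
    the statement about whiskering.\<close>
  have lift: "opc_lift C D G h (cmp C m h) (fhom G m) (id2 D (fhom G (cmp C m h))) m (id2 D (fhom G m)) (id2 C (cmp C m h))"
    if "m \<in> Hom C" "src C m = tgt C h" for m
    using that h unfolding opc_lift_def by (simp add: dom.iso2_id2 cod.iso2_id2)
  have "\<exists>!bt. bt \<in> Cell C \<and> dom2 C bt = n \<and> cod2 C bt = n' \<and>
      vcmp D (fcell G bt) (id2 D (fhom G n)) = vcmp D (id2 D (fhom G n')) \<beta> \<and>
      vcmp C \<rho> (id2 C (cmp C n h)) = vcmp C (id2 C (cmp C n' h)) (hcmp C bt (id2 C h))"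
    by (rule oc[unfolded opcartesian1_def, THEN conjunct2, THEN conjunct2,
          THEN spec[of _ "cmp C n h"],
          THEN spec[of _ "cmp C n' h"],
          THEN spec[of _ "fhom G n"],
          THEN spec[of _ "fhom G n'"],
          THEN spec[of _ "\<beta>"],
          THEN spec[of _ "\<rho>"],
          THEN spec[of _ "id2 D (fhom G (cmp C n h))"],
          THEN spec[of _ "id2 D (fhom G (cmp C n' h))"],
          THEN spec[of _ "n"],
          THEN spec[of _ "id2 D (fhom G n)"],
          THEN spec[of _ "id2 C (cmp C n h)"],
          THEN spec[of _ "n'"],
          THEN spec[of _ "id2 D (fhom G n')"],
          THEN spec[of _ "id2 C (cmp C n' h)"],
          THEN mp])
      (use a h lift[OF a(1,3)] lift[OF a(2,4)] in \<open>simp add: cod.iso2_id2\<close>)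
  \<comment> \<open>Identity comparisons disappear, leaving the two conditions on the image and on
    the whiskering of the 2-cell.\<close>
  moreover have "(\<lambda>bt. bt \<in> Cell C \<and> dom2 C bt = n \<and> cod2 C bt = n' \<and>
      vcmp D (fcell G bt) (id2 D (fhom G n)) = vcmp D (id2 D (fhom G n')) \<beta> \<and>
      vcmp C \<rho> (id2 C (cmp C n h)) = vcmp C (id2 C (cmp C n' h)) (hcmp C bt (id2 C h))) =
    (\<lambda>\<nu>. \<nu> \<in> Cell C \<and> dom2 C \<nu> = n \<and> cod2 C \<nu> = n' \<and> fcell G \<nu> = \<beta> \<and> hcmp C \<nu> (id2 C h) = \<rho>)"
    using a h by (intro ext conj_cong refl) auto
  ultimately show "\<exists>!\<nu>. \<nu> \<in> Cell C \<and> dom2 C \<nu> = n \<and> cod2 C \<nu> = n' \<and> fcell G \<nu> = \<beta> \<and> hcmp C \<nu> (id2 C h) = \<rho>"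
    by simp
qed

end

context cospan
begin

section \<open>The inclusion as a 2-functor\<close>

lemma incl_simps [simp]:
  "fob (incl K L J P) (k, j) = (k, idm L (fob P k), j)"
  "fhom (incl K L J P) (s, t) = ((src K s, idm L (fob P (src K s)), src J t), s, id2 L (fhom P s), t,
     (tgt K s, idm L (fob P (tgt K s)), tgt J t))"
  "fcell (incl K L J P) (\<phi>, \<gamma>) = (fhom (incl K L J P) (dom2 K \<phi>, dom2 J \<gamma>), \<phi>, \<gamma>,
     fhom (incl K L J P) (cod2 K \<phi>, cod2 J \<gamma>))"
  by (simp_all add: incl_def incl_ob_def incl_hom_def)

lemma incl_Hom: "(s, t) \<in> Hom PB \<Longrightarrow> fhom (incl K L J P) (s, t) \<in> Hom CM"
  using pb_parallel(3,4)[of s t] by (simp flip: P.tgt_fhom)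

lemma incl_comp:
  assumes "(s, t) \<in> Hom PB" "(s', t') \<in> Hom PB" "tgt K s = src K s'" "tgt J t = src J t'"
  shows "fhom (incl K L J P) (cmp K s' s, cmp J t' t) =
    cmp CM (fhom (incl K L J P) (s', t')) (fhom (incl K L J P) (s, t))"
proof -
  have F: "fhom F t = fhom P s" "fhom F t' = fhom P s'" and h: "s \<in> Hom K" "t \<in> Hom J" "s' \<in> Hom K" "t' \<in> Hom J"
    using assms by simp_all
  show ?thesis by (simp add: F h assms(3,4))
qed

lemma strict_2functor_incl: "strict_2functor PB CM (incl K L J P)"
  unfolding strict_2functor_def
proof (intro conjI ballI impI)
  fix a assume "a \<in> Cell PB"
  then obtain \<phi> \<gamma> where a: "a = (\<phi>, \<gamma>)" "\<phi> \<in> Cell K" "\<gamma> \<in> Cell J" "fcell P \<phi> = fcell F \<gamma>" by (cases a) auto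
  have p: "(dom2 K \<phi>, dom2 J \<gamma>) \<in> Hom PB" "(cod2 K \<phi>, cod2 J \<gamma>) \<in> Hom PB"
    using a pb_parallel(1,2)[of \<phi> \<gamma>] by simp_all
  have eq: "vcmp L (hcmp L (id2 L (idm L (fob P (tgt K (dom2 K \<phi>))))) (fcell P \<phi>)) (id2 L (fhom P (dom2 K \<phi>))) =
      vcmp L (id2 L (fhom P (cod2 K \<phi>))) (hcmp L (fcell P \<phi>) (id2 L (idm L (fob P (src K (dom2 K \<phi>))))))"
    using a(2) by simp
  show "fcell (incl K L J P) a \<in> Cell CM"
    using incl_Hom[OF p(1)] incl_Hom[OF p(2)] eq a by simp
  show "dom2 CM (fcell (incl K L J P) a) = fhom (incl K L J P) (dom2 PB a)"
    "cod2 CM (fcell (incl K L J P) a) = fhom (incl K L J P) (cod2 PB a)" by (simp_all add: a)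
next
  fix f assume "f \<in> Hom PB"
  then obtain s t where f: "f = (s, t)" "(s, t) \<in> Hom PB" by (cases f) auto
  show "fhom (incl K L J P) f \<in> Hom CM" unfolding f(1) by (rule incl_Hom[OF f(2)])
  show "src CM (fhom (incl K L J P) f) = fob (incl K L J P) (src PB f)"
    "tgt CM (fhom (incl K L J P) f) = fob (incl K L J P) (tgt PB f)" by (simp_all add: f)
  show "fcell (incl K L J P) (id2 PB f) = id2 CM (fhom (incl K L J P) f)" using f by simp
next
  fix f g assume a: "f \<in> Hom PB" "g \<in> Hom PB" "tgt PB f = src PB g"
  obtain s t where f: "f = (s, t)" by (cases f)
  obtain s' t' where g: "g = (s', t')" by (cases g)
  show "fhom (incl K L J P) (cmp PB g f) = cmp CM (fhom (incl K L J P) g) (fhom (incl K L J P) f)"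
    using incl_comp[of s t s' t'] a unfolding f g by (simp only: pb_ops prod.inject)
next
  fix a b assume h: "a \<in> Cell PB" "b \<in> Cell PB" "tgt PB (dom2 PB a) = src PB (dom2 PB b)"
  obtain \<phi> \<gamma> where a: "a = (\<phi>, \<gamma>)" by (cases a)
  obtain \<psi> \<delta> where b: "b = (\<psi>, \<delta>)" by (cases b)
  have p: "(dom2 K \<phi>, dom2 J \<gamma>) \<in> Hom PB" "(cod2 K \<phi>, cod2 J \<gamma>) \<in> Hom PB"
    "(dom2 K \<psi>, dom2 J \<delta>) \<in> Hom PB" "(cod2 K \<psi>, cod2 J \<delta>) \<in> Hom PB"
    using h pb_parallel(1,2)[of \<phi> \<gamma>] pb_parallel(1,2)[of \<psi> \<delta>] unfolding a b by simp_all
  show "fcell (incl K L J P) (hcmp PB b a) = hcmp CM (fcell (incl K L J P) b) (fcell (incl K L J P) a)"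
    using incl_comp[OF p(1,3)] incl_comp[OF p(2,4)] h unfolding a b
    by (simp del: comma_cmp_simp incl_simps(2))
qed auto

text \<open>The inverses of the two components satisfy the compatibility law for the reversed
  2-cell: composing the given law with both of them moves each to the opposite side.\<close>

lemma comma_iso2:
  assumes A: "(((x, f, z), s, \<alpha>, t, (x', f', z')), \<phi>, \<gamma>, ((x, f, z), s', \<alpha>', t', (x', f', z'))) \<in> Cell CM"
    and i: "iso2 K \<phi>" "iso2 J \<gamma>"
  shows "iso2 CM (((x, f, z), s, \<alpha>, t, (x', f', z')), \<phi>, \<gamma>, ((x, f, z), s', \<alpha>', t', (x', f', z')))"
proof -
  note a = A[simplified]
  obtain \<psi> where \<psi>: "\<psi> \<in> Cell K" "dom2 K \<psi> = cod2 K \<phi>" "cod2 K \<psi> = dom2 K \<phi>"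
    "vcmp K \<psi> \<phi> = id2 K (dom2 K \<phi>)" "vcmp K \<phi> \<psi> = id2 K (cod2 K \<phi>)" using P.dom.iso2_inverse[OF i(1)] .
  obtain \<delta> where \<delta>: "\<delta> \<in> Cell J" "dom2 J \<delta> = cod2 J \<gamma>" "cod2 J \<delta> = dom2 J \<gamma>"
    "vcmp J \<delta> \<gamma> = id2 J (dom2 J \<gamma>)" "vcmp J \<gamma> \<delta> = id2 J (cod2 J \<gamma>)" using F.dom.iso2_inverse[OF i(2)] .
  let ?w = "\<lambda>b. hcmp L (id2 L f') b" and ?r = "\<lambda>b. hcmp L b (id2 L f)"
  have eq: "vcmp L (?w (fcell P \<phi>)) \<alpha> = vcmp L \<alpha>' (?r (fcell F \<gamma>))" using a by simp
  have P1: "vcmp L (?w (fcell P \<psi>)) (?w (fcell P \<phi>)) = id2 L (cmp L f' (fhom P s))"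
  proof -
    have "vcmp L (?w (fcell P \<psi>)) (?w (fcell P \<phi>)) = ?w (fcell P (vcmp K \<psi> \<phi>))"
      using a \<psi>(1-3) by (simp add: P.cod.wl_vcomp)
    then show ?thesis unfolding \<psi>(4) using a by simp
  qed
  have F1: "vcmp L (?r (fcell F \<gamma>)) (?r (fcell F \<delta>)) = id2 L (cmp L (fhom F t') f)"
  proof -
    have "vcmp L (?r (fcell F \<gamma>)) (?r (fcell F \<delta>)) = ?r (fcell F (vcmp J \<gamma> \<delta>))"
      using a \<delta>(1-3) by (simp add: P.cod.wr_vcomp)
    then show ?thesis unfolding \<delta>(5) using a by simp
  qed
  have "vcmp L (?w (fcell P \<psi>)) \<alpha>' = vcmp L (?w (fcell P \<psi>)) (vcmp L \<alpha>' (vcmp L (?r (fcell F \<gamma>)) (?r (fcell F \<delta>))))"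
    unfolding F1 using a by simp
  also have "\<dots> = vcmp L (?w (fcell P \<psi>)) (vcmp L (vcmp L \<alpha>' (?r (fcell F \<gamma>))) (?r (fcell F \<delta>)))"
    using a \<psi>(1-3) \<delta>(1-3) by simp
  also have "\<dots> = vcmp L (?w (fcell P \<psi>)) (vcmp L (vcmp L (?w (fcell P \<phi>)) \<alpha>) (?r (fcell F \<delta>)))"
    by (simp only: eq)
  also have "\<dots> = vcmp L (vcmp L (?w (fcell P \<psi>)) (?w (fcell P \<phi>))) (vcmp L \<alpha> (?r (fcell F \<delta>)))"
  proof -
    have "f \<in> Hom L" "f' \<in> Hom L" "src L f' = fob P (tgt K s)" "tgt L f = fob F (src J t')" "\<alpha> \<in> Cell L"
      "dom2 L \<alpha> = cmp L (fhom F t) f" "cod2 L \<alpha> = cmp L f' (fhom P s)" "tgt K s' = tgt K s" "\<phi> \<in> Cell K"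
      "dom2 K \<phi> = s" "cod2 K \<phi> = s'" "dom2 J \<gamma> = t" "cod2 J \<gamma> = t'" "s' \<in> Hom K"
      "s \<in> Hom K" "t \<in> Hom J" "t' \<in> Hom J" "src J t' = src J t" "\<gamma> \<in> Cell J"
      using a by simp_all
    then show ?thesis using \<psi>(1-3) \<delta>(1-3) by simp
  qed
  also have "\<dots> = vcmp L \<alpha> (?r (fcell F \<delta>))"
    unfolding P1 using a \<delta>(1-3) by simp
  finally have "(((x, f, z), s', \<alpha>', t', (x', f', z')), \<psi>, \<delta>, ((x, f, z), s, \<alpha>, t, (x', f', z'))) \<in> Cell CM"
    using a \<psi>(1-3) \<delta>(1-3) by simp
  then show ?thesis
    unfolding iso2_def using A a \<psi> \<delta>
    by (intro conjI bexI[of _ "(((x, f, z), s', \<alpha>', t', (x', f', z')), \<psi>, \<delta>, ((x, f, z), s, \<alpha>, t, (x', f', z')))"]) simp_all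
qed

end

section \<open>The pullback as a deformation of the comma object\<close>

locale opfibration_cospan = cospan K L J P F
  for K :: "('ok,'ak,'ck) cat2" and L :: "('ol,'al,'cl) cat2" and J :: "('oj,'aj,'cj) cat2"
    and P :: "('ok,'ak,'ck,'ol,'al,'cl) fun2" and F :: "('oj,'aj,'cj,'ol,'al,'cl) fun2" +
  assumes opf: "opfibration K L P" and invertible: "a \<in> Cell L \<Longrightarrow> iso2 L a"
begin

lemma lf: "local_fibration K L P" using opf by (simp add: opfibration_def)

text \<open>The case distinction is what makes \<open>unit\<close> an identity on objects of the
  pullback, as \<open>E_image\<close> requires.\<close>

definition opc :: "'ok \<times> 'al \<times> 'oj \<Rightarrow> 'ak" where
  "opc = (\<lambda>(x, f, z). if f = idm L (fob P x) then idm K x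
     else SOME h. src K h = x \<and> fhom P h = f \<and> P.strictly_opcartesian h)"

lemma
  assumes "(x, f, z) \<in> Obj CM"
  shows opc_Hom: "opc (x, f, z) \<in> Hom K" and src_opc: "src K (opc (x, f, z)) = x"
    and fhom_opc: "fhom P (opc (x, f, z)) = f" and tgt_opc: "fob P (tgt K (opc (x, f, z))) = fob F z"
    and opc_strictly: "P.strictly_opcartesian (opc (x, f, z))"
proof -
  have a: "x \<in> Obj K" "f \<in> Hom L" "src L f = fob P x" "tgt L f = fob F z" using assms by simp_all
  have "src K (opc (x, f, z)) = x \<and> fhom P (opc (x, f, z)) = f \<and> P.strictly_opcartesian (opc (x, f, z))"
  proof (cases "f = idm L (fob P x)")
    case True
    then show ?thesis using a P.strictly_opcartesian_idm[OF lf a(1)] by (simp add: opc_def)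
  next
    case False
    have "\<exists>hh. hh \<in> Hom K \<and> src K hh = x \<and> fhom P hh = f \<and> opcartesian1 K L P hh"
      using opf a unfolding opfibration_def by simp
    then obtain h where "src K h = x" "fhom P h = f" "opcartesian1 K L P h" by (elim exE conjE) (rule that)
    then have "\<exists>h. src K h = x \<and> fhom P h = f \<and> P.strictly_opcartesian h"
      using P.opcartesian1_strictly[OF lf] by (intro exI[of _ h] conjI)
    from someI_ex[OF this] False show ?thesis by (simp add: opc_def)
  qed
  then show s: "src K (opc (x, f, z)) = x" "fhom P (opc (x, f, z)) = f" "P.strictly_opcartesian (opc (x, f, z))"
    by simp_all
  show h: "opc (x, f, z) \<in> Hom K" using s(3) by (simp add: P.strictly_opcartesian_def)
  show "fob P (tgt K (opc (x, f, z))) = fob F z" using P.tgt_fhom[OF h] s(2) a by simp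
qed

text \<open>The filler can be an identity because \<open>opc\<close> lies strictly over
  \<open>f\<close>.\<close>

definition unit :: "'ok \<times> 'al \<times> 'oj \<Rightarrow> ('ok \<times> 'al \<times> 'oj) \<times> 'ak \<times> 'cl \<times> 'aj \<times> 'ok \<times> 'al \<times> 'oj" where
  "unit = (\<lambda>(x, f, z). ((x, f, z), opc (x, f, z), id2 L f, idm J z, (tgt K (opc (x, f, z)), idm L (fob F z), z)))"

lemma unit_Hom: "(x, f, z) \<in> Obj CM \<Longrightarrow> unit (x, f, z) \<in> Hom CM"
  using opc_Hom[of x f z] src_opc[of x f z] fhom_opc[of x f z] tgt_opc[of x f z]
  by (simp add: unit_def)

lemma two_functor_incl: "two_functor PB CM (incl K L J P)"
  by unfold_locales (rule strict_2cat_pb strict_2cat_comma strict_2functor_incl)+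

sublocale CM: two_cat CM by unfold_locales (rule strict_2cat_comma)

text \<open>The unit has an identity in \<open>J\<close>, so whiskering determines the component
  \<open>\<gamma>\<close> in \<open>J\<close>. Between 1-cells of the pullback the compatibility law
  forces the component in \<open>K\<close> to lie over \<open>fcell F \<gamma>\<close>, and over
  this 2-cell opcartesianness makes whiskering bijective.\<close>

lemma unit_bij:
  assumes X: "(x, f, z) \<in> Obj CM" and n: "(n, t) \<in> Hom PB" "(n', t') \<in> Hom PB"
    and s: "src K n = tgt K (opc (x, f, z))" "src J t = z" "src K n' = tgt K (opc (x, f, z))" "src J t' = z"
    and e: "tgt K n = tgt K n'" "tgt J t = tgt J t'"
  shows "CM.whisker_bij (unit (x, f, z)) (fhom (incl K L J P) (n, t)) (fhom (incl K L J P) (n', t'))"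
  unfolding CM.whisker_bij_def
proof (intro allI impI; elim conjE)
  let ?h = "opc (x, f, z)"
  note h = opc_Hom[OF X] src_opc[OF X] fhom_opc[OF X] tgt_opc[OF X]
  have x: "x \<in> Obj K" "z \<in> Obj J" "f \<in> Hom L" "src L f = fob P x" "tgt L f = fob F z" using X by simp_all
  have Fn: "fhom F t = fhom P n" "fhom F t' = fhom P n'" using n by simp_all
  have nn: "n \<in> Hom K" "t \<in> Hom J" "n' \<in> Hom K" "t' \<in> Hom J" using n by simp_all
  fix \<rho> assume \<rho>: "\<rho> \<in> Cell CM" "dom2 CM \<rho> = cmp CM (fhom (incl K L J P) (n, t)) (unit (x, f, z))"
    "cod2 CM \<rho> = cmp CM (fhom (incl K L J P) (n', t')) (unit (x, f, z))"
  obtain \<rho>1 \<gamma> where r: "\<rho> = (cmp CM (fhom (incl K L J P) (n, t)) (unit (x, f, z)), \<rho>1, \<gamma>,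
      cmp CM (fhom (incl K L J P) (n', t')) (unit (x, f, z)))"
    using \<rho>(2,3) by (cases \<rho>) simp
  have rr: "\<rho>1 \<in> Cell K" "dom2 K \<rho>1 = cmp K n ?h" "cod2 K \<rho>1 = cmp K n' ?h"
    "\<gamma> \<in> Cell J" "dom2 J \<gamma> = t" "cod2 J \<gamma> = t'"
    using \<rho>(1) unfolding r by (simp_all add: unit_def h x Fn nn s e)
  \<comment> \<open>All fillers involved are identities, so the compatibility law of
    \<open>\<rho>\<close> becomes the equation that opcartesianness asks for.\<close>
  have eq: "fcell P \<rho>1 = hcmp L (fcell F \<gamma>) (id2 L f)"
    using \<rho>(1) unfolding r by (simp add: unit_def h x Fn nn s e rr)
  have U: "\<exists>!\<nu>. \<nu> \<in> Cell K \<and> dom2 K \<nu> = n \<and> cod2 K \<nu> = n' \<and> fcell P \<nu> = fcell F \<gamma> \<and> hcmp K \<nu> (id2 K ?h) = \<rho>1"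
    by (rule opc_strictly[OF X, unfolded P.strictly_opcartesian_def, THEN conjunct2, THEN conjunct2, THEN spec, THEN spec,
          THEN spec, THEN spec, THEN mp]) (use rr eq in \<open>simp add: h Fn nn s e\<close>)
  then obtain \<nu> where \<nu>: "\<nu> \<in> Cell K" "dom2 K \<nu> = n" "cod2 K \<nu> = n'" "fcell P \<nu> = fcell F \<gamma>" "hcmp K \<nu> (id2 K ?h) = \<rho>1"
    by blast
  show "\<exists>!\<mu>. \<mu> \<in> Cell CM \<and> dom2 CM \<mu> = fhom (incl K L J P) (n, t) \<and> cod2 CM \<mu> = fhom (incl K L J P) (n', t') \<and>
      hcmp CM \<mu> (id2 CM (unit (x, f, z))) = \<rho>"
  proof (rule ex1I)
    have "fcell (incl K L J P) (\<nu>, \<gamma>) \<in> Cell CM"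
      using strict_2functor_incl \<nu> rr unfolding strict_2functor_def by (metis pb_mem(3))
    then have c: "(fhom (incl K L J P) (n, t), \<nu>, \<gamma>, fhom (incl K L J P) (n', t')) \<in> Cell CM"
      using \<nu>(2,3) rr(5,6) by (simp only: incl_simps(3))
    have "hcmp CM (fhom (incl K L J P) (n, t), \<nu>, \<gamma>, fhom (incl K L J P) (n', t')) (id2 CM (unit (x, f, z))) = \<rho>"
      unfolding r using \<nu>(5) rr s h by (simp add: unit_def x nn)
    with c show "(fhom (incl K L J P) (n, t), \<nu>, \<gamma>, fhom (incl K L J P) (n', t')) \<in> Cell CM \<and>
        dom2 CM (fhom (incl K L J P) (n, t), \<nu>, \<gamma>, fhom (incl K L J P) (n', t')) = fhom (incl K L J P) (n, t) \<and>
        cod2 CM (fhom (incl K L J P) (n, t), \<nu>, \<gamma>, fhom (incl K L J P) (n', t')) = fhom (incl K L J P) (n', t') \<and>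
        hcmp CM (fhom (incl K L J P) (n, t), \<nu>, \<gamma>, fhom (incl K L J P) (n', t')) (id2 CM (unit (x, f, z))) = \<rho>"
      by (simp only: comma_ops simp_thms)
  next
    fix \<mu> assume m: "\<mu> \<in> Cell CM \<and> dom2 CM \<mu> = fhom (incl K L J P) (n, t) \<and> cod2 CM \<mu> = fhom (incl K L J P) (n', t') \<and>
      hcmp CM \<mu> (id2 CM (unit (x, f, z))) = \<rho>"
    then obtain \<mu>1 \<delta> where mu: "\<mu> = (fhom (incl K L J P) (n, t), \<mu>1, \<delta>, fhom (incl K L J P) (n', t'))"
      by (cases \<mu>) simp
    have d: "\<mu>1 \<in> Cell K" "dom2 K \<mu>1 = n" "cod2 K \<mu>1 = n'" "\<delta> \<in> Cell J" "dom2 J \<delta> = t" "cod2 J \<delta> = t'"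
      using conjunct1[OF m] unfolding mu by (simp_all add: nn s e h)
    have deq: "fcell P \<mu>1 = fcell F \<delta>"
      using conjunct1[OF m] unfolding mu by (simp add: nn s e h Fn d x)
    have "hcmp J \<delta> (id2 J (idm J z)) = \<gamma>" and w: "hcmp K \<mu>1 (id2 K ?h) = \<rho>1"
      using m unfolding mu r by (simp_all add: unit_def)
    then have "\<delta> = \<gamma>" using d s by simp
    moreover from this have "\<mu>1 = \<nu>" using ex1_eqD[OF U, of \<mu>1 \<nu>] d \<nu> deq w by simp
    ultimately show "\<mu> = (fhom (incl K L J P) (n, t), \<nu>, \<gamma>, fhom (incl K L J P) (n', t'))" by (simp add: mu)
  qed
qed

text \<open>Let \<open>h\<close> and \<open>h'\<close> be the lifts of \<open>f\<close> and
  \<open>f'\<close>. Then \<open>\<alpha>\<close> goes from \<open>F t\<close> after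
  \<open>P h\<close> to the image under \<open>P\<close> of \<open>h'\<close> after
  \<open>s\<close>: a lifting problem for \<open>h\<close>, admissible since \<open>\<alpha>\<close>
  is invertible. That the solution \<open>\<theta>\<close> lies over \<open>\<alpha>\<close> is the
  compatibility law for the filler with components \<open>\<theta>\<close> and an identity.\<close>

lemma unit_square:
  assumes X: "(x, f, z) \<in> Obj CM" and Y: "(x', f', z') \<in> Obj CM"
    and M: "((x, f, z), s, \<alpha>, t, (x', f', z')) \<in> Hom CM"
  shows "\<exists>n \<Theta>. (n, t) \<in> Hom PB \<and> src K n = tgt K (opc (x, f, z)) \<and> tgt K n = tgt K (opc (x', f', z')) \<and>
    iso2 CM \<Theta> \<and> dom2 CM \<Theta> = cmp CM (fhom (incl K L J P) (n, t)) (unit (x, f, z)) \<and>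
    cod2 CM \<Theta> = cmp CM (unit (x', f', z')) ((x, f, z), s, \<alpha>, t, (x', f', z'))"
proof -
  let ?h = "opc (x, f, z)" and ?h' = "opc (x', f', z')"
  note h = opc_Hom[OF X] src_opc[OF X] fhom_opc[OF X] tgt_opc[OF X]
  note h' = opc_Hom[OF Y] src_opc[OF Y] fhom_opc[OF Y] tgt_opc[OF Y]
  note m = M[simplified]
  have "\<exists>n \<theta>. n \<in> Hom K \<and> src K n = tgt K ?h \<and> tgt K n = tgt K (cmp K ?h' s) \<and> fhom P n = fhom F t \<and>
      iso2 K \<theta> \<and> dom2 K \<theta> = cmp K n ?h \<and> cod2 K \<theta> = cmp K ?h' s \<and> fcell P \<theta> = \<alpha>"
    by (rule opc_strictly[OF X, unfolded P.strictly_opcartesian_def, THEN conjunct2, THEN conjunct1, THEN spec, THEN spec,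
          THEN spec, THEN mp]) (use m invertible in \<open>simp add: h h'\<close>)
  then obtain n \<theta> where n: "n \<in> Hom K" "src K n = tgt K ?h" "tgt K n = tgt K (cmp K ?h' s)" "fhom P n = fhom F t"
    "iso2 K \<theta>" "dom2 K \<theta> = cmp K n ?h" "cod2 K \<theta> = cmp K ?h' s" "fcell P \<theta> = \<alpha>"
    by (elim exE conjE) (rule that)
  have nt: "tgt K n = tgt K ?h'" using n(3) m h' by simp
  have PB: "(n, t) \<in> Hom PB" using n m by simp
  have "tgt J t = z'" "src J t = z" using m by simp_all
  let ?T = "(cmp CM (fhom (incl K L J P) (n, t)) (unit (x, f, z)), \<theta>, id2 J t,
      cmp CM (unit (x', f', z')) ((x, f, z), s, \<alpha>, t, (x', f', z')))"
  have T: "?T = (((x, f, z), cmp K n ?h, id2 L (cmp L (fhom F t) f), t, (tgt K ?h', idm L (fob F z'), z')), \<theta>, id2 J t,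
      ((x, f, z), cmp K ?h' s, \<alpha>, t, (tgt K ?h', idm L (fob F z'), z')))"
    using n(1,2,4) nt m h h' by (simp add: unit_def)
  have c: "?T \<in> Cell CM"
    unfolding T using n P.dom.iso2_Cell[OF n(5)] nt m h h' by simp
  have "iso2 CM ?T"
    unfolding T by (rule comma_iso2[OF c[unfolded T] n(5) F.dom.iso2_id2]) (use m in simp)
  then show ?thesis using PB n(2) nt by (intro exI[of _ n] exI[of _ ?T]) simp
qed

lemma deformation_incl: "deformation PB CM (incl K L J P) unit"
proof -
  interpret I: two_functor PB CM "incl K L J P" by (rule two_functor_incl)
  let ?I = "incl K L J P"
  show ?thesis
  proof unfold_locales
    show "inj_on (fob ?I) (Obj PB)" "inj_on (fhom ?I) (Hom PB)" "inj_on (fcell ?I) (Cell PB)"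
      by (auto simp: inj_on_def)
  next
    fix g h c assume a: "g \<in> Hom PB" "h \<in> Hom PB" "c \<in> Cell CM" "dom2 CM c = fhom ?I g" "cod2 CM c = fhom ?I h"
    obtain s t where g: "g = (s, t)" by (cases g)
    obtain s' t' where h: "h = (s', t')" by (cases h)
    obtain \<phi> \<gamma> where c: "c = (fhom ?I (s, t), \<phi>, \<gamma>, fhom ?I (s', t'))" using a(4,5) g h by (cases c) simp
    have d: "\<phi> \<in> Cell K" "dom2 K \<phi> = s" "cod2 K \<phi> = s'" "\<gamma> \<in> Cell J" "dom2 J \<gamma> = t" "cod2 J \<gamma> = t'"
      using a(3) unfolding c by simp_all
    \<comment> \<open>The fillers of both boundary 1-cells are identities, so compatibility in the
      comma object is the matching condition of the pullback.\<close>
    have "fcell P \<phi> = fcell F \<gamma>" using a(1-3) d pb_parallel(3,4)[of s t] unfolding c g h by auto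
    then have "(\<phi>, \<gamma>) \<in> Cell PB" "c = fcell ?I (\<phi>, \<gamma>)" using d c by simp_all
    then show "c \<in> fcell ?I ` Cell PB" by blast
  next
    fix X assume "X \<in> Obj CM"
    then obtain x f z where X: "X = (x, f, z)" "(x, f, z) \<in> Obj CM" by (cases X) simp
    have "tgt CM (unit X) = fob ?I (tgt K (opc (x, f, z)), z)" "(tgt K (opc (x, f, z)), z) \<in> Obj PB"
      using opc_Hom[OF X(2)] tgt_opc[OF X(2)] X(2) by (simp_all add: X(1) unit_def)
    then have "tgt CM (unit X) \<in> fob ?I ` Obj PB" by blast
    then show "unit X \<in> Hom CM \<and> src CM (unit X) = X \<and> tgt CM (unit X) \<in> fob ?I ` Obj PB"
      using unit_Hom[OF X(2)] by (simp add: X(1)) (simp add: unit_def)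
  next
    fix b assume "b \<in> Obj PB"
    then obtain k j where "b = (k, j)" "k \<in> Obj K" "j \<in> Obj J" "fob P k = fob F j" by (cases b) simp
    then show "unit (fob ?I b) = idm CM (fob ?I b)" by (simp add: unit_def opc_def)
  next
    fix X u u' assume a: "X \<in> Obj CM" "u \<in> fhom ?I ` Hom PB" "u' \<in> fhom ?I ` Hom PB" "src CM u = tgt CM (unit X)"
      "src CM u' = tgt CM (unit X)" "tgt CM u = tgt CM u'"
    obtain x f z where X: "X = (x, f, z)" by (cases X)
    obtain n t where n: "u = fhom ?I (n, t)" "(n, t) \<in> Hom PB" using a(2) by (elim imageE) (metis surj_pair)
    obtain n' t' where n': "u' = fhom ?I (n', t')" "(n', t') \<in> Hom PB" using a(3) by (elim imageE) (metis surj_pair)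
    show "CM.whisker_bij (unit X) u u'"
      unfolding X n n' by (rule unit_bij) (use a n n' X in \<open>simp_all add: unit_def\<close>)
  next
    fix M assume M: "M \<in> Hom CM"
    then obtain x f z s \<alpha> t x' f' z' where m: "M = ((x, f, z), s, \<alpha>, t, (x', f', z'))" by (metis prod_cases3 surj_pair)
    have X: "(x, f, z) \<in> Obj CM" "(x', f', z') \<in> Obj CM" using M unfolding m by simp_all
    obtain n \<Theta> where n: "(n, t) \<in> Hom PB" "src K n = tgt K (opc (x, f, z))" "tgt K n = tgt K (opc (x', f', z'))"
      "iso2 CM \<Theta>" "dom2 CM \<Theta> = cmp CM (fhom ?I (n, t)) (unit (x, f, z))" "cod2 CM \<Theta> = cmp CM (unit (x', f', z')) M"
      using unit_square[OF X M[unfolded m], folded m] by (elim exE conjE) (rule that)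
    have e: "src CM (fhom ?I (n, t)) = tgt CM (unit (x, f, z))" "tgt CM (fhom ?I (n, t)) = tgt CM (unit (x', f', z'))"
      using n(1-3) M tgt_opc[OF X(1)] tgt_opc[OF X(2)] unfolding m by (simp_all add: unit_def)
    show "\<exists>g\<in>fhom ?I ` Hom PB. \<exists>t. src CM g = tgt CM (unit (src CM M)) \<and> tgt CM g = tgt CM (unit (tgt CM M)) \<and>
      iso2 CM t \<and> dom2 CM t = cmp CM g (unit (src CM M)) \<and> cod2 CM t = cmp CM (unit (tgt CM M)) M"
      by (intro bexI[of _ "fhom ?I (n, t)"] exI[of _ \<Theta>] imageI n(1)) (use n e m in \<open>simp del: comma_ops(4) incl_simps\<close>)
  qed
qed

end

theorem theorem1p1:
  fixes K :: "('ok,'ak,'ck) cat2" and L :: "('ol,'al,'cl) cat2" and J :: "('oj,'aj,'cj) cat2"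
    and P :: "('ok,'ak,'ck,'ol,'al,'cl) fun2" and F :: "('oj,'aj,'cj,'ol,'al,'cl) fun2"
  assumes "strict_2cat K" and "strict_2cat L" and "strict_2cat J"
    and "opfibration K L P"
    and "strict_2functor J L F"
    and "\<forall>a\<in>Cell L. iso2 L a"
  shows "homotopy_equivalence_map (classifying_space (pb K J P F))
           (classifying_space (comma K L J P F)) (B_map (comma K L J P F) (incl K L J P))"
proof -
  have "strict_2functor K L P" using assms(4) by (simp add: opfibration_def)
  then have "opfibration_cospan K L J P F"
    using assms by unfold_locales auto
  from deformation.homotopy_equivalence_B_map[OF opfibration_cospan.deformation_incl[OF this]]
  show ?thesis .
qed

end
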